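(* Suppose that $0<\lambda<1$ and $g$ is analytic on $\mathbb{D}$. Then the following conditions are equivalent: (i) $T_g:\mathcal{L}^{2,\lambda}\to B$ is bounded; (ii) $g\in B\mathcal{L}^{p,\lambda}$ for all $p\in(1,\infty)$; (iii) $g\in B\mathcal{L}^{p,\lambda}$ for some $p\in(1,\infty)$. Moreover, $\|T_g\|\approx M(g)$ (where $M(g)=M_p(g)$ is taken with any fixed $p\in(1,\infty)$).
   Context: $\mathbb{D}$ is the open unit disc in $\mathbb{C}$, $\partial\mathbb{D}$ the unit circle, $H(\mathbb{D})$ the space of analytic functions on $\mathbb{D}$, $dm(z)=\frac1\pi dx\,dy$. For an arc $I\subset\partial\mathbb{D}$, $|I|=\frac1{2\pi}\int_I|d\zeta|$ is its normalized length, $f_I=\frac1{|I|}\int_I f(\zeta)\frac{|d\zeta|}{2\pi}$, and $S(I)=\{z\in\mathbb{D}:1-|I|\le|z|<1,\ z/|z|\in I\}$ is its Carleson box (with $S(\partial\mathbb{D})=\mathbb{D}$). Analytic Morrey space: $\mathcal{L}^{2,\lambda}$ is the set of $f$ in the Hardy space $H^2$ (boundary values are used on $\partial\mathbb{D}$) with $\sup_{I\subset\partial\mathbb{D}}\frac1{|I|^\lambda}\int_I|f(\zeta)-f_I|^2\frac{|d\zeta|}{2\pi}<\infty$. For $0<\lambda<1$ it is known that $f\in H(\mathbb{D})$ lies in $\mathcal{L}^{2,\lambda}$ iff $\|f\|_{\mathcal{L}^{2,\lambda}}=|f(0)|+\sup_{I\subset\partial\mathbb{D}}\big(\frac1{|I|^\lambda}\int_{S(I)}|f'(z)|^2(1-|z|^2)\,dm(z)\big)^{1/2}<\infty$,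 and this is the norm used. Bloch space: $B=\{f\in H(\mathbb{D}):\|f\|_B=\sup_{z\in\mathbb{D}}(1-|z|^2)|f'(z)|<\infty\}$, a Banach space with norm $|f(0)|+\|f\|_B$. Bloch–Morrey type space: for $p>1$, $B\mathcal{L}^{p,\lambda}$ is the set of $g\in H(\mathbb{D})$ with $M(g)=M_p(g)=\sup_{I\subset\partial\mathbb{D}}\big(\frac1{|I|^{p-\lambda+1}}\int_{S(I)}|g'(z)|^2(1-|z|^2)^p\,dm(z)\big)^{1/2}<\infty$. For $g\in H(\mathbb{D})$, $T_gf(z)=\int_0^z f(w)g'(w)\,dw$ for $f\in H(\mathbb{D})$, $z\in\mathbb{D}$. That $T_g:X\to Y$ is bounded means it maps $X$ into $Y$ and is a bounded linear operator. $F\approx G$ means $C^{-1}G\le F\le CG$ with a constant $C>0$ depending only on $p,\lambda$. *)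

theory Defs
  imports "HOL-Complex_Analysis.Complex_Analysis"
begin

text \<open>
  Analytic functions on the unit disc are total functions of type \<^typ>\<open>complex \<Rightarrow> complex\<close>; only
  their values on \<^term>\<open>ball 0 1 :: complex set\<close> matter. Suprema and norms take values in
  \<^typ>\<open>ennreal\<close>, so that they are meaningful also when they are infinite.
\<close>

definition ennsqrt :: "ennreal \<Rightarrow> ennreal" where
  "ennsqrt x = (if x = \<infinity> then \<infinity> else ennreal (sqrt (enn2real x)))"

text \<open>Normalized arc length \<open>|d\<zeta>| / (2 \<pi>)\<close> on the unit circle, as a Borel measure on the plane.\<close>

definition circle_measure :: "complex measure" where
  "circle_measure = distr (uniform_measure lborel {0..2 * pi}) borel cis"

text \<open>The normalized area measure \<open>dm = dx dy / \<pi>\<close>.\<close>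

definition area_measure :: "complex measure" where
  "area_measure = scale_measure (ennreal (1 / pi)) lborel"

text \<open>
  Only closed arcs are used: end points are null sets for both measures, so they do not change
  the suprema below. The whole circle is the case \<open>b = a + 2 \<pi>\<close>.
\<close>

definition arcs :: "complex set set" where
  "arcs = {cis ` {a..b} | a b. a < b \<and> b \<le> a + 2 * pi}"

definition arc_len :: "complex set \<Rightarrow> real" where
  "arc_len I = measure circle_measure I"

definition arc_mean :: "(complex \<Rightarrow> complex) \<Rightarrow> complex set \<Rightarrow> complex" where
  "arc_mean F I = (1 / arc_len I) *\<^sub>R (LINT \<zeta>:I|circle_measure. F \<zeta>)"

definition carleson_box :: "complex set \<Rightarrow> complex set" where
  "carleson_box I =
     (if I = sphere 0 1 then ball 0 1
      else {z \<in> ball 0 1. 1 - arc_len I \<le> norm z \<and> z / of_real (norm z) \<in> I})"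

definition hardy2 :: "(complex \<Rightarrow> complex) set" where
  "hardy2 = {f. f holomorphic_on ball 0 1 \<and>
     (SUP r\<in>{0..<1::real}.
        \<integral>\<^sup>+\<zeta>. ennreal ((norm (f (of_real r * \<zeta>)))\<^sup>2) \<partial>circle_measure) < \<infinity>}"

text \<open>
  By Fatou's theorem every function in the Hardy space has such a boundary function, and it is
  unique almost everywhere.
\<close>

definition boundary_function :: "(complex \<Rightarrow> complex) \<Rightarrow> (complex \<Rightarrow> complex) \<Rightarrow> bool" where
  "boundary_function f F \<longleftrightarrow> F \<in> borel_measurable borel \<and>
     (AE \<zeta> in circle_measure. ((\<lambda>r::real. f (of_real r * \<zeta>)) \<longlongrightarrow> F \<zeta>) (at_left 1))"

definition morrey :: "real \<Rightarrow> (complex \<Rightarrow> complex) set" where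
  "morrey lam = {f \<in> hardy2. \<exists>F. boundary_function f F \<and>
     (SUP I\<in>arcs. (\<integral>\<^sup>+\<zeta>\<in>I. ennreal ((norm (F \<zeta> - arc_mean F I))\<^sup>2) \<partial>circle_measure)
        / ennreal (arc_len I powr lam)) < \<infinity>}"

text \<open>
  The Carleson-type norm; for \<open>0 < lam < 1\<close> it is finite exactly on the functions
  in \<^term>\<open>morrey lam\<close>.
\<close>

definition morrey_norm :: "real \<Rightarrow> (complex \<Rightarrow> complex) \<Rightarrow> ennreal" where
  "morrey_norm lam f = ennreal (norm (f 0)) +
     (SUP I\<in>arcs. ennsqrt
        ((\<integral>\<^sup>+z\<in>carleson_box I. ennreal ((norm (deriv f z))\<^sup>2 * (1 - (norm z)\<^sup>2)) \<partial>area_measure)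
          / ennreal (arc_len I powr lam)))"

definition bloch_seminorm :: "(complex \<Rightarrow> complex) \<Rightarrow> ennreal" where
  "bloch_seminorm f = (SUP z\<in>ball 0 1. ennreal ((1 - (norm z)\<^sup>2) * norm (deriv f z)))"

definition bloch :: "(complex \<Rightarrow> complex) set" where
  "bloch = {f. f holomorphic_on ball 0 1 \<and> bloch_seminorm f < \<infinity>}"

definition bloch_norm :: "(complex \<Rightarrow> complex) \<Rightarrow> ennreal" where
  "bloch_norm f = ennreal (norm (f 0)) + bloch_seminorm f"

definition bm_seminorm :: "real \<Rightarrow> real \<Rightarrow> (complex \<Rightarrow> complex) \<Rightarrow> ennreal" where
  "bm_seminorm p lam g =
     (SUP I\<in>arcs. ennsqrt
        ((\<integral>\<^sup>+z\<in>carleson_box I.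
             ennreal ((norm (deriv g z))\<^sup>2 * (1 - (norm z)\<^sup>2) powr p) \<partial>area_measure)
          / ennreal (arc_len I powr (p - lam + 1))))"

definition bloch_morrey :: "real \<Rightarrow> real \<Rightarrow> (complex \<Rightarrow> complex) set" where
  "bloch_morrey p lam = {g. g holomorphic_on ball 0 1 \<and> bm_seminorm p lam g < \<infinity>}"

definition T_op :: "(complex \<Rightarrow> complex) \<Rightarrow> (complex \<Rightarrow> complex) \<Rightarrow> complex \<Rightarrow> complex" where
  "T_op g f z = contour_integral (linepath 0 z) (\<lambda>w. f w * deriv g w)"

text \<open>
  Bounded linear operators between spaces of functions on the disc, with linearity required on
  the disc only, since functions agreeing there are identified.
\<close>

definition bounded_operator ::
  "(complex \<Rightarrow> complex) set \<Rightarrow> ((complex \<Rightarrow> complex) \<Rightarrow> ennreal) \<Rightarrow>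
   (complex \<Rightarrow> complex) set \<Rightarrow> ((complex \<Rightarrow> complex) \<Rightarrow> ennreal) \<Rightarrow>
   ((complex \<Rightarrow> complex) \<Rightarrow> complex \<Rightarrow> complex) \<Rightarrow> bool" where
  "bounded_operator X nX Y nY T \<longleftrightarrow>
     (\<forall>f\<in>X. T f \<in> Y) \<and>
     (\<forall>f\<in>X. \<forall>h\<in>X. \<forall>z\<in>ball 0 1. T (\<lambda>w. f w + h w) z = T f z + T h z) \<and>
     (\<forall>c. \<forall>f\<in>X. \<forall>z\<in>ball 0 1. T (\<lambda>w. c * f w) z = c * T f z) \<and>
     (\<exists>K\<ge>0. \<forall>f\<in>X. nY (T f) \<le> ennreal K * nX f)"

definition operator_norm ::
  "(complex \<Rightarrow> complex) set \<Rightarrow> ((complex \<Rightarrow> complex) \<Rightarrow> ennreal) \<Rightarrow>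
   ((complex \<Rightarrow> complex) \<Rightarrow> ennreal) \<Rightarrow>
   ((complex \<Rightarrow> complex) \<Rightarrow> complex \<Rightarrow> complex) \<Rightarrow> ennreal" where
  "operator_norm X nX nY T = (SUP f\<in>{f \<in> X. nX f \<le> 1}. nY (T f))"

abbreviation T_bounded :: "real \<Rightarrow> (complex \<Rightarrow> complex) \<Rightarrow> bool" where
  "T_bounded lam g \<equiv> bounded_operator (morrey lam) (morrey_norm lam) bloch bloch_norm (T_op g)"

abbreviation T_norm :: "real \<Rightarrow> (complex \<Rightarrow> complex) \<Rightarrow> ennreal" where
  "T_norm lam g \<equiv> operator_norm (morrey lam) (morrey_norm lam) bloch_norm (T_op g)"

end

theory Submission
  imports Defs
begin

text \<open>
  All three conditions are equivalent to the pointwise bound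
  \<open>|g'(z)| = O((1 - |z|)\<^bsup>-(1+\<lambda>)/2\<^esup>)\<close>, with comparable constants, and \<open>p\<close> does not occur in it.

  For \<open>M\<^sub>p(g)\<close>: a disc of radius \<open>(1 - |z|)/2\<close> about \<open>z\<close> lies in a Carleson box of size comparable to
  \<open>1 - |z|\<close>, so the sub-mean value property of \<open>|g'|\<^sup>2\<close> gives the pointwise bound; conversely the
  bound is integrated over boxes.

  For \<open>T\<^sub>g\<close>: since \<open>(T\<^sub>g f)' = f g'\<close>, one needs that point evaluation at \<open>z\<close> on the Morrey space has
  norm comparable to \<open>(1 - |z|)\<^bsup>(\<lambda>-1)/2\<^esup>\<close>. The upper bound follows by applying the sub-mean value
  argument to \<open>f'\<close> and integrating along a radius; the functions
  \<open>w \<mapsto> (1 - w cnj z)\<^bsup>(\<lambda>-1)/2\<^esup>\<close> attain it up to a constant.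

  That \<open>T\<^sub>g\<close> maps into the Bloch space also needs \<open>|f(z)| = O((1 - |z|)\<^bsup>(\<lambda>-1)/2\<^esup>)\<close> for every \<open>f\<close> whose
  boundary values have Morrey oscillation. The means of \<open>|F|\<close> over dyadic arcs of length \<open>t\<close> grow at
  most like \<open>t\<^bsup>(\<lambda>-1)/2\<^esup>\<close>, and these are summed against the Cauchy kernel; because the power is
  negative, the Cauchy kernel loses no logarithm here.
\<close>

section \<open>Normalized arc length on the circle\<close>

text \<open>\<open>morrey lam\<close> is defined by boundary oscillation, \<open>morrey_norm\<close>
  by a supremum of area integrals, and the proof treats the two independently. Growth of Morrey
  functions is therefore shown twice: linearly in \<open>morrey_norm\<close>, for the norm
  inequality, and from the oscillation with a constant depending on f, for mapping into the Bloch
  space. Likewise the test functions enter \<open>morrey lam\<close> by boundedness, and their norm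
  is estimated separately.

  The exponents show why p disappears: the disc about z bounds |g'(z)|^2 (1-|z|)^(p+2) by a multiple
  of |I|^(p-\<lambda>+1) with |I| comparable to 1-|z|, which leaves |g'(z)|^2 of order
  (1-|z|)^(-\<lambda>-1). The exponents -(\<lambda>+1)/2 of g' and (\<lambda>-1)/2 of point
  evaluation add up to -1, which the Bloch weight cancels.

  Functions are total and arbitrary off the disc, so cut-offs supply Borel measurability.\<close>

lemma norm_lebesgue_integral_le_nn_integral:
  fixes h :: "'a \<Rightarrow> 'b::{banach, second_countable_topology}"
  shows "ennreal (norm (LINT x|M. h x)) \<le> (\<integral>\<^sup>+x. ennreal (norm (h x)) \<partial>M)"
  \<comment> \<open>A non-integrable \<open>h\<close> has Bochner integral 0 by default.\<close>
  by (cases "integrable M h") (rule integral_norm_bound_ennreal, simp_all add: not_integrable_integral_eq)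

lemma nn_integral_circle:
  assumes [measurable]: "h \<in> borel_measurable borel"
  shows "(\<integral>\<^sup>+\<zeta>. h \<zeta> \<partial>circle_measure) = (\<integral>\<^sup>+t\<in>{0..2 * pi}. h (cis t) \<partial>lborel) / ennreal (2 * pi)"
proof -
  have [measurable]: "cis \<in> borel_measurable borel"
    by (intro borel_measurable_continuous_onI continuous_intros)
  show ?thesis
    unfolding circle_measure_def
    by (subst nn_integral_distr; simp add: uniform_measure_def nn_integral_density
        divide_ennreal_def mult.commute nn_integral_cmult[symmetric] mult.left_commute mult.assoc
        indicator_def if_distrib cong: if_cong)
qed

lemma sets_circle [measurable_cong, simp]: "sets circle_measure = sets borel"
  by (simp add: circle_measure_def)

lemma space_circle [simp]: "space circle_measure = UNIV"
  by (simp add: circle_measure_def)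

lemma cis_measurable [measurable]: "cis \<in> borel_measurable borel"
  by (intro borel_measurable_continuous_onI continuous_intros)

lemma cnj_measurable [measurable]: "cnj \<in> borel_measurable borel"
  by (intro borel_measurable_continuous_onI continuous_intros)

lemma emeasure_circle_UNIV [simp]: "emeasure circle_measure UNIV = 1"
  using nn_integral_circle[of "\<lambda>_. 1"] by (simp add: divide_ennreal)

interpretation circle: finite_measure circle_measure
  by (rule finite_measureI) simp

lemma AE_circle_norm: "AE \<zeta> in circle_measure. norm \<zeta> = 1"
  unfolding circle_measure_def
  by (subst AE_distr_iff) (auto intro!: AE_I2)

lemma nn_integral_shift_real:
  fixes h :: "real \<Rightarrow> ennreal"
  assumes [measurable]: "h \<in> borel_measurable borel"
  shows "(\<integral>\<^sup>+t. h (c + t) \<partial>lborel) = (\<integral>\<^sup>+t. h t \<partial>lborel)"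
  using nn_integral_real_affine[of h 1 c] by simp

lemma cis_periodic: "cis (t + 2 * pi * of_int k) = cis t"
  by (simp only: cis_mult[symmetric]) (simp add: cis_multiple_2pi)

lemma nn_integral_Icc_split:
  fixes h :: "real \<Rightarrow> ennreal"
  assumes [measurable]: "h \<in> borel_measurable borel" and "a \<le> b" "b \<le> c"
  shows "(\<integral>\<^sup>+t\<in>{a..c}. h t \<partial>lborel) = (\<integral>\<^sup>+t\<in>{a..b}. h t \<partial>lborel) + (\<integral>\<^sup>+t\<in>{b..c}. h t \<partial>lborel)"
proof -
  have "(\<integral>\<^sup>+t\<in>{a..c}. h t \<partial>lborel) = (\<integral>\<^sup>+t. h t * indicator {a..b} t + h t * indicator {b..c} t \<partial>lborel)"
    by (rule nn_integral_cong_AE)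
      (use AE_lborel_singleton[of b] in eventually_elim, use assms in \<open>auto simp: indicator_def\<close>)
  then show ?thesis by (simp add: nn_integral_add)
qed

text \<open>Periodicity of \<open>cis\<close>. The window starting at \<open>a\<close> is what
  allows the parameter interval of an arc to lie inside a single period.\<close>

lemma nn_integral_circle_shifted:
  assumes [measurable]: "h \<in> borel_measurable borel"
  shows "(\<integral>\<^sup>+\<zeta>. h \<zeta> \<partial>circle_measure) = (\<integral>\<^sup>+t\<in>{a..a + 2 * pi}. h (cis t) \<partial>lborel) / ennreal (2 * pi)"
proof -
  have shift: "(\<integral>\<^sup>+t\<in>{u + 2 * pi * of_int k..v + 2 * pi * of_int k}. h (cis t) \<partial>lborel)
      = (\<integral>\<^sup>+t\<in>{u..v}. h (cis t) \<partial>lborel)" for u v and k :: int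
  proof -
    have "(\<integral>\<^sup>+t\<in>{u + 2 * pi * of_int k..v + 2 * pi * of_int k}. h (cis t) \<partial>lborel) =
      (\<integral>\<^sup>+t. h (cis (2 * pi * of_int k + t)) *
        indicator {u + 2 * pi * of_int k..v + 2 * pi * of_int k} (2 * pi * of_int k + t) \<partial>lborel)"
      by (subst nn_integral_shift_real) auto
    also have "\<dots> = (\<integral>\<^sup>+t\<in>{u..v}. h (cis t) \<partial>lborel)"
      using cis_periodic[of _ k] by (intro nn_integral_cong) (auto simp: indicator_def add.commute)
    finally show ?thesis .
  qed
  \<comment> \<open>The window is cut at the one point \<open>d + 2 * pi\<close> congruent to 0 in
    it; moving the right piece back by a period gives the standard window translated by
    \<open>d\<close>.\<close>
  define k where "k = \<lfloor>a / (2 * pi)\<rfloor>"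
  define d where "d = 2 * pi * of_int k"
  have "of_int k \<le> a / (2*pi)" "a / (2*pi) < of_int k + 1" unfolding k_def by linarith+
  then have d: "d \<le> a" "a \<le> d + 2 * pi" by (auto simp: d_def field_simps)
  have "(\<integral>\<^sup>+t\<in>{a..a + 2 * pi}. h (cis t) \<partial>lborel) =
    (\<integral>\<^sup>+t\<in>{a..d + 2 * pi}. h (cis t) \<partial>lborel) + (\<integral>\<^sup>+t\<in>{d + 2 * pi..a + 2 * pi}. h (cis t) \<partial>lborel)"
    using d by (intro nn_integral_Icc_split) auto
  also have "(\<integral>\<^sup>+t\<in>{d + 2 * pi..a + 2 * pi}. h (cis t) \<partial>lborel) = (\<integral>\<^sup>+t\<in>{d..a}. h (cis t) \<partial>lborel)"
    using shift[of d 1 a] by simp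
  also have "(\<integral>\<^sup>+t\<in>{a..d + 2 * pi}. h (cis t) \<partial>lborel) + \<dots> = (\<integral>\<^sup>+t\<in>{d..d + 2 * pi}. h (cis t) \<partial>lborel)"
    using d by (subst nn_integral_Icc_split[of _ d a "d + 2 * pi"]) (auto simp: add.commute)
  also have "\<dots> = (\<integral>\<^sup>+t\<in>{0..2 * pi}. h (cis t) \<partial>lborel)"
    using shift[of 0 k "2 * pi"] by (simp add: d_def add.commute)
  finally show ?thesis by (simp add: nn_integral_circle)
qed

lemma compact_arc: "compact (cis ` {a..b})"
  by (intro compact_continuous_image continuous_intros) auto

lemma emeasure_arc:
  assumes "a \<le> b" "b \<le> a + 2 * pi"
  shows "emeasure circle_measure (cis ` {a..b}) = ennreal ((b - a) / (2 * pi))"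
proof -
  have [measurable]: "cis ` {a..b} \<in> sets borel"
    by (intro borel_compact compact_arc)
  \<comment> \<open>Without the two ends of the window, |t - s| < 2 \<pi> holds strictly, so the
    number of turns between \<open>s\<close> and \<open>t\<close> is 0. The ends are null for the
    measure.\<close>
  have eq: "t \<in> {a..b}" if "cis t \<in> cis ` {a..b}" "t \<in> {a..a + 2 * pi}" "t \<noteq> a + 2 * pi" "t \<noteq> a" for t
  proof -
    from that(1) obtain s where s: "s \<in> {a..b}" "cis t = cis s" by blast
    then have "cis (t - s) = 1" by (simp flip: cis_divide)
    then have "cos (t - s) = 1" by (simp add: complex_eq_iff)
    then obtain k :: int where k: "t - s = of_int k * (2 * pi)"
      by (auto simp: cos_one_2pi_int)
    have "a < t" "t < a + 2 * pi" using that by simp_all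
    then have "\<bar>t - s\<bar> < 2 * pi" using s(1) assms by auto
    then have "\<bar>of_int k :: real\<bar> < 1" unfolding k by (simp add: abs_mult)
    then have "k = 0" by linarith
    with k s show ?thesis by simp
  qed
  have "emeasure circle_measure (cis ` {a..b}) = (\<integral>\<^sup>+\<zeta>. indicator (cis ` {a..b}) \<zeta> \<partial>circle_measure)"
    by (subst nn_integral_indicator) auto
  also have "\<dots> = (\<integral>\<^sup>+t\<in>{a..a + 2 * pi}. indicator (cis ` {a..b}) (cis t) \<partial>lborel) / ennreal (2 * pi)"
    by (rule nn_integral_circle_shifted) auto
  also have "(\<integral>\<^sup>+t\<in>{a..a + 2 * pi}. indicator (cis ` {a..b}) (cis t) \<partial>lborel) = (\<integral>\<^sup>+t. indicator {a..b} t \<partial>lborel)"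
  proof (rule nn_integral_cong_AE, use AE_lborel_singleton[of "a + 2 * pi"] AE_lborel_singleton[of a] in eventually_elim)
    fix t assume "t \<noteq> a + 2 * pi" "t \<noteq> a"
    then have "cis t \<in> cis ` {a..b} \<and> t \<in> {a..a + 2 * pi} \<longleftrightarrow> t \<in> {a..b}"
      using eq[of t] assms(2) by fastforce
    then show "indicator (cis ` {a..b}) (cis t) * indicator {a..a + 2 * pi} t = (indicator {a..b} t :: ennreal)"
      unfolding indicator_def by (simp only: of_bool_conj[symmetric])
  qed
  also have "\<dots> / ennreal (2 * pi) = ennreal ((b - a) / (2 * pi))"
    using assms by (simp add: divide_ennreal)
  finally show ?thesis .
qed

lemma arc_len_arc:
  assumes "a \<le> b" "b \<le> a + 2 * pi"
  shows "arc_len (cis ` {a..b}) = (b - a) / (2 * pi)"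
  using emeasure_arc[OF assms] assms by (simp add: arc_len_def measure_def)

lemma norm_cis_minus_1: "norm (cis t - 1) = 2 * \<bar>sin (t / 2)\<bar>"
proof -
  have "(norm (cis t - 1))\<^sup>2 = (cos t - 1)\<^sup>2 + (sin t)\<^sup>2" by (simp add: cmod_power2)
  also have "\<dots> = 2 - 2 * cos t"
    using sin_cos_squared_add[of t] by (simp add: power2_eq_square algebra_simps)
  also have "\<dots> = (2 * \<bar>sin (t / 2)\<bar>)\<^sup>2"
    using cos_double_sin[of "t/2"] by (simp add: power2_eq_square)
  finally show ?thesis by (subst (asm) power2_eq_iff_nonneg) auto
qed

lemma norm_cis_diff_le: "norm (cis s - cis t) \<le> \<bar>s - t\<bar>"
proof -
  have "cis s - cis t = cis t * (cis (s - t) - 1)" by (simp add: algebra_simps cis_mult)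
  then have "norm (cis s - cis t) = 2 * \<bar>sin ((s - t) / 2)\<bar>"
    by (simp add: norm_mult norm_cis_minus_1)
  also have "\<dots> \<le> \<bar>s - t\<bar>" using abs_sin_x_le_abs_x[of "(s - t)/2"] by simp
  finally show ?thesis .
qed

text \<open>Jordan's inequality: the sine is concave on [0, \<pi>/2] and so lies above its
  chord.\<close>

lemma sin_ge_jordan:
  fixes x :: real
  assumes "0 \<le> x" "x \<le> pi / 2"
  shows "2 * x / pi \<le> sin x"
proof -
  have cv: "convex_on {0..pi/2} (\<lambda>x. - sin x)"
    by (rule f''_ge0_imp_convex[of _ _ "\<lambda>x. - cos x" "\<lambda>x. sin x"])
       (auto intro!: derivative_eq_intros sin_ge_zero)
  have "- sin ((1 - 2 * x / pi) *\<^sub>R 0 + (2 * x / pi) *\<^sub>R (pi / 2)) \<le>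
    (1 - 2 * x / pi) * (- sin 0) + (2 * x / pi) * (- sin (pi / 2))"
    by (rule convex_onD[OF cv]) (use assms in \<open>auto simp: field_simps\<close>)
  then show ?thesis by simp
qed

lemma unit_circle_arc:
  assumes "norm \<zeta> = 1"
  shows "\<exists>s. \<bar>s\<bar> \<le> pi \<and> \<zeta> = cis (\<theta> + s)"
proof -
  define s where "s = Arg (\<zeta> * cis (- \<theta>))"
  have nz: "\<zeta> * cis (- \<theta>) \<noteq> 0" "norm (\<zeta> * cis (- \<theta>)) = 1" using assms by (auto simp: norm_mult)
  have s: "- pi < s" "s \<le> pi" "cis s = \<zeta> * cis (- \<theta>)"
    using Arg_bounded[of "\<zeta> * cis (- \<theta>)"] cis_Arg[OF nz(1)] nz by (auto simp: s_def sgn_div_norm)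
  have "cis (\<theta> + s) = cis \<theta> * (\<zeta> * cis (- \<theta>))" by (simp only: s(3)[symmetric] cis_mult)
  also have "\<dots> = \<zeta> * (cis \<theta> * cis (- \<theta>))" by (simp only: ac_simps)
  finally have "\<zeta> = cis (\<theta> + s)" by (simp add: cis_mult)
  with s show ?thesis by (intro exI[of _ s]) auto
qed

text \<open>Outside an arc of normalised length t centred at \<open>cis \<theta>\<close> the angle
  to the centre exceeds \<pi> t, and Jordan's inequality turns the angle into a chord. This converts
  Euclidean closeness into membership in an arc.\<close>

lemma chord_ge:
  assumes "norm \<zeta> = 1" "0 \<le> t" "\<zeta> \<notin> cis ` {\<theta> - pi * t..\<theta> + pi * t}"
  shows "2 * t \<le> norm (\<zeta> - cis \<theta>)"
proof -
  obtain s where s: "\<bar>s\<bar> \<le> pi" and z: "\<zeta> = cis (\<theta> + s)"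
    using unit_circle_arc[OF assms(1)] by blast
  with assms have "\<bar>s\<bar> > pi * t" by (force simp: image_iff abs_if)
  then have "2 * t \<le> 2 * (2 * (\<bar>s\<bar> / 2) / pi)" by (simp add: field_simps)
  also have "\<dots> \<le> 2 * sin (\<bar>s\<bar> / 2)"
    using sin_ge_jordan[of "\<bar>s\<bar> / 2"] s by (intro mult_left_mono) auto
  also have "\<dots> \<le> 2 * \<bar>sin (s / 2)\<bar>" by (cases "s \<ge> 0") auto
  also have "\<dots> = norm (cis \<theta> * (cis s - 1))" by (simp add: norm_mult norm_cis_minus_1)
  also have "\<dots> = norm (\<zeta> - cis \<theta>)" by (simp add: z algebra_simps cis_mult)
  finally show ?thesis .
qed

lemma integral_circle:
  fixes h :: "complex \<Rightarrow> complex"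
  assumes [measurable]: "h \<in> borel_measurable borel"
  shows "(LINT \<zeta>|circle_measure. h \<zeta>) = (LINT t:{0..2 * pi}|lborel. h (cis t)) / of_real (2 * pi)"
proof -
  have d: "uniform_measure lborel {0..2 * pi} =
      density lborel (\<lambda>x. ennreal (indicator {0..2 * pi} x / (2 * pi)))"
    unfolding uniform_measure_def
    by (intro density_cong) (auto simp: indicator_def divide_ennreal ennreal_1[symmetric] simp del: ennreal_1)
  have "(LINT \<zeta>|circle_measure. h \<zeta>) = (LINT t|uniform_measure lborel {0..2 * pi}. h (cis t))"
    unfolding circle_measure_def by (subst integral_distr) auto
  also have "\<dots> = (LINT t|lborel. (indicator {0..2 * pi} t / (2 * pi)) *\<^sub>R h (cis t))"
    unfolding d by (subst integral_density) auto
  also have "\<dots> = (LINT t|lborel. (1 / (2 * pi)) *\<^sub>R (indicator {0..2 * pi} t *\<^sub>R h (cis t)))"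
    by (intro Bochner_Integration.integral_cong) auto
  also have "\<dots> = (1 / (2 * pi)) *\<^sub>R (LINT t:{0..2 * pi}|lborel. h (cis t))"
    unfolding set_lebesgue_integral_def by (subst integral_scaleR_right) auto
  finally show ?thesis by (simp add: scaleR_conv_of_real)
qed

text \<open>Cauchy's formula written for arc length: on the circle d\<zeta> = i \<zeta> |d\<zeta>|
  and \<zeta> - z = \<zeta> (1 - z cnj \<zeta>), so the factor \<zeta> cancels. At z = 0 it is the
  mean value property; for general z it feeds the Hardy space estimate.\<close>

lemma cauchy_circle:
  fixes h :: "complex \<Rightarrow> complex"
  assumes h: "h holomorphic_on S" "open S" "cball 0 1 \<subseteq> S" and z: "norm z < 1"
    and hm[measurable]: "h \<in> borel_measurable borel"
  shows "(LINT \<zeta>|circle_measure. h \<zeta> / (1 - z * cnj \<zeta>)) = h z"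
proof -
  have c: "continuous_on (cball 0 1) h"
    using h holomorphic_on_imp_continuous_on holomorphic_on_subset by blast
  have nz: "cis t \<noteq> z" for t using z by auto
  have "((\<lambda>u. h u / (u - z)) has_contour_integral 2 * of_real pi * \<i> * h z) (circlepath 0 1)"
    using Cauchy_integral_circlepath[of 0 1 h z] c h z
    by (simp add: holomorphic_on_subset[OF h(1)] subset_trans[OF ball_subset_cball])
  then have "((\<lambda>t. h (cis t) / (cis t - z) * \<i> * cis t) has_integral 2 * of_real pi * \<i> * h z) {0..2*pi}"
    unfolding circlepath_def by (subst (asm) has_contour_integral_part_circlepath_iff) auto
  then have "((\<lambda>t. (1/\<i>) * (h (cis t) / (cis t - z) * \<i> * cis t)) has_integral (1/\<i>) * (2 * of_real pi * \<i> * h z)) {0..2*pi}"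
    by (rule has_integral_mult_right)
  also have "(1/\<i>) * (2 * of_real pi * \<i> * h z) = of_real (2 * pi) * h z" by simp
  finally have hi: "((\<lambda>t. h (cis t) / (1 - z * cnj (cis t))) has_integral of_real (2 * pi) * h z) {0..2*pi}"
  proof (rule has_integral_eq[rotated])
    fix t :: real
    have "(cis t - z) = cis t * (1 - z * cnj (cis t))"
      by (simp add: algebra_simps cis_cnj cis_mult)
    moreover have "\<i> * (h (cis t) * \<i>) = - h (cis t)" by (simp add: complex_eq_iff)
    ultimately show "(1/\<i>) * (h (cis t) / (cis t - z) * \<i> * cis t) = h (cis t) / (1 - z * cnj (cis t))"
      by simp
  qed
  have "1 - z * cnj (cis t) \<noteq> 0" for t
  proof
    assume "1 - z * cnj (cis t) = 0"
    then have "norm (z * cnj (cis t)) = 1" by (metis eq_iff_diff_eq_0 norm_one)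
    then show False using z by (simp add: norm_mult)
  qed
  moreover have "continuous_on {0..2*pi} (\<lambda>t. h (cis t))"
    by (rule continuous_on_compose2[OF c]) (auto intro!: continuous_intros)
  ultimately have "continuous_on {0..2*pi} (\<lambda>t. h (cis t) / (1 - z * cnj (cis t)))"
    by (intro continuous_intros) auto
  then have si: "set_integrable lborel {0..2*pi} (\<lambda>t. h (cis t) / (1 - z * cnj (cis t)))"
    by (rule borel_integrable_atLeastAtMost')
  have "(LINT t:{0..2 * pi}|lborel. h (cis t) / (1 - z * cnj (cis t))) = of_real (2 * pi) * h z"
    using set_borel_integral_eq_integral(2)[OF si] integral_unique[OF hi] by simp
  then show ?thesis
    by (subst integral_circle) auto
qed

section \<open>Area measure and the sub-mean value property\<close>

lemma Complex_measurable [measurable]: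
  "(\<lambda>(x, y). Complex x y) \<in> borel_measurable (borel \<Otimes>\<^sub>M borel)"
  unfolding borel_prod Complex_eq case_prod_beta
  by (intro borel_measurable_continuous_onI continuous_intros)

lemma lborel_complex: "(lborel :: complex measure) = distr (lborel \<Otimes>\<^sub>M lborel) borel (\<lambda>(x, y). Complex x y)"
proof (rule lborel_eqI)
  fix l u :: complex
  assume le: "\<And>b. b \<in> Basis \<Longrightarrow> l \<bullet> b \<le> u \<bullet> b"
  then have le': "Re l \<le> Re u" "Im l \<le> Im u" using le[of 1] le[of \<i>] by (auto simp: Basis_complex_def)
  have "(\<lambda>(x, y). Complex x y) -` box l u \<inter> space (lborel \<Otimes>\<^sub>M lborel) = {Re l<..<Re u} \<times> {Im l<..<Im u}"
    by (auto simp: box_def Basis_complex_def space_pair_measure)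
  then have "emeasure (distr (lborel \<Otimes>\<^sub>M lborel) borel (\<lambda>(x, y). Complex x y)) (box l u) =
      emeasure (lborel \<Otimes>\<^sub>M lborel) ({Re l<..<Re u} \<times> {Im l<..<Im u})"
    by (subst emeasure_distr) auto
  also have "\<dots> = ennreal (Re u - Re l) * ennreal (Im u - Im l)"
    using le' by (subst lborel.emeasure_pair_measure_Times) auto
  also have "\<dots> = ennreal (\<Prod>b\<in>Basis. (u - l) \<bullet> b)"
    using le' by (simp add: Basis_complex_def ennreal_mult)
  finally show "emeasure (distr (lborel \<Otimes>\<^sub>M lborel) borel (\<lambda>(x, y). Complex x y)) (box l u) = \<dots>" .
qed simp

lemma nn_integral_complex:
  fixes h :: "complex \<Rightarrow> ennreal"
  assumes [measurable]: "h \<in> borel_measurable borel"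
  shows "(\<integral>\<^sup>+z. h z \<partial>lborel) = (\<integral>\<^sup>+x. \<integral>\<^sup>+y. h (Complex x y) \<partial>lborel \<partial>lborel)"
    and "(\<integral>\<^sup>+z. h z \<partial>lborel) = (\<integral>\<^sup>+y. \<integral>\<^sup>+x. h (Complex x y) \<partial>lborel \<partial>lborel)"
proof -
  have eq: "(\<integral>\<^sup>+z. h z \<partial>lborel) = (\<integral>\<^sup>+p. h (Complex (fst p) (snd p)) \<partial>(lborel \<Otimes>\<^sub>M lborel))"
    by (subst lborel_complex, subst nn_integral_distr) (auto simp: case_prod_beta)
  have m: "(\<lambda>p. h (Complex (fst p) (snd p))) \<in> borel_measurable (lborel \<Otimes>\<^sub>M lborel)"
    using measurable_compose[OF Complex_measurable assms] by (simp add: case_prod_beta cong: measurable_cong_sets)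
  show "(\<integral>\<^sup>+z. h z \<partial>lborel) = (\<integral>\<^sup>+x. \<integral>\<^sup>+y. h (Complex x y) \<partial>lborel \<partial>lborel)"
    unfolding eq using lborel.nn_integral_fst[OF m] by simp
  show "(\<integral>\<^sup>+z. h z \<partial>lborel) = (\<integral>\<^sup>+y. \<integral>\<^sup>+x. h (Complex x y) \<partial>lborel \<partial>lborel)"
    unfolding eq using lborel_pair.nn_integral_snd[OF m] by simp
qed

text \<open>On each horizontal or vertical slice a shear is a translation, so Fubini reduces the
  claim to translation invariance on the line.\<close>

lemma nn_integral_shear:
  fixes h :: "complex \<Rightarrow> ennreal"
  assumes [measurable]: "h \<in> borel_measurable borel"
  shows "(\<integral>\<^sup>+z. h (Complex (Re z + t * Im z) (Im z)) \<partial>lborel) = (\<integral>\<^sup>+z. h z \<partial>lborel)"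
    and "(\<integral>\<^sup>+z. h (Complex (Re z) (Im z + t * Re z)) \<partial>lborel) = (\<integral>\<^sup>+z. h z \<partial>lborel)"
proof -
  have c: "continuous_on UNIV (\<lambda>z. Complex (Re z + t * Im z) (Im z))"
     "continuous_on UNIV (\<lambda>z. Complex (Re z) (Im z + t * Re z))"
    "continuous_on UNIV (\<lambda>x. Complex x y)" "continuous_on UNIV (\<lambda>x. Complex y x)" for y
    unfolding Complex_eq by (intro continuous_intros)+
  note [measurable] = c[THEN borel_measurable_continuous_onI]
  show "(\<integral>\<^sup>+z. h (Complex (Re z + t * Im z) (Im z)) \<partial>lborel) = (\<integral>\<^sup>+z. h z \<partial>lborel)"
    by (subst (1 2) nn_integral_complex(2))
       (use nn_integral_shift_real[of "\<lambda>x. h (Complex x y)" "t * y" for y] in \<open>auto simp: add.commute intro!: nn_integral_cong\<close>)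
  show "(\<integral>\<^sup>+z. h (Complex (Re z) (Im z + t * Re z)) \<partial>lborel) = (\<integral>\<^sup>+z. h z \<partial>lborel)"
    by (subst (1 2) nn_integral_complex(1))
       (use nn_integral_shift_real[of "\<lambda>x. h (Complex y x)" "t * y" for y] in \<open>auto simp: add.commute intro!: nn_integral_cong\<close>)
qed

lemma mult_measurable_complex [measurable]: "(\<lambda>z::complex. w * z) \<in> borel_measurable borel"
  by (intro borel_measurable_continuous_onI continuous_intros)

text \<open>A rotation by an angle other than \<open>\<pi>\<close> is a product of three shears.\<close>

lemma nn_integral_rotate_aux:
  fixes h :: "complex \<Rightarrow> ennreal"
  assumes [measurable]: "h \<in> borel_measurable borel" and w: "norm w = 1" "w \<noteq> -1"
  shows "(\<integral>\<^sup>+z. h (w * z) \<partial>lborel) = (\<integral>\<^sup>+z. h z \<partial>lborel)"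
proof -
  define c s where "c = Re w" and "s = Im w"
  have cs: "c\<^sup>2 + s\<^sup>2 = 1" using w(1) cmod_power2[of w] by (simp add: c_def s_def)
  have c1: "1 + c \<noteq> 0"
  proof
    assume "1 + c = 0"
    then have "c = -1" by simp
    with cs have "s = 0" by simp
    with \<open>c = -1\<close> w(2) show False by (simp add: c_def s_def complex_eq_iff)
  qed
  \<comment> \<open>For \<open>w = cis \<phi>\<close> this is -tan(\<phi>/2), and the middle shear
    has coefficient sin \<phi>. The quotient degenerates exactly at \<open>w = -1\<close>.\<close>
  define t where "t = - s / (1 + c)"
  define X where "X = (\<lambda>z. Complex (Re z + t * Im z) (Im z))"
  define Y where "Y = (\<lambda>z. Complex (Re z) (Im z + s * Re z))"
  have c: "continuous_on UNIV X" "continuous_on UNIV Y"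
    unfolding X_def Y_def Complex_eq by (intro continuous_intros)+
  note [measurable] = c[THEN borel_measurable_continuous_onI]
  have t: "t * (1 + c) = - s" using c1 by (simp add: t_def)
  have "(1 + t * s) * (1 + c) = (1 + c) + (t * (1 + c)) * s" by (simp add: algebra_simps)
  also have "\<dots> = c * (1 + c)" unfolding t using cs by (simp add: algebra_simps power2_eq_square)
  finally have "1 + t * s = c" using c1 by simp
  moreover have "t + c * t = - s" using t by (simp add: algebra_simps)
  ultimately have ts: "1 + t * s = c" "t + c * t = - s" .
  have ts': "t * (1 + s * t) + t = - s"
    using ts by (simp add: algebra_simps)
  have "X (Y (X z)) = w * z" for z
  proof (rule complex_eqI)
    have "Re (X (Y (X z))) = (1 + t * s) * Re z + (t * (1 + s * t) + t) * Im z"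
      by (simp add: X_def Y_def algebra_simps)
    then show "Re (X (Y (X z))) = Re (w * z)" unfolding ts ts' by (simp add: c_def s_def)
    have "Im (X (Y (X z))) = s * Re z + (1 + t * s) * Im z"
      by (simp add: X_def Y_def algebra_simps)
    then show "Im (X (Y (X z))) = Im (w * z)" unfolding ts by (simp add: c_def s_def algebra_simps)
  qed
  then have "(\<integral>\<^sup>+z. h (w * z) \<partial>lborel) = (\<integral>\<^sup>+z. h (X (Y (X z))) \<partial>lborel)" by simp
  also have "\<dots> = (\<integral>\<^sup>+z. h (X (Y z)) \<partial>lborel)"
    using nn_integral_shear(1)[of "\<lambda>z. h (X (Y z))" t] by (simp add: X_def)
  also have "\<dots> = (\<integral>\<^sup>+z. h (X z) \<partial>lborel)"
    using nn_integral_shear(2)[of "\<lambda>z. h (X z)" s] by (simp add: Y_def)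
  also have "\<dots> = (\<integral>\<^sup>+z. h z \<partial>lborel)"
    using nn_integral_shear(1)[of h t] by (simp add: X_def)
  finally show ?thesis .
qed

lemma nn_integral_rotate:
  fixes h :: "complex \<Rightarrow> ennreal"
  assumes [measurable]: "h \<in> borel_measurable borel" and w: "norm w = 1"
  shows "(\<integral>\<^sup>+z. h (w * z) \<partial>lborel) = (\<integral>\<^sup>+z. h z \<partial>lborel)"
proof (cases "w = -1")
  case True
  have [measurable]: "(\<lambda>z. h (\<i> * z)) \<in> borel_measurable borel" by measurable
  \<comment> \<open>The half turn is composed of two quarter turns, to which the shear argument
    applies.\<close>
  have "(\<integral>\<^sup>+z. h (w * z) \<partial>lborel) = (\<integral>\<^sup>+z. h (\<i> * (\<i> * z)) \<partial>lborel)"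
    using True by (simp add: mult.assoc[symmetric])
  also have "\<dots> = (\<integral>\<^sup>+z. h (\<i> * z) \<partial>lborel)"
    by (rule nn_integral_rotate_aux) (auto simp: complex_eq_iff)
  also have "\<dots> = (\<integral>\<^sup>+z. h z \<partial>lborel)"
    by (rule nn_integral_rotate_aux) (auto simp: complex_eq_iff)
  finally show ?thesis .
qed (use nn_integral_rotate_aux assms in blast)

lemma emeasure_area_cball:
  assumes "0 \<le> r"
  shows "emeasure area_measure (cball c r) = ennreal (r\<^sup>2)" "emeasure area_measure (ball c r) = ennreal (r\<^sup>2)"
proof -
  have "emeasure lborel (cball c r) = ennreal (pi * r\<^sup>2)"
    using assms by (simp add: emeasure_cball eval_unit_ball_vol)
  then show "emeasure area_measure (cball c r) = ennreal (r\<^sup>2)"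
    using assms by (simp add: area_measure_def ennreal_mult[symmetric])
  have "emeasure lborel (ball c r) = ennreal (pi * r\<^sup>2)"
    using assms by (simp add: emeasure_ball eval_unit_ball_vol)
  then show "emeasure area_measure (ball c r) = ennreal (r\<^sup>2)"
    using assms by (simp add: area_measure_def ennreal_mult[symmetric])
qed

lemma sets_area [measurable_cong, simp]: "sets area_measure = sets borel"
  by (simp add: area_measure_def)

lemma nn_integral_area:
  assumes [measurable]: "h \<in> borel_measurable borel"
  shows "(\<integral>\<^sup>+z. h z \<partial>area_measure) = ennreal (1 / pi) * (\<integral>\<^sup>+z. h z \<partial>lborel)"
  unfolding area_measure_def by (subst nn_integral_scale_measure) auto

text \<open>Cauchy's formula at the centre for \<open>z \<mapsto> u (z * w)\<close>. The Borel
  function \<open>v\<close> stands in for \<open>u\<close>, whose values off the disc are arbitrary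
  and may spoil measurability.\<close>

lemma sub_mean_value_circle:
  fixes u :: "complex \<Rightarrow> complex"
  assumes u: "u holomorphic_on ball 0 R" and v[measurable]: "v \<in> borel_measurable borel"
    and uv: "\<And>z. norm z < R \<Longrightarrow> v z = u z" and w: "norm w < R"
  shows "ennreal (norm (u 0)) \<le> (\<integral>\<^sup>+\<zeta>. ennreal (norm (v (\<zeta> * w))) \<partial>circle_measure)"
proof (cases "w = 0")
  case True
  then show ?thesis using uv[of 0] w by simp
next
  case False
  define S where "S = {z. norm (z * w) < R}"
  have S: "open S" unfolding S_def by (intro open_Collect_less continuous_intros)
  have "cball 0 1 \<subseteq> S"
    using w by (auto simp: S_def norm_mult intro: le_less_trans[OF mult_left_le_one_le])
  moreover have "(\<lambda>z. u (z * w)) holomorphic_on S"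
    by (rule holomorphic_on_compose_gen[OF _ u, unfolded o_def])
       (auto simp: S_def intro!: holomorphic_intros)
  then have "(\<lambda>z. v (z * w)) holomorphic_on S"
    by (rule holomorphic_transform) (auto simp: S_def uv)
  moreover have [measurable]: "(\<lambda>z. v (z * w)) \<in> borel_measurable borel" 
    using mult_measurable_complex[of w] by (subst mult.commute) measurable
  ultimately have "(LINT \<zeta>|circle_measure. v (\<zeta> * w) / (1 - 0 * cnj \<zeta>)) = v (0 * w)"
    using S by (intro cauchy_circle[of _ S]) auto
  then have "(LINT \<zeta>|circle_measure. v (\<zeta> * w)) = u 0" using uv[of 0] w
    by (simp add: le_less_trans[OF norm_ge_zero])
  then have "ennreal (norm (u 0)) = ennreal (norm (LINT \<zeta>|circle_measure. v (\<zeta> * w)))" by simp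
  also have "\<dots> \<le> (\<integral>\<^sup>+\<zeta>. ennreal (norm (v (\<zeta> * w))) \<partial>circle_measure)"
    by (rule norm_lebesgue_integral_le_nn_integral)
  finally show ?thesis .
qed

text \<open>The area of a disc is rotation invariant, so its mean may be averaged over all rotations;
  this replaces polar coordinates.\<close>

lemma sub_mean_value_area:
  assumes u: "u holomorphic_on ball a R" and R: "0 < R"
  shows "ennreal (norm (u a) * R\<^sup>2) \<le> (\<integral>\<^sup>+z\<in>ball a R. ennreal (norm (u z)) \<partial>area_measure)"
proof -
  define v where "v = (\<lambda>z. indicator (ball 0 R) z *\<^sub>R u (a + z))"
  have "(\<lambda>z. u (a + z)) holomorphic_on ball 0 R"
    by (rule holomorphic_on_compose_gen[OF _ u, unfolded o_def])
       (auto intro!: holomorphic_intros simp: dist_norm)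
  note hol = this
  have vm[measurable]: "v \<in> borel_measurable borel"
    unfolding v_def
    by (intro borel_measurable_continuous_on_indicator holomorphic_on_imp_continuous_on hol) auto
  let ?B = "\<lambda>z::complex. indicator (ball 0 R) z :: ennreal"
  have [measurable]: "(\<lambda>p::complex \<times> complex. fst p * snd p) \<in> borel_measurable (borel \<Otimes>\<^sub>M borel)"
    unfolding borel_prod by (intro borel_measurable_continuous_onI continuous_intros)
  have [measurable]: "(\<lambda>z. a + z) \<in> borel_measurable borel" 
    by (intro borel_measurable_continuous_onI continuous_intros)
  have [measurable]: "Measurable.pred borel (\<lambda>x::complex. x \<in> ball 0 R)"
    using borel_open[OF open_ball, of 0 R] by (simp add: pred_def)
  interpret P: pair_sigma_finite "lborel :: complex measure" circle_measure ..
  have "ennreal (norm (u a)) * emeasure lborel (ball (0::complex) R) =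
      (\<integral>\<^sup>+w. ennreal (norm (u a)) * ?B w \<partial>lborel)"
    by (simp add: nn_integral_cmult_indicator)
  also have "\<dots> \<le> (\<integral>\<^sup>+w. (\<integral>\<^sup>+\<zeta>. ennreal (norm (v (\<zeta> * w))) * ?B w \<partial>circle_measure) \<partial>lborel)"
  proof (rule nn_integral_mono)
    fix w :: complex
    have mw: "(\<lambda>\<zeta>. v (\<zeta> * w)) \<in> borel_measurable borel"
      using mult_measurable_complex[of w] by (subst mult.commute) measurable
    have "ennreal (norm (u (a + 0))) \<le> (\<integral>\<^sup>+\<zeta>. ennreal (norm (v (\<zeta> * w))) \<partial>circle_measure)" if "norm w < R"
      using that by (intro sub_mean_value_circle[OF hol vm]) (auto simp: v_def)
    then show "ennreal (norm (u a)) * ?B w \<le> (\<integral>\<^sup>+\<zeta>. ennreal (norm (v (\<zeta> * w))) * ?B w \<partial>circle_measure)"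
      using mw by (auto simp: indicator_def)
  qed
  also have "\<dots> = (\<integral>\<^sup>+\<zeta>. (\<integral>\<^sup>+w. ennreal (norm (v (\<zeta> * w))) * ?B w \<partial>lborel) \<partial>circle_measure)"
  proof (rule P.Fubini'[symmetric])
    have [measurable]: "Measurable.pred (borel \<Otimes>\<^sub>M borel) (\<lambda>x::complex \<times> complex. fst x \<in> ball 0 R)"
      by (rule pred_sets2[OF _ measurable_fst]) simp
    show "(\<lambda>(w, \<zeta>). ennreal (norm (v (\<zeta> * w))) * ?B w) \<in> borel_measurable (lborel \<Otimes>\<^sub>M circle_measure)"
      by measurable
  qed
  also have "\<dots> = (\<integral>\<^sup>+\<zeta>. (\<integral>\<^sup>+w. ennreal (norm (v w)) * ?B w \<partial>lborel) \<partial>circle_measure)"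
  proof (rule nn_integral_cong_AE, use AE_circle_norm in eventually_elim)
    fix \<zeta> :: complex assume z: "norm \<zeta> = 1"
    have "(\<integral>\<^sup>+w. ennreal (norm (v (\<zeta> * w))) * ?B w \<partial>lborel) =
      (\<integral>\<^sup>+w. ennreal (norm (v (\<zeta> * w))) * ?B (\<zeta> * w) \<partial>lborel)"
      using z by (intro nn_integral_cong) (auto simp: indicator_def norm_mult)
    also have "\<dots> = (\<integral>\<^sup>+w. ennreal (norm (v w)) * ?B w \<partial>lborel)"
      by (rule nn_integral_rotate[OF _ z]) measurable
    finally show "(\<integral>\<^sup>+w. ennreal (norm (v (\<zeta> * w))) * ?B w \<partial>lborel) = \<dots>" .
  qed
  also have "\<dots> = (\<integral>\<^sup>+w. ennreal (norm (v w)) * ?B w \<partial>lborel)" by simp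
  also have "\<dots> = (\<integral>\<^sup>+w. ennreal (norm (v (- a + w))) * ?B (- a + w) \<partial>lborel)"
    by (subst lborel_distr_plus[of "- a", symmetric], subst nn_integral_distr) auto
  finally have "ennreal (1 / pi) * (ennreal (norm (u a)) * emeasure lborel (ball (0::complex) R)) \<le>
    ennreal (1 / pi) * (\<integral>\<^sup>+w. ennreal (norm (v (- a + w))) * ?B (- a + w) \<partial>lborel)"
    by (rule mult_left_mono) simp
  also have "\<dots> = (\<integral>\<^sup>+w. ennreal (norm (v (- a + w))) * ?B (- a + w) \<partial>area_measure)"
    by (subst nn_integral_area) measurable
  also have "\<dots> = (\<integral>\<^sup>+z\<in>ball a R. ennreal (norm (u z)) \<partial>area_measure)"
    by (intro nn_integral_cong) (auto simp: v_def indicator_def dist_norm norm_minus_commute)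
  also have "ennreal (1 / pi) * (ennreal (norm (u a)) * emeasure lborel (ball (0::complex) R)) = ennreal (norm (u a) * R\<^sup>2)"
    using R by (simp add: emeasure_ball eval_unit_ball_vol ennreal_mult[symmetric])
  finally show ?thesis .
qed

section \<open>Carleson boxes\<close>

lemma arcsE:
  assumes "I \<in> arcs"
  obtains a b where "I = cis ` {a..b}" "a < b" "b \<le> a + 2 * pi" "arc_len I = (b - a) / (2 * pi)"
proof -
  obtain a b where ab: "I = cis ` {a..b}" "a < b" "b \<le> a + 2 * pi" using assms by (auto simp: arcs_def)
  then show ?thesis using that[of a b] arc_len_arc[of a b] by simp
qed

lemma arc_len_pos: "I \<in> arcs \<Longrightarrow> 0 < arc_len I" and arc_len_le_1: "I \<in> arcs \<Longrightarrow> arc_len I \<le> 1"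
  by (auto elim!: arcsE)

lemma carleson_box_polar:
  assumes I: "I = cis ` {a..b}" "a < b" "b \<le> a + 2 * pi" and z: "z \<in> carleson_box I"
  obtains \<theta> where "\<theta> \<in> {a..b}" "z = of_real (norm z) * cis \<theta>" "1 - norm z \<le> (b - a) / (2 * pi)" "norm z < 1"
proof -
  have len: "arc_len I = (b - a) / (2 * pi)" using arc_len_arc I by simp
  show ?thesis
  proof (cases "z = 0")
    case z0: True
    \<comment> \<open>The origin has no direction, but it lies only in boxes over arcs of length at
      least 1, so any angle of the arc serves.\<close>
    have "1 \<le> arc_len I"
    proof (cases "I = sphere 0 1")
      case True
      have "emeasure circle_measure (sphere 0 1) = emeasure circle_measure UNIV"
        using AE_circle_norm by (intro emeasure_eq_AE) auto
      then show ?thesis by (simp add: arc_len_def True measure_def)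
    next
      case False
      then show ?thesis using z z0 by (simp add: carleson_box_def)
    qed
    then show ?thesis using that[of a] I len z0 by simp
  next
    case False
    have zz: "z / of_real (norm z) \<in> I \<and> 1 - norm z \<le> arc_len I"
    proof (cases "I = sphere 0 1")
      case True
      have "emeasure circle_measure (sphere 0 1) = emeasure circle_measure UNIV"
        using AE_circle_norm by (intro emeasure_eq_AE) auto
      then have "arc_len I = 1" by (simp add: arc_len_def True measure_def)
      then show ?thesis using True False by (simp add: norm_divide)
    qed (use z in \<open>auto simp: carleson_box_def\<close>)
    then obtain \<theta> where "\<theta> \<in> {a..b}" "z / of_real (norm z) = cis \<theta>" using I by auto
    moreover have "norm z < 1" using z by (auto simp: carleson_box_def split: if_splits)
    ultimately show ?thesis using that[of \<theta>] zz False len by (simp add: field_simps)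
  qed
qed

text \<open>Move radially from \<open>z\<close> to the circle, then along the circle.\<close>

lemma norm_polar_diff:
  assumes "z = of_real (norm z) * cis \<theta>" "norm z < 1"
  shows "norm (z - cis a) \<le> (1 - norm z) + \<bar>\<theta> - a\<bar>"
proof -
  have "z - cis a = of_real (norm z - 1) * cis \<theta> + (cis \<theta> - cis a)"
    by (subst assms(1)) (simp add: algebra_simps)
  then have "norm (z - cis a) \<le> norm (of_real (norm z - 1) * cis \<theta>) + norm (cis \<theta> - cis a)"
    by (metis norm_triangle_ineq)
  also have "\<dots> \<le> (1 - norm z) + \<bar>\<theta> - a\<bar>"
    using norm_cis_diff_le[of \<theta> a] assms(2) by (simp add: norm_mult del: of_real_diff)
  finally show ?thesis .
qed

text \<open>The height contributes |I| and the arc 2 \<pi> |I| \<le> 7 |I|, which together give the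
  factor 8.\<close>

lemma carleson_box_subset_cball:
  assumes "I \<in> arcs"
  obtains c where "carleson_box I \<subseteq> cball c (8 * arc_len I)"
proof -
  obtain a b where ab: "I = cis ` {a..b}" "a < b" "b \<le> a + 2 * pi" "arc_len I = (b - a) / (2 * pi)"
    using arcsE[OF assms] .
  have "norm (z - cis a) \<le> 8 * arc_len I" if z: "z \<in> carleson_box I" for z
  proof -
    obtain \<theta> where t: "\<theta> \<in> {a..b}" "z = of_real (norm z) * cis \<theta>" "1 - norm z \<le> (b - a) / (2 * pi)" "norm z < 1"
      using carleson_box_polar[OF ab(1-3) z] .
    have "norm (z - cis a) \<le> arc_len I + (b - a)" using norm_polar_diff[OF t(2,4), of a] t ab by auto
    also have "b - a = 2 * pi * arc_len I" using ab by simp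
    also have "\<dots> \<le> 2 * 3.5 * arc_len I"
      using pi_less_4 arc_len_pos[OF assms] pi_approx by (intro mult_right_mono) auto
    finally show ?thesis by simp
  qed
  then have "carleson_box I \<subseteq> cball (cis a) (8 * arc_len I)" by (auto simp: dist_norm norm_minus_commute)
  then show ?thesis by (rule that)
qed

section \<open>Dyadic summation, in place of polar coordinates, for weights over boxes and
  discs\<close>

lemma nn_integral_dyadic:
  fixes q B :: real
  assumes cov: "\<And>z. z \<in> S \<Longrightarrow> \<exists>k::nat. z \<in> E k \<and> w z \<le> c k"
    and E[measurable]: "\<And>k. E k \<in> sets M"
    and bd: "\<And>k. c k * emeasure M (E k) \<le> ennreal (B * q ^ k)"
    and q: "0 \<le> B" "0 \<le> q" "q < 1"
  shows "(\<integral>\<^sup>+z\<in>S. w z \<partial>M) \<le> ennreal (B / (1 - q))"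
proof -
  have "(\<integral>\<^sup>+z\<in>S. w z \<partial>M) \<le> (\<integral>\<^sup>+z. (\<Sum>k. c k * indicator (E k) z) \<partial>M)"
  proof (rule nn_integral_mono)
    fix z
    show "w z * indicator S z \<le> (\<Sum>k. c k * indicator (E k) z)"
    proof (cases "z \<in> S")
      case True
      then obtain k where k: "z \<in> E k" "w z \<le> c k" using cov by blast
      \<comment> \<open>A single term of the series dominates the integrand at \<open>z\<close>, so
        the sets \<open>E k\<close> may overlap and may reach beyond \<open>S\<close>.\<close>
      then have "w z * indicator S z \<le> (\<Sum>j\<in>{k}. c j * indicator (E j) z)" using True by simp
      also have "\<dots> \<le> (\<Sum>j. c j * indicator (E j) z)" by (rule sum_le_suminf) auto
      finally show ?thesis .
    qed simp
  qed
  also have "\<dots> = (\<Sum>k. c k * emeasure M (E k))"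
    by (subst nn_integral_suminf) (simp_all add: nn_integral_cmult)
  also have "\<dots> \<le> (\<Sum>k. ennreal (B * q ^ k))" by (intro suminf_le bd) auto
  also have "\<dots> = ennreal (\<Sum>k. B * q ^ k)"
    using q by (intro suminf_ennreal2 summable_mult summable_geometric) auto
  also have "(\<Sum>k. B * q ^ k) = B / (1 - q)"
    using q by (subst suminf_mult) (auto simp: suminf_geometric summable_geometric)
  finally show ?thesis .
qed

lemma dyadic_exists:
  fixes x L :: real
  assumes "0 < x" "x \<le> L"
  shows "\<exists>k::nat. L / 2 ^ Suc k < x \<and> x \<le> L / 2 ^ k"
proof -
  have "\<exists>n::nat. L / 2 ^ n < x"
  proof -
    obtain n :: nat where "L / x < 2 ^ n" using real_arch_pow[of 2 "L / x"] by auto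
    then show ?thesis using assms by (auto simp: field_simps)
  qed
  then obtain n where n: "L / 2 ^ n < x" "\<And>m. m < n \<Longrightarrow> \<not> L / 2 ^ m < x"
    using exists_least_iff[of "\<lambda>n. L / 2 ^ n < x"] by auto
  \<comment> \<open>\<open>x \<le> L\<close> rules out \<open>n = 0\<close>.\<close>
  then obtain k where "n = Suc k" using assms by (cases n) auto
  then show ?thesis using n(1) n(2)[of k] by (auto simp: not_less)
qed

lemma powr_half_pow: "(1 / 2 ^ k) powr s = (2 powr (- s)) ^ k" for k :: nat and s :: real
proof -
  have "(1 / 2 ^ k :: real) = 2 powr (- real k)" by (simp add: powr_minus powr_realpow divide_inverse)
  then show ?thesis by (simp add: powr_powr powr_power mult.commute)
qed

lemma one_minus_norm_sq:
  assumes "norm z < 1"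
  shows "1 - norm z \<le> 1 - (norm z)\<^sup>2" "1 - (norm z)\<^sup>2 \<le> 2 * (1 - norm z)" "0 < 1 - (norm z)\<^sup>2"
proof -
  have eq: "1 - (norm z)\<^sup>2 = (1 + norm z) * (1 - norm z)" by (simp add: power2_eq_square algebra_simps)
  show "1 - norm z \<le> 1 - (norm z)\<^sup>2" "1 - (norm z)\<^sup>2 \<le> 2 * (1 - norm z)"
    unfolding eq using assms mult_right_mono[of "1" "1 + norm z" "1 - norm z"]
      mult_right_mono[of "1 + norm z" 2 "1 - norm z"] by auto
  then show "0 < 1 - (norm z)\<^sup>2" using assms by linarith
qed

text \<open>The weight (1 - |z|^2)^s is compared with a power of the dyadic scale for exponents of
  either sign, hence the absolute value in the constant.\<close>

lemma powr_le_two_sided: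
  fixes x y s :: real
  assumes "0 < y" "y / 2 \<le> x" "x \<le> 2 * y"
  shows "x powr s \<le> 2 powr \<bar>s\<bar> * y powr s"
proof (cases "s \<ge> 0")
  case True
  have "x powr s \<le> (2 * y) powr s" using assms True by (intro powr_mono2) auto
  then show ?thesis using True assms by (simp add: powr_mult)
next
  case False
  have "x powr s \<le> (y / 2) powr s" using assms False by (intro powr_mono2') auto
  also have "\<dots> = 2 powr \<bar>s\<bar> * y powr s" using False assms by (simp add: powr_divide powr_minus field_simps)
  finally show ?thesis .
qed

text \<open>The part of the box at distance about \<open>2\<^sup>-\<^sup>k|I|\<close> from the circle is covered by \<open>2\<^sup>k\<close> discs of
  radius comparable to \<open>2\<^sup>-\<^sup>k|I|\<close>.\<close>

lemma box_weight_integral: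
  fixes s :: real
  assumes s: "s > -1"
  shows "\<exists>C>0. \<forall>I\<in>arcs. (\<integral>\<^sup>+z\<in>carleson_box I. ennreal ((1 - (norm z)\<^sup>2) powr s) \<partial>area_measure)
     \<le> ennreal (C * arc_len I powr (s + 2))"
proof -
  \<comment> \<open>The layer at scale 2^-k |I| has area of order 2^-k |I|^2 and weight of order
    (2^-k |I|)^s. The resulting ratio 2^-(s+1) is below 1 exactly when s > -1.\<close>
  define q :: real where "q = 2 powr (- (s + 1))"
  have "2 powr (- (s + 1)) < 2 powr (0::real)" by (subst powr_less_cancel_iff) (use s in auto)
  then have q: "0 < q" "q < 1" by (auto simp: q_def)
  define C where "C = 64 * 2 powr \<bar>s\<bar> / (1 - q)"
  have C: "C > 0" using q by (simp add: C_def)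
  have "(\<integral>\<^sup>+z\<in>carleson_box I. ennreal ((1 - (norm z)\<^sup>2) powr s) \<partial>area_measure)
     \<le> ennreal (C * arc_len I powr (s + 2))" if I: "I \<in> arcs" for I
  proof -
    obtain a b where ab: "I = cis ` {a..b}" "a < b" "b \<le> a + 2 * pi" "arc_len I = (b - a) / (2 * pi)"
      using arcsE[OF I] .
    define L where "L = arc_len I"
    have L: "0 < L" "b - a = 2 * pi * L" using ab by (auto simp: L_def)
    \<comment> \<open>The centres divide the arc into 2^k equal pieces. The factor 8 is again height
      plus piece length, 1 + 2 \<pi> \<le> 8 in units of L / 2^k, and its square is the 64 in
      \<open>C\<close>.\<close>
    define E where "E = (\<lambda>k::nat. \<Union>j<(2::nat)^k. cball (cis (a + real j * ((b - a) / 2 ^ k))) (8 * (L / 2 ^ k)))"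
    define c where "c = (\<lambda>k::nat. ennreal (2 powr \<bar>s\<bar> * (L / 2 ^ k) powr s))"
    have "(\<integral>\<^sup>+z\<in>carleson_box I. ennreal ((1 - (norm z)\<^sup>2) powr s) \<partial>area_measure)
      \<le> ennreal (64 * 2 powr \<bar>s\<bar> * L powr (s + 2) / (1 - q))"
    proof (rule nn_integral_dyadic)
      fix z assume z: "z \<in> carleson_box I"
      obtain \<theta> where t: "\<theta> \<in> {a..b}" "z = of_real (norm z) * cis \<theta>" "1 - norm z \<le> (b - a) / (2 * pi)" "norm z < 1"
        using carleson_box_polar[OF ab(1-3) z] .
      have le: "0 < 1 - norm z" "1 - norm z \<le> L" using t ab by (auto simp: L_def)
      obtain k :: nat where k: "L / 2 ^ Suc k < 1 - norm z" "1 - norm z \<le> L / 2 ^ k"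
        using dyadic_exists[OF le] by blast
      have w: "ennreal ((1 - (norm z)\<^sup>2) powr s) \<le> c k"
        unfolding c_def
        using k one_minus_norm_sq[OF t(4)] L by (intro ennreal_leI powr_le_two_sided) auto
      define h where "h = (b - a) / 2 ^ k"
      have h: "h > 0" "2 ^ k * h = b - a" using ab by (auto simp: h_def)
      have "\<exists>j<(2::nat)^k. a + real j * h \<le> \<theta> \<and> \<theta> \<le> a + real j * h + h"
      proof (cases "\<theta> = b")
        case True
        \<comment> \<open>At the right end of the arc the floor used below would give the index 2^k,
          one too many; the last piece contains this point.\<close>
        have "real ((2::nat) ^ k - 1) = 2 ^ k - 1" by (simp add: of_nat_diff)
        then have "real ((2::nat) ^ k - 1) * h = 2 ^ k * h - h" by (simp add: left_diff_distrib)
        then have "a + real ((2::nat) ^ k - 1) * h \<le> \<theta>" "\<theta> \<le> a + real ((2::nat) ^ k - 1) * h + h"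
          using True h by linarith+
        moreover have "(2::nat) ^ k - 1 < 2 ^ k" by simp
        ultimately show ?thesis by blast
      next
        case False
        define j where "j = nat \<lfloor>(\<theta> - a) / h\<rfloor>"
        have nn: "0 \<le> (\<theta> - a) / h" using t h by auto
        then have j: "real j \<le> (\<theta> - a) / h" "(\<theta> - a) / h < real j + 1"
          unfolding j_def by linarith+
        have "(\<theta> - a) / h < 2 ^ k" using t False h by (simp add: pos_divide_less_eq)
        then have "real j < 2 ^ k" using j(1) by linarith
        then have "j < 2 ^ k" by simp
        then show ?thesis using j h by (intro exI[of _ j]) (auto simp: field_simps)
      qed
      then obtain j where j: "j < (2::nat)^k" "a + real j * h \<le> \<theta>" "\<theta> \<le> a + real j * h + h" by blast
      have "norm (z - cis (a + real j * h)) \<le> (1 - norm z) + \<bar>\<theta> - (a + real j * h)\<bar>"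
        by (rule norm_polar_diff[OF t(2,4)])
      also have "\<dots> \<le> L / 2 ^ k + h" using k(2) j by auto
      finally have "norm (z - cis (a + real j * h)) \<le> L / 2 ^ k + h" .
      moreover have "h = 2 * pi * (L / 2 ^ k)" by (simp add: h_def L)
      moreover have "2 * pi * (L / 2 ^ k) \<le> 2 * 3.5 * (L / 2 ^ k)"
        using pi_approx L by (intro mult_right_mono) auto
      ultimately have "norm (z - cis (a + real j * h)) \<le> 8 * (L / 2 ^ k)" by linarith
      then have "z \<in> E k" unfolding E_def h_def[symmetric] using j(1)
        by (auto simp: dist_norm norm_minus_commute)
      with w show "\<exists>k. z \<in> E k \<and> ennreal ((1 - (norm z)\<^sup>2) powr s) \<le> c k" by blast
    next
      fix k :: nat
      show Em: "E k \<in> sets area_measure" unfolding E_def by auto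
      have "emeasure area_measure (E k) \<le> (\<Sum>j<(2::nat)^k. emeasure area_measure (cball (cis (a + real j * ((b - a) / 2 ^ k))) (8 * (L / 2 ^ k))))"
        unfolding E_def by (rule emeasure_subadditive_finite) auto
      also have "\<dots> = (\<Sum>j<(2::nat)^k. ennreal ((8 * (L / 2 ^ k))\<^sup>2))"
        using L by (subst emeasure_area_cball) auto
      also have "\<dots> = ennreal (2 ^ k * (8 * (L / 2 ^ k))\<^sup>2)"
        by (simp add: ennreal_of_nat_eq_real_of_nat ennreal_mult[symmetric])
      also have "2 ^ k * (8 * (L / 2 ^ k))\<^sup>2 = 64 * L\<^sup>2 * (1 / 2 ^ k)"
        by (simp add: power2_eq_square field_simps)
      finally have "c k * emeasure area_measure (E k) \<le> c k * ennreal (64 * L\<^sup>2 * (1 / 2 ^ k))"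
        by (rule mult_left_mono) simp
      also have "\<dots> = ennreal (2 powr \<bar>s\<bar> * (L / 2 ^ k) powr s * (64 * L\<^sup>2 * (1 / 2 ^ k)))"
        unfolding c_def by (rule ennreal_mult[symmetric]) auto
      also have "(L / 2 ^ k) powr s = L powr s * (1 / 2 ^ k) powr s"
        using L powr_mult[of L "1 / 2 ^ k" s] by simp
      also have "2 powr \<bar>s\<bar> * (L powr s * (1 / 2 ^ k) powr s) * (64 * L\<^sup>2 * (1 / 2 ^ k)) =
        64 * 2 powr \<bar>s\<bar> * (L powr s * L powr 2) * ((1 / 2 ^ k) powr s * (1 / 2 ^ k) powr 1)"
        using L by simp
      also have "(1 / 2 ^ k) powr s * (1 / 2 ^ k) powr 1 = q ^ k"
        unfolding powr_add[symmetric] by (simp only: powr_half_pow q_def)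
      also have "L powr s * L powr 2 = L powr (s + 2)" by (simp only: powr_add)
      finally show "c k * emeasure area_measure (E k) \<le> ennreal (64 * 2 powr \<bar>s\<bar> * L powr (s + 2) * q ^ k)" .
    qed (use q in auto)
    then show ?thesis by (simp add: C_def L_def field_simps)
  qed
  with C show ?thesis by blast
qed

text \<open>At distance about R / 2^k from the centre the area is of order (R / 2^k)^2 and the
  integrand of order (R / 2^k)^(\<lambda>-2), so the layers contribute a geometric series of ratio
  2^-\<lambda>. The factor 4 comes from comparing the outer with the inner radius of a
  layer.\<close>

lemma cball_singular_integral:
  fixes lam :: real
  assumes lam: "0 < lam" "lam < 2" and R: "0 < R"
  shows "(\<integral>\<^sup>+z\<in>cball a R - {a}. ennreal (norm (z - a) powr (lam - 2)) \<partial>area_measure)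
    \<le> ennreal (4 / (1 - 2 powr (- lam)) * R powr lam)"
proof -
  have "2 powr (- lam) < 2 powr (0::real)" by (subst powr_less_cancel_iff) (use lam in auto)
  then have q: "2 powr (- lam) < 1" by simp
  have "(\<integral>\<^sup>+z\<in>cball a R - {a}. ennreal (norm (z - a) powr (lam - 2)) \<partial>area_measure)
    \<le> ennreal ((4 * R powr lam) / (1 - 2 powr (- lam)))"
  proof (rule nn_integral_dyadic[where E = "\<lambda>k. cball a (R / 2 ^ k)" and c = "\<lambda>k. ennreal ((R / 2 ^ Suc k) powr (lam - 2))"])
    fix z assume z: "z \<in> cball a R - {a}"
    then have "0 < norm (z - a)" "norm (z - a) \<le> R" by (auto simp: dist_norm norm_minus_commute)
    from dyadic_exists[OF this] obtain k :: nat where k: "R / 2 ^ Suc k < norm (z - a)" "norm (z - a) \<le> R / 2 ^ k" by blast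
    have "norm (z - a) powr (lam - 2) \<le> (R / 2 ^ Suc k) powr (lam - 2)"
      using k R lam by (intro powr_mono2') auto
    with k show "\<exists>k. z \<in> cball a (R / 2 ^ k) \<and> ennreal (norm (z - a) powr (lam - 2)) \<le> ennreal ((R / 2 ^ Suc k) powr (lam - 2))"
      by (intro exI[of _ k]) (auto simp: dist_norm norm_minus_commute intro: ennreal_leI)
  next
    fix k :: nat
    have "ennreal ((R / 2 ^ Suc k) powr (lam - 2)) * emeasure area_measure (cball a (R / 2 ^ k)) =
      ennreal ((R / 2 ^ Suc k) powr (lam - 2) * (R / 2 ^ k)\<^sup>2)"
      using R by (subst emeasure_area_cball) (auto simp: ennreal_mult[symmetric])
    also have "(R / 2 ^ Suc k) powr (lam - 2) * (R / 2 ^ k)\<^sup>2 = 4 * ((R / 2 ^ Suc k) powr (lam - 2) * (R / 2 ^ Suc k) powr 2)"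
      using R by (simp add: power2_eq_square field_simps)
    also have "(R / 2 ^ Suc k) powr (lam - 2) * (R / 2 ^ Suc k) powr 2 = (R / 2 ^ Suc k) powr lam"
      by (simp only: powr_add[symmetric]) simp
    also have "4 * \<dots> \<le> 4 * (R / 2 ^ k) powr lam"
      using R lam by (intro mult_left_mono powr_mono2) (auto simp: field_simps)
    also have "(R / 2 ^ k) powr lam = R powr lam * (2 powr (- lam)) ^ k"
      using R powr_mult[of R "1 / 2 ^ k" lam] powr_half_pow[of k lam] by simp
    finally show "ennreal ((R / 2 ^ Suc k) powr (lam - 2)) * emeasure area_measure (cball a (R / 2 ^ k))
      \<le> ennreal (4 * R powr lam * (2 powr (- lam)) ^ k)"
      by (simp add: ennreal_leI mult.assoc)
  qed (use q in auto)
  then show ?thesis by simp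
qed

text \<open>Points of the box far from the pole are handled by the area of the box alone.\<close>

lemma box_singular_integral:
  fixes lam :: real
  assumes lam: "0 < lam" "lam < 2"
  shows "\<exists>C>0. \<forall>I\<in>arcs. \<forall>\<zeta>. norm \<zeta> = 1 \<longrightarrow>
    (\<integral>\<^sup>+z\<in>carleson_box I. ennreal (norm (z - \<zeta>) powr (lam - 2)) \<partial>area_measure) \<le> ennreal (C * arc_len I powr lam)"
proof -
  have "2 powr (- lam) < 2 powr (0::real)" by (subst powr_less_cancel_iff) (use lam in auto)
  then have q: "2 powr (- lam) < 1" by simp
  define C where "C = (4 / (1 - 2 powr (- lam)) + 1) * 8 powr lam"
  have C: "C > 0" using q by (auto simp: C_def intro!: mult_pos_pos add_pos_pos)
  have "(\<integral>\<^sup>+z\<in>carleson_box I. ennreal (norm (z - \<zeta>) powr (lam - 2)) \<partial>area_measure) \<le> ennreal (C * arc_len I powr lam)"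
    if I: "I \<in> arcs" and z: "norm \<zeta> = 1" for I \<zeta>
  proof -
    obtain c where c: "carleson_box I \<subseteq> cball c (8 * arc_len I)" using carleson_box_subset_cball[OF I] .
    define R where "R = 8 * arc_len I"
    have R: "R > 0" using arc_len_pos[OF I] by (simp add: R_def)
    have "(\<integral>\<^sup>+z\<in>carleson_box I. ennreal (norm (z - \<zeta>) powr (lam - 2)) \<partial>area_measure) \<le>
      (\<integral>\<^sup>+z. ennreal (norm (z - \<zeta>) powr (lam - 2)) * indicator (cball \<zeta> R - {\<zeta>}) z + ennreal (R powr (lam - 2)) * indicator (cball c R) z \<partial>area_measure)"
    proof (rule nn_integral_mono)
      fix w
      show "ennreal (norm (w - \<zeta>) powr (lam - 2)) * indicator (carleson_box I) w \<le>
        ennreal (norm (w - \<zeta>) powr (lam - 2)) * indicator (cball \<zeta> R - {\<zeta>}) w + ennreal (R powr (lam - 2)) * indicator (cball c R) w"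
      proof (cases "w \<in> carleson_box I")
        case True
        then have w: "w \<in> cball c R" "w \<noteq> \<zeta>" using c z by (auto simp: R_def carleson_box_def split: if_splits)
        show ?thesis
        proof (cases "w \<in> cball \<zeta> R")
          case False
          then have "norm (w - \<zeta>) powr (lam - 2) \<le> R powr (lam - 2)"
            using R lam by (intro powr_mono2') (auto simp: dist_norm norm_minus_commute)
          then show ?thesis using w True False by (simp add: ennreal_leI)
        qed (use w True in simp)
      qed simp
    qed
    also have "\<dots> = (\<integral>\<^sup>+z\<in>cball \<zeta> R - {\<zeta>}. ennreal (norm (z - \<zeta>) powr (lam - 2)) \<partial>area_measure) + ennreal (R powr (lam - 2)) * ennreal (R\<^sup>2)"
    proof (subst nn_integral_add)
      have [measurable]: "cball \<zeta> R - {\<zeta>} \<in> sets borel" "cball c R \<in> sets borel" by auto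
      show "(\<lambda>w. ennreal (norm (w - \<zeta>) powr (lam - 2)) * indicator (cball \<zeta> R - {\<zeta>}) w) \<in> borel_measurable area_measure"
        by measurable
      show "(\<lambda>w. ennreal (R powr (lam - 2)) * indicator (cball c R) w) \<in> borel_measurable area_measure"
        by measurable
    qed (use R in \<open>simp add: nn_integral_cmult_indicator emeasure_area_cball\<close>)
    also have "\<dots> \<le> ennreal (4 / (1 - 2 powr (- lam)) * R powr lam) + ennreal (R powr lam)"
    proof (rule add_mono[OF cball_singular_integral[OF lam R]])
      have "R powr (lam - 2) * R powr 2 = R powr lam" by (simp only: powr_add[symmetric]) simp
      then show "ennreal (R powr (lam - 2)) * ennreal (R\<^sup>2) \<le> ennreal (R powr lam)"
        using R by (simp add: ennreal_mult[symmetric])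
    qed
    also have "\<dots> = ennreal ((4 / (1 - 2 powr (- lam)) + 1) * R powr lam)"
      using q by (subst ennreal_plus[symmetric]) (auto simp: algebra_simps)
    also have "R powr lam = 8 powr lam * arc_len I powr lam"
      using arc_len_pos[OF I] by (simp add: R_def powr_mult)
    finally show ?thesis by (simp add: C_def mult.assoc)
  qed
  with C show ?thesis by blast
qed

section \<open>Discs inside Carleson boxes and pointwise bounds by box integrals\<close>

lemma norm_sgn_diff_le:
  fixes w z :: complex
  assumes "w \<noteq> 0" "z \<noteq> 0"
  shows "norm (sgn w - sgn z) \<le> 2 * norm (w - z) / norm z"
proof -
  have "sgn w - sgn z = (w - z) / of_real (norm z) + sgn w * of_real ((norm z - norm w) / norm z)"
    using assms by (simp add: sgn_eq field_simps)
  then have "norm (sgn w - sgn z) \<le> norm ((w - z) / of_real (norm z)) + norm (sgn w * of_real ((norm z - norm w) / norm z))"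
    by (metis norm_triangle_ineq)
  also have "\<dots> = norm (w - z) / norm z + \<bar>norm z - norm w\<bar> / norm z"
    using assms by (simp only: norm_mult norm_divide norm_of_real norm_sgn) simp
  also have "\<dots> \<le> norm (w - z) / norm z + norm (w - z) / norm z"
    using norm_triangle_ineq3[of z w] by (intro add_mono divide_right_mono) (auto simp: norm_minus_commute)
  finally show ?thesis by simp
qed

lemma ball_subset_carleson_box:
  assumes z: "norm z < 1"
  obtains I where "I \<in> arcs" "ball z ((1 - norm z) / 2) \<subseteq> carleson_box I"
    "1 - norm z \<le> arc_len I" "arc_len I \<le> 2 * (1 - norm z)"
proof -
  define d where "d = 1 - norm z"
  have d: "0 < d" "d \<le> 1" using z by (auto simp: d_def)
  have wd: "norm w < 1 \<and> 1 - norm w \<le> 3 / 2 * d" if "w \<in> ball z (d / 2)" for w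
    using that norm_triangle_ineq3[of w z] d by (auto simp: d_def dist_norm norm_minus_commute)
  show ?thesis
  proof (cases "d \<le> 1 / 2")
    case False
    \<comment> \<open>For d > 1/2 the whole circle serves, since its length 1 is below 2 d.\<close>
    define I where "I = cis ` {0..2 * pi}"
    have "I \<in> arcs" unfolding arcs_def I_def
      by (intro CollectI exI[of _ 0] exI[of _ "2 * pi"]) auto
    moreover have "arc_len I = 1"
      using arc_len_arc[of 0 "2 * pi"] by (simp add: I_def)
    ultimately have I: "I \<in> arcs" "arc_len I = 1" .
    have "I = sphere 0 1"
    proof
      show "sphere 0 1 \<subseteq> I"
      proof
        fix w :: complex assume "w \<in> sphere 0 1"
        then obtain s where "\<bar>s\<bar> \<le> pi" "w = cis (pi + s)" using unit_circle_arc[of w pi] by auto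
        then show "w \<in> I" unfolding I_def by (intro image_eqI[of _ _ "pi + s"]) auto
      qed
    qed (auto simp: I_def)
    then have "ball z ((1 - norm z) / 2) \<subseteq> carleson_box I"
      using wd by (auto simp: carleson_box_def d_def)
    then show ?thesis using that[of I] I False d by (simp add: d_def)
  next
    case True
    have z0: "z \<noteq> 0" "1 / 2 \<le> norm z" using True by (auto simp: d_def)
    define \<theta> where "\<theta> = Arg z"
    \<comment> \<open>Points of the disc have height at most 3d/2, within the height 2d of the box.
      As |z| \<ge> 1/2, their direction differs from that of \<open>z\<close> by a chord below 2d,
      whereas leaving the arc takes a chord of 4d. The arc closes up at most once because d \<le>
      1/2.\<close>
    define t where "t = 2 * d"
    define I where "I = cis ` {\<theta> - pi * t..\<theta> + pi * t}"
    have I: "I \<in> arcs"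
      using d True unfolding I_def arcs_def t_def
      by (intro CollectI exI[of _ "\<theta> - pi * (2 * d)"] exI[of _ "\<theta> + pi * (2 * d)"]) (auto simp: field_simps)
    have len: "arc_len I = 2 * d"
      unfolding I_def using d True by (subst arc_len_arc) (auto simp: field_simps t_def)
    have "w \<in> carleson_box I" if w: "w \<in> ball z (d / 2)" for w
    proof -
      have nw: "norm w < 1" "1 - norm w \<le> 3 / 2 * d" using wd[OF w] by auto
      then have "w \<noteq> 0" using True by auto
      have "norm (sgn w - cis \<theta>) \<le> 2 * norm (w - z) / norm z"
        using norm_sgn_diff_le[OF \<open>w \<noteq> 0\<close> z0(1)] cis_Arg[OF z0(1)] by (simp add: \<theta>_def)
      also have "\<dots> < 2 * (d / 2) / norm z"
        using w z0 by (intro divide_strict_right_mono) (auto simp: dist_norm norm_minus_commute)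
      also have "\<dots> \<le> 2 * d" using z0 d by (simp add: field_simps)
      finally have "sgn w \<in> I" 
        using chord_ge[of "sgn w" t \<theta>] \<open>w \<noteq> 0\<close> d unfolding I_def t_def by (force simp: norm_sgn)
      then show ?thesis using nw len d by (auto simp: carleson_box_def sgn_eq)
    qed
    then have "ball z ((1 - norm z) / 2) \<subseteq> carleson_box I" unfolding d_def by blast
    then show ?thesis using that[OF I] len d by (simp add: d_def)
  qed
qed

text \<open>The sub-mean value property is applied to the holomorphic square of \<open>h\<close>;
  the area of the disc gives the exponent 2, and the lower bound r^q for the weight gives q. The
  case q = 1 serves the Morrey norm, q = p the Bloch-Morrey seminorm.\<close>

lemma pointwise_le_box_integral:
  fixes h :: "complex \<Rightarrow> complex" and q :: real
  assumes h: "h holomorphic_on ball 0 1" and z: "norm z < 1" and q: "0 \<le> q"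
  obtains I where "I \<in> arcs" "1 - norm z \<le> arc_len I" "arc_len I \<le> 2 * (1 - norm z)"
    "ennreal ((norm (h z))\<^sup>2 * ((1 - norm z) / 2) powr (q + 2)) \<le>
      (\<integral>\<^sup>+w\<in>carleson_box I. ennreal ((norm (h w))\<^sup>2 * (1 - (norm w)\<^sup>2) powr q) \<partial>area_measure)"
proof -
  define r where "r = (1 - norm z) / 2"
  have r: "0 < r" using z by (simp add: r_def)
  obtain I where I: "I \<in> arcs" "ball z r \<subseteq> carleson_box I" "1 - norm z \<le> arc_len I" "arc_len I \<le> 2 * (1 - norm z)"
    using ball_subset_carleson_box[OF z] unfolding r_def .
  have sub: "r \<le> 1 - norm w \<and> norm w < 1" if "w \<in> ball z r" for w
    using that norm_triangle_ineq3[of w z] r by (auto simp: r_def dist_norm norm_minus_commute)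
  have "(\<lambda>w. (h w)\<^sup>2) holomorphic_on ball z r"
    using sub by (intro holomorphic_intros holomorphic_on_subset[OF h]) auto
  note smv = sub_mean_value_area[OF this r]
  have "(norm (h z))\<^sup>2 * r powr (q + 2) = r powr q * (norm ((h z)\<^sup>2) * r\<^sup>2)"
    using r by (simp add: powr_add norm_power)
  then have "ennreal ((norm (h z))\<^sup>2 * r powr (q + 2)) = ennreal (r powr q) * ennreal (norm ((h z)\<^sup>2) * r\<^sup>2)"
    by (simp add: ennreal_mult)
  also have "\<dots> \<le> ennreal (r powr q) * (\<integral>\<^sup>+w\<in>ball z r. ennreal (norm ((h w)\<^sup>2)) \<partial>area_measure)"
    by (intro mult_left_mono smv) auto
  also have "\<dots> = (\<integral>\<^sup>+w. ennreal (r powr q) * (ennreal (norm ((h w)\<^sup>2)) * indicator (ball z r) w) \<partial>area_measure)"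
  proof (rule nn_integral_cmult[symmetric])
    have "continuous_on (ball z r) (\<lambda>w. norm ((h w)\<^sup>2))"
      using sub by (intro continuous_intros holomorphic_on_imp_continuous_on holomorphic_on_subset[OF h]) auto
    then have "(\<lambda>w. indicator (ball z r) w *\<^sub>R norm ((h w)\<^sup>2)) \<in> borel_measurable borel"
      by (intro borel_measurable_continuous_on_indicator) auto
    then have "(\<lambda>w. ennreal (indicator (ball z r) w *\<^sub>R norm ((h w)\<^sup>2))) \<in> borel_measurable borel"
      by measurable
    also have "(\<lambda>w. ennreal (indicator (ball z r) w *\<^sub>R norm ((h w)\<^sup>2))) = (\<lambda>w. ennreal (norm ((h w)\<^sup>2)) * indicator (ball z r) w)"
      by (auto simp: indicator_def)
    finally show "\<dots> \<in> borel_measurable area_measure" by (simp cong: measurable_cong_sets)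
  qed
  also have "\<dots> \<le> (\<integral>\<^sup>+w\<in>carleson_box I. ennreal ((norm (h w))\<^sup>2 * (1 - (norm w)\<^sup>2) powr q) \<partial>area_measure)"
  proof (rule nn_integral_mono)
    fix w
    show "ennreal (r powr q) * (ennreal (norm ((h w)\<^sup>2)) * indicator (ball z r) w) \<le>
      ennreal ((norm (h w))\<^sup>2 * (1 - (norm w)\<^sup>2) powr q) * indicator (carleson_box I) w"
    proof (cases "w \<in> ball z r")
      case True
      have "r \<le> 1 - (norm w)\<^sup>2" using sub[OF True] one_minus_norm_sq[of w] by auto
      then have "r powr q \<le> (1 - (norm w)\<^sup>2) powr q" using r q by (intro powr_mono2) auto
      then have "r powr q * (norm (h w))\<^sup>2 \<le> (norm (h w))\<^sup>2 * (1 - (norm w)\<^sup>2) powr q"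
        by (subst mult.commute) (rule mult_left_mono, auto)
      then show ?thesis using True I(2)
        by (auto simp: ennreal_mult[symmetric] norm_power intro!: ennreal_leI)
    qed simp
  qed
  finally show ?thesis using that[OF I(1,3,4)] by (simp add: r_def)
qed

section \<open>Test functions in the Morrey space\<close>

lemma ennsqrt_le_iff:
  assumes "0 \<le> c"
  shows "ennsqrt x \<le> ennreal c \<longleftrightarrow> x \<le> ennreal (c\<^sup>2)"
proof (cases x rule: ennreal_cases)
  case (real r)
  have "sqrt r \<le> c \<longleftrightarrow> r \<le> c\<^sup>2"
    using real assms real_sqrt_le_iff[of r "c\<^sup>2"] by simp
  then show ?thesis using real assms by (simp add: ennsqrt_def)
qed (simp add: ennsqrt_def top_unique)

lemma ennreal_divide_le_iff:
  assumes "0 < L" "0 \<le> c"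
  shows "A / ennreal L \<le> ennreal c \<longleftrightarrow> A \<le> ennreal (c * L)"
proof (cases A rule: ennreal_cases)
  case (real r)
  then show ?thesis using assms by (simp add: divide_ennreal pos_divide_le_eq)
next
  case top
  then show ?thesis using assms by (simp add: ennreal_top_divide top_unique)
qed

lemma ennsqrt_quotient_le_iff:
  assumes "I \<in> arcs" "0 \<le> c"
  shows "ennsqrt (A / ennreal (arc_len I powr e)) \<le> ennreal c \<longleftrightarrow> A \<le> ennreal (c\<^sup>2 * arc_len I powr e)"
  using assms arc_len_pos[OF assms(1)] by (simp add: ennsqrt_le_iff ennreal_divide_le_iff)

lemma arc_borel [measurable]: "I \<in> arcs \<Longrightarrow> I \<in> sets borel"
  by (auto elim!: arcsE intro: borel_compact compact_arc)

lemma carleson_box_borel [measurable]: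
  assumes "I \<in> arcs"
  shows "carleson_box I \<in> sets borel"
proof (cases "I = sphere 0 1")
  case False
  have [measurable]: "I \<in> sets borel" using assms by measurable
  have "{z \<in> space borel. norm z < 1 \<and> 1 - arc_len I \<le> norm z \<and> z / of_real (norm z) \<in> I} \<in> sets borel"
    by measurable
  then show ?thesis using False by (simp add: carleson_box_def)
qed (simp add: carleson_box_def)

lemma emeasure_arc_len: "emeasure circle_measure I = ennreal (arc_len I)"
  unfolding arc_len_def by (rule circle.emeasure_eq_measure)

lemma norm_arc_mean_le:
  assumes [measurable]: "F \<in> borel_measurable borel" and I: "I \<in> arcs"
  shows "ennreal (norm (arc_mean F I) * arc_len I) \<le> (\<integral>\<^sup>+\<zeta>\<in>I. ennreal (norm (F \<zeta>)) \<partial>circle_measure)"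
proof -
  have "norm (arc_mean F I) * arc_len I = norm (LINT \<zeta>:I|circle_measure. F \<zeta>)"
    using arc_len_pos[OF I] by (simp add: arc_mean_def)
  also have "ennreal \<dots> \<le> (\<integral>\<^sup>+\<zeta>. ennreal (norm (indicator I \<zeta> *\<^sub>R F \<zeta>)) \<partial>circle_measure)"
    unfolding set_lebesgue_integral_def
    by (rule norm_lebesgue_integral_le_nn_integral)
  also have "\<dots> = (\<integral>\<^sup>+\<zeta>\<in>I. ennreal (norm (F \<zeta>)) \<partial>circle_measure)"
    by (intro nn_integral_cong) (auto simp: indicator_def)
  finally show ?thesis .
qed

lemma nn_integral_arc_le:
  assumes I: "I \<in> arcs" and F: "\<And>\<zeta>. F \<zeta> \<le> ennreal c" and "0 \<le> c"
  shows "(\<integral>\<^sup>+\<zeta>\<in>I. F \<zeta> \<partial>circle_measure) \<le> ennreal (c * arc_len I)"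
proof -
  have "(\<integral>\<^sup>+\<zeta>\<in>I. F \<zeta> \<partial>circle_measure) \<le> (\<integral>\<^sup>+\<zeta>\<in>I. ennreal c \<partial>circle_measure)"
    by (intro nn_integral_mono mult_right_mono F) auto
  also have "\<dots> = ennreal (c * arc_len I)"
    using arc_borel[OF I] \<open>0 \<le> c\<close> by (simp add: nn_integral_cmult_indicator emeasure_arc_len ennreal_mult')
  finally show ?thesis .
qed

text \<open>A bounded function satisfies the Morrey condition because \<open>|I| \<le> |I|\<^sup>\<lambda>\<close>.\<close>

lemma holomorphic_cball_in_morrey:
  assumes f: "f holomorphic_on S" "open S" "cball 0 1 \<subseteq> S" and lam: "lam \<le> 1"
  shows "f \<in> morrey lam"
proof -
  have cont: "continuous_on (cball 0 1) f"
    using f holomorphic_on_imp_continuous_on continuous_on_subset by blast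
  then have "bounded (f ` cball 0 1)"
    by (intro compact_imp_bounded compact_continuous_image) auto
  then obtain M where M: "0 < M" "\<And>z. norm z \<le> 1 \<Longrightarrow> norm (f z) \<le> M"
    by (auto simp: bounded_pos)
  \<comment> \<open>The radial limits are the values of \<open>f\<close> itself; the cut-off makes
    them a Borel function on the plane.\<close>
  define F where "F = (\<lambda>z. indicator (cball 0 1) z *\<^sub>R f z)"
  have F[measurable]: "F \<in> borel_measurable borel"
    unfolding F_def by (intro borel_measurable_continuous_on_indicator cont) auto
  have FM: "norm (F z) \<le> M" for z using M by (auto simp: F_def indicator_def)
  have "f \<in> hardy2"
  proof -
    have "(\<integral>\<^sup>+\<zeta>. ennreal ((norm (f (of_real r * \<zeta>)))\<^sup>2) \<partial>circle_measure) \<le> ennreal (M\<^sup>2)" if "r \<in> {0..<1}" for r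
    proof -
      have "(\<integral>\<^sup>+\<zeta>. ennreal ((norm (f (of_real r * \<zeta>)))\<^sup>2) \<partial>circle_measure) \<le> (\<integral>\<^sup>+\<zeta>. ennreal (M\<^sup>2) \<partial>circle_measure)"
        by (rule nn_integral_mono_AE, use AE_circle_norm in eventually_elim)
          (use that M in \<open>auto simp: norm_mult intro!: ennreal_leI power_mono\<close>)
      then show ?thesis by simp
    qed
    then have "(SUP r\<in>{0..<1::real}. \<integral>\<^sup>+\<zeta>. ennreal ((norm (f (of_real r * \<zeta>)))\<^sup>2) \<partial>circle_measure) \<le> ennreal (M\<^sup>2)"
      by (rule SUP_least)
    then have "(SUP r\<in>{0..<1::real}. \<integral>\<^sup>+\<zeta>. ennreal ((norm (f (of_real r * \<zeta>)))\<^sup>2) \<partial>circle_measure) < \<infinity>"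
      by (rule le_less_trans) simp
    moreover have "f holomorphic_on ball 0 1"
      using f by (meson ball_subset_cball holomorphic_on_subset subset_trans)
    ultimately show ?thesis by (simp add: hardy2_def)
  qed
  moreover have "boundary_function f F"
    unfolding boundary_function_def
  proof (intro conjI F, use AE_circle_norm in eventually_elim)
    fix \<zeta> :: complex assume z: "norm \<zeta> = 1"
    then have "\<zeta> \<in> S" using f by auto
    then have "isCont f \<zeta>"
      using f holomorphic_on_imp_continuous_on continuous_on_eq_continuous_at by blast
    moreover have "((\<lambda>r::real. of_real r * \<zeta>) \<longlongrightarrow> of_real 1 * \<zeta>) (at_left 1)"
      by (intro tendsto_intros)
    ultimately have "((\<lambda>r::real. f (of_real r * \<zeta>)) \<longlongrightarrow> f \<zeta>) (at_left 1)"
      using isCont_tendsto_compose[of \<zeta> f] by auto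
    then show "((\<lambda>r::real. f (of_real r * \<zeta>)) \<longlongrightarrow> F \<zeta>) (at_left 1)"
      using z by (simp add: F_def)
  qed
  moreover have "(SUP I\<in>arcs. (\<integral>\<^sup>+\<zeta>\<in>I. ennreal ((norm (F \<zeta> - arc_mean F I))\<^sup>2) \<partial>circle_measure)
        / ennreal (arc_len I powr lam)) \<le> ennreal ((2 * M)\<^sup>2)"
  proof (rule SUP_least)
    fix I assume I: "I \<in> arcs"
    note len = arc_len_pos[OF I] arc_len_le_1[OF I]
    have "ennreal (norm (arc_mean F I) * arc_len I) \<le> ennreal (M * arc_len I)"
      using norm_arc_mean_le[OF F I] nn_integral_arc_le[OF I, of "\<lambda>\<zeta>. ennreal (norm (F \<zeta>))" M] FM M
      by (meson ennreal_leI less_imp_le order_trans)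
    then have am: "norm (arc_mean F I) \<le> M" using len M by simp
    have "norm (F \<zeta> - arc_mean F I) \<le> 2 * M" for \<zeta>
      using norm_triangle_ineq4[of "F \<zeta>" "arc_mean F I"] FM[of \<zeta>] am by linarith
    then have "(\<integral>\<^sup>+\<zeta>\<in>I. ennreal ((norm (F \<zeta> - arc_mean F I))\<^sup>2) \<partial>circle_measure) \<le> ennreal ((2 * M)\<^sup>2 * arc_len I)"
      by (intro nn_integral_arc_le[OF I] ennreal_leI power_mono) auto
    also have "\<dots> \<le> ennreal ((2 * M)\<^sup>2 * arc_len I powr lam)"
      using powr_mono'[of lam 1 "arc_len I"] len lam by (intro ennreal_leI mult_left_mono) auto
    finally show "(\<integral>\<^sup>+\<zeta>\<in>I. ennreal ((norm (F \<zeta> - arc_mean F I))\<^sup>2) \<partial>circle_measure)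
        / ennreal (arc_len I powr lam) \<le> ennreal ((2 * M)\<^sup>2)"
      using len by (subst ennreal_divide_le_iff) auto
  qed
  then have "(SUP I\<in>arcs. (\<integral>\<^sup>+\<zeta>\<in>I. ennreal ((norm (F \<zeta> - arc_mean F I))\<^sup>2) \<partial>circle_measure)
        / ennreal (arc_len I powr lam)) < \<infinity>"
    by (rule le_less_trans) simp
  ultimately show ?thesis by (auto simp: morrey_def)
qed

section \<open>Bounds for the kernel 1 - z cnj b and its powers\<close>

lemma norm_powr_of_real:
  fixes z :: complex
  assumes "z \<noteq> 0"
  shows "norm (z powr of_real s) = norm z powr s"
  using assms by (simp add: powr_def norm_exp_eq_Re)

lemma one_minus_cnj_mult_bounds:
  assumes b: "norm b < 1" and z: "norm z < 1"
  shows "1 - norm z \<le> norm (1 - cnj b * z)" "1 - norm b \<le> norm (1 - cnj b * z)"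
proof -
  have "1 - norm b * norm z \<le> norm (1 - cnj b * z)"
    using norm_triangle_ineq2[of 1 "cnj b * z"] by (simp add: norm_mult)
  moreover have "norm b * norm z \<le> norm z" "norm b * norm z \<le> norm b"
    using b z by (auto intro: mult_left_le_one_le mult_left_le)
  ultimately show "1 - norm z \<le> norm (1 - cnj b * z)" "1 - norm b \<le> norm (1 - cnj b * z)" by linarith+
qed

text \<open>|z - \<zeta>| equals |1 - z cnj \<zeta>|. Replacing \<zeta> by b costs at most 1 - |b|,
  which |1 - z cnj b| already dominates; hence the factor 2. The estimate moves the pole to the
  circle uniformly in b.\<close>

lemma one_minus_cnj_mult_ge:
  assumes b: "norm b < 1" and \<zeta>: "norm \<zeta> = 1" "b = of_real (norm b) * \<zeta>" and z: "norm z < 1"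
  shows "norm (z - \<zeta>) \<le> 2 * norm (1 - cnj b * z)"
proof -
  have "cnj \<zeta> * \<zeta> = 1" using \<zeta>(1) complex_norm_square[of \<zeta>] by (simp add: mult.commute)
  then have "z - \<zeta> = \<zeta> * (cnj \<zeta> * z - 1)" by (simp add: algebra_simps)
  then have "norm (z - \<zeta>) = norm (1 - cnj \<zeta> * z)" using \<zeta>(1) by (simp add: norm_mult norm_minus_commute)
  also have "1 - cnj \<zeta> * z = (1 - cnj b * z) + (cnj b - cnj \<zeta>) * z" by (simp add: algebra_simps)
  also have "norm \<dots> \<le> norm (1 - cnj b * z) + norm (b - \<zeta>) * norm z"
    by (metis complex_cnj_diff complex_mod_cnj norm_mult norm_triangle_ineq)
  also have "b - \<zeta> = of_real (norm b - 1) * \<zeta>" by (subst \<zeta>(2)) (simp add: algebra_simps)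
  also have "norm \<dots> * norm z \<le> (1 - norm b) * 1"
    using b z \<zeta>(1) by (intro mult_mono) (auto simp: norm_mult simp del: of_real_diff)
  also have "(1 - norm b) * 1 \<le> norm (1 - cnj b * z)"
    using one_minus_cnj_mult_bounds[OF b z] by simp
  finally show ?thesis by simp
qed

text \<open>The test functions are \<open>(1 - z cnj b)\<^bsup>(\<lambda>-1)/2\<^esup>\<close>. On the disc \<open>|f'|\<^sup>2 (1 - |z|\<^sup>2)\<close> is dominated by
  \<open>|z - \<zeta>|\<^bsup>\<lambda>-2\<^esup>\<close> with \<open>\<zeta>\<close> the radial projection of \<open>b\<close>, uniformly in \<open>b\<close>.\<close>

lemma morrey_test_functions:
  assumes lam: "0 < lam" "lam < 1"
  shows "\<exists>k>0. \<forall>b. norm b < 1 \<longrightarrow> (\<exists>f\<in>morrey lam. morrey_norm lam f \<le> 1 \<and>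
     norm (f b) = k * (1 - (norm b)\<^sup>2) powr ((lam - 1) / 2))"
proof -
  obtain C where C: "C > 0" "\<And>I \<zeta>. I \<in> arcs \<Longrightarrow> norm \<zeta> = 1 \<Longrightarrow>
    (\<integral>\<^sup>+z\<in>carleson_box I. ennreal (norm (z - \<zeta>) powr (lam - 2)) \<partial>area_measure) \<le> ennreal (C * arc_len I powr lam)"
    using box_singular_integral[of lam] lam by auto
  \<comment> \<open>Normalisation: the value at 0 contributes k to the Morrey norm and the Carleson
    part at most k sqrt(2C).\<close>
  define k where "k = 1 / (1 + sqrt (2 * C))"
  have k: "k > 0" "k * (1 + sqrt (2 * C)) = 1" using C(1) by (auto simp: k_def add_pos_pos less_imp_neq[symmetric])
  define \<beta> where "\<beta> = (1 - lam) / 2"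
  have \<beta>: "0 < \<beta>" "\<beta> \<le> 1 / 2" using lam by (auto simp: \<beta>_def)
  have "\<exists>f\<in>morrey lam. morrey_norm lam f \<le> 1 \<and> norm (f b) = k * (1 - (norm b)\<^sup>2) powr ((lam - 1) / 2)"
    if b: "norm b < 1" for b
  proof -
    define \<zeta> where "\<zeta> = (if b = 0 then 1 else sgn b)"
    have \<zeta>: "norm \<zeta> = 1" "b = of_real (norm b) * \<zeta>"
      by (auto simp: \<zeta>_def norm_sgn) (simp add: sgn_eq)
    define f where "f = (\<lambda>z. of_real k * (1 - cnj b * z) powr of_real (- \<beta>))"
    \<comment> \<open>On \<open>S\<close> the base of the power has positive real part and so avoids
      the branch cut. Since |b| < 1, this open set contains the closed disc, which puts
      \<open>f\<close> into the Morrey space.\<close>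
    define S where "S = {z. Re (cnj b * z) < 1}"
    have S: "open S" unfolding S_def by (intro open_Collect_less continuous_intros)
    have dS: "cball 0 1 \<subseteq> S"
    proof
      fix z :: complex assume "z \<in> cball 0 1"
      then have "norm (cnj b * z) < 1"
        using b mult_left_le[of "norm z" "norm b"] by (auto simp: norm_mult)
      then show "z \<in> S" unfolding S_def using complex_Re_le_cmod[of "cnj b * z"] by simp
    qed
    have nn: "1 - cnj b * z \<notin> \<real>\<^sub>\<le>\<^sub>0" if "z \<in> S" for z
      using that by (auto simp: S_def complex_nonpos_Reals_iff)
    have der: "(f has_field_derivative
      (of_real k * (of_real \<beta> * cnj b * (1 - cnj b * z) powr of_real (- \<beta> - 1)))) (at z)" if "z \<in> S" for z
      unfolding f_def using nn[OF that]
      by (auto intro!: derivative_eq_intros simp: algebra_simps)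
    have hol: "f holomorphic_on S"
      unfolding holomorphic_on_open[OF S] using der by blast
    have 1: "f \<in> morrey lam" by (rule holomorphic_cball_in_morrey[OF hol S dS]) (use lam in auto)
    have nz: "1 - cnj b * z \<noteq> 0" if "norm z < 1" for z
      using one_minus_cnj_mult_bounds(1)[OF b that] that by auto
    \<comment> \<open>|f'|^2 is of order A^(\<lambda>-3); the weight, at most 2A, absorbs one power.
      Since \<lambda> - 2 < 0, the lower bound A \<ge> |z - \<zeta>|/2 then gives an upper
      bound.\<close>
    have ptw: "(norm (deriv f z))\<^sup>2 * (1 - (norm z)\<^sup>2) \<le> k\<^sup>2 * 2 * norm (z - \<zeta>) powr (lam - 2)" if z: "norm z < 1" for z
    proof -
      define A where "A = norm (1 - cnj b * z)"
      have A: "0 < A" using nz[OF z] by (simp add: A_def)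
      have "z \<in> S" using z dS by auto
      then have "norm (deriv f z) = k * (\<beta> * norm b * A powr (- \<beta> - 1))"
        using DERIV_imp_deriv[OF der] norm_powr_of_real[OF nz[OF z], of "- \<beta> - 1"] k \<beta>
        by (simp add: norm_mult A_def)
      also have "\<dots> \<le> k * (1 / 2 * 1 * A powr (- \<beta> - 1))"
        using k \<beta> b by (intro mult_left_mono mult_right_mono mult_mono) auto
      finally have "(norm (deriv f z))\<^sup>2 \<le> (k * (1 / 2 * 1 * A powr (- \<beta> - 1)))\<^sup>2"
        by (intro power_mono) auto
      also have "\<dots> = k\<^sup>2 / 4 * (A powr (- \<beta> - 1) * A powr (- \<beta> - 1))"
        by (simp add: power2_eq_square)
      also have "A powr (- \<beta> - 1) * A powr (- \<beta> - 1) = A powr (lam - 3)"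
      proof -
        have "- \<beta> - 1 + (- \<beta> - 1) = lam - 3" by (simp add: \<beta>_def)
        then show ?thesis by (simp only: powr_add[symmetric])
      qed
      finally have d2: "(norm (deriv f z))\<^sup>2 \<le> k\<^sup>2 / 4 * A powr (lam - 3)" .
      have "1 - (norm z)\<^sup>2 \<le> 2 * A"
        using one_minus_norm_sq[OF z] one_minus_cnj_mult_bounds(1)[OF b z] by (simp add: A_def)
      then have "(norm (deriv f z))\<^sup>2 * (1 - (norm z)\<^sup>2) \<le> (k\<^sup>2 / 4 * A powr (lam - 3)) * (2 * A)"
        using d2 one_minus_norm_sq[OF z] by (intro mult_mono) auto
      also have "\<dots> = k\<^sup>2 / 2 * (A powr (lam - 3) * A powr 1)" using A by simp
      also have "A powr (lam - 3) * A powr 1 = A powr (lam - 2)"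
        unfolding powr_add[symmetric] by simp
      also have "\<dots> \<le> (norm (z - \<zeta>) / 2) powr (lam - 2)"
        using one_minus_cnj_mult_ge[OF b \<zeta> z] lam z \<zeta>(1) by (intro powr_mono2') (auto simp: A_def)
      also have "\<dots> = norm (z - \<zeta>) powr (lam - 2) * 2 powr (2 - lam)"
        by (simp add: powr_divide powr_diff field_simps)
      also have "\<dots> \<le> norm (z - \<zeta>) powr (lam - 2) * 2 powr 2"
        using lam by (intro mult_left_mono powr_mono) auto
      finally show ?thesis by (simp add: mult_left_mono)
    qed
    have "morrey_norm lam f \<le> ennreal k + ennreal (k * sqrt (2 * C))"
      unfolding morrey_norm_def
    proof (intro add_mono SUP_least)
      show "ennreal (norm (f 0)) \<le> ennreal k" using k by (simp add: f_def norm_mult)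
      fix I assume I: "I \<in> arcs"
      have "(\<integral>\<^sup>+z\<in>carleson_box I. ennreal ((norm (deriv f z))\<^sup>2 * (1 - (norm z)\<^sup>2)) \<partial>area_measure) \<le>
        (\<integral>\<^sup>+z. ennreal (k\<^sup>2 * 2) * (ennreal (norm (z - \<zeta>) powr (lam - 2)) * indicator (carleson_box I) z) \<partial>area_measure)"
      proof (rule nn_integral_mono)
        fix z
        show "ennreal ((norm (deriv f z))\<^sup>2 * (1 - (norm z)\<^sup>2)) * indicator (carleson_box I) z \<le>
          ennreal (k\<^sup>2 * 2) * (ennreal (norm (z - \<zeta>) powr (lam - 2)) * indicator (carleson_box I) z)"
        proof (cases "z \<in> carleson_box I")
          case True
          then have "norm z < 1" by (auto simp: carleson_box_def split: if_splits)
          then show ?thesis using ptw[of z] True by (auto simp: ennreal_mult[symmetric] intro!: ennreal_leI)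
        qed simp
      qed
      also have "\<dots> \<le> ennreal (k\<^sup>2 * 2) * ennreal (C * arc_len I powr lam)"
        using C(2)[OF I \<zeta>(1)] carleson_box_borel[OF I] by (subst nn_integral_cmult) (auto intro!: mult_left_mono)
      also have "\<dots> = ennreal ((k * sqrt (2 * C))\<^sup>2 * arc_len I powr lam)"
        using C(1) by (simp add: ennreal_mult[symmetric] power_mult_distrib algebra_simps)
      finally show "ennsqrt ((\<integral>\<^sup>+z\<in>carleson_box I. ennreal ((norm (deriv f z))\<^sup>2 * (1 - (norm z)\<^sup>2)) \<partial>area_measure)
          / ennreal (arc_len I powr lam)) \<le> ennreal (k * sqrt (2 * C))"
        using k C(1) by (subst ennsqrt_quotient_le_iff[OF I]) auto
    qed
    also have "\<dots> = ennreal (k * (1 + sqrt (2 * C)))"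
      using k C(1) by (subst ennreal_plus[symmetric]) (auto simp: algebra_simps)
    finally have 2: "morrey_norm lam f \<le> 1" by (simp add: k(2))
    have "cnj b * b = of_real ((norm b)\<^sup>2)" by (metis complex_norm_square mult.commute of_real_power)
    then have "1 - cnj b * b = of_real (1 - (norm b)\<^sup>2)" by simp
    then have "norm (1 - cnj b * b) = 1 - (norm b)\<^sup>2"
      using one_minus_norm_sq(3)[OF b] by (simp only: norm_of_real)
    then have "norm (f b) = k * (1 - (norm b)\<^sup>2) powr (- \<beta>)"
      using k norm_powr_of_real[OF nz[OF b], of "- \<beta>"] by (simp add: f_def norm_mult)
    moreover have "- \<beta> = (lam - 1) / 2" by (simp add: \<beta>_def field_simps)
    ultimately show ?thesis using 1 2 by metis
  qed
  with k(1) show ?thesis by blast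
qed

section \<open>Growth estimates from Carleson conditions\<close>

lemma norm_less_1_of_box: "z \<in> carleson_box I \<Longrightarrow> norm z < 1"
  by (auto simp: carleson_box_def split: if_splits)

text \<open>Bookkeeping for the box estimate, solved for \<open>X\<close> = |h(z)|: \<open>d\<close>
  stands for 1 - |z| and \<open>B\<close> for the length of an arc comparable to it.\<close>

lemma square_le_imp_le_powr:
  fixes d s e m B :: real
  assumes "X\<^sup>2 * (d / 2) powr s \<le> m\<^sup>2 * B powr e" "0 < d" "0 < B" "B \<le> 2 * d" "0 \<le> e" "0 \<le> m" "0 \<le> X"
  shows "X \<le> 2 powr ((e + s) / 2) * m * d powr ((e - s) / 2)"
proof -
  have p: "(2 / d) powr s * (d / 2) powr s = 1"
    using assms(2) by (subst powr_mult[symmetric]) auto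
  have "X\<^sup>2 = (2 / d) powr s * (X\<^sup>2 * (d / 2) powr s)" using p by (simp add: ac_simps)
  also have "\<dots> \<le> (2 / d) powr s * (m\<^sup>2 * B powr e)" by (rule mult_left_mono[OF assms(1)]) simp
  also have "\<dots> \<le> (2 / d) powr s * (m\<^sup>2 * (2 * d) powr e)"
    using assms by (intro mult_left_mono powr_mono2) auto
  also have "\<dots> = m\<^sup>2 * (2 powr (e + s) * d powr (e - s))"
    using assms(2) by (simp add: powr_divide powr_mult powr_add powr_diff)
  also have "2 powr (e + s) = (2 powr ((e + s) / 2))\<^sup>2" by (simp add: power2_eq_square powr_add[symmetric])
  also have "d powr (e - s) = (d powr ((e - s) / 2))\<^sup>2" by (simp add: power2_eq_square powr_add[symmetric])
  finally have "X\<^sup>2 \<le> (2 powr ((e + s) / 2) * m * d powr ((e - s) / 2))\<^sup>2"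
    by (simp add: power_mult_distrib ac_simps)
  then show ?thesis by (rule power2_le_imp_le) (use assms in auto)
qed

text \<open>Common source of both growth rates: q = 1, e = \<lambda> yields the exponent
  (\<lambda>-3)/2 for f', while q = p, e = p-\<lambda>+1 yields -(\<lambda>+1)/2 for g', the p
  cancelling.\<close>

lemma norm_le_of_box_integrals:
  assumes h: "h holomorphic_on ball 0 1" and z: "norm z < 1" and "0 \<le> q" "0 \<le> e" "0 \<le> m"
    and box: "\<And>I. I \<in> arcs \<Longrightarrow> ennsqrt ((\<integral>\<^sup>+w\<in>carleson_box I. ennreal ((norm (h w))\<^sup>2 * (1 - (norm w)\<^sup>2) powr q) \<partial>area_measure)
       / ennreal (arc_len I powr e)) \<le> ennreal m"
  shows "norm (h z) \<le> 2 powr ((e + (q + 2)) / 2) * m * (1 - norm z) powr ((e - (q + 2)) / 2)"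
proof -
  obtain I where I: "I \<in> arcs" "1 - norm z \<le> arc_len I" "arc_len I \<le> 2 * (1 - norm z)"
    "ennreal ((norm (h z))\<^sup>2 * ((1 - norm z) / 2) powr (q + 2)) \<le>
      (\<integral>\<^sup>+w\<in>carleson_box I. ennreal ((norm (h w))\<^sup>2 * (1 - (norm w)\<^sup>2) powr q) \<partial>area_measure)"
    using pointwise_le_box_integral[OF h z \<open>0 \<le> q\<close>] .
  have "ennreal ((norm (h z))\<^sup>2 * ((1 - norm z) / 2) powr (q + 2)) \<le> ennreal (m\<^sup>2 * arc_len I powr e)"
    using I(4) box[OF I(1)] ennsqrt_quotient_le_iff[OF I(1) \<open>0 \<le> m\<close>] order_trans by blast
  then have "(norm (h z))\<^sup>2 * ((1 - norm z) / 2) powr (q + 2) \<le> m\<^sup>2 * arc_len I powr e"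
    by (subst (asm) ennreal_le_iff) auto
  then show ?thesis
    by (rule square_le_imp_le_powr) (use z I arc_len_pos assms in auto)
qed

lemma growth_from_deriv:
  assumes f: "f holomorphic_on ball 0 1" and "0 < \<beta>" "0 \<le> K"
    and d: "\<And>z. norm z < 1 \<Longrightarrow> norm (deriv f z) \<le> K * (1 - norm z) powr (- \<beta> - 1)"
    and z: "norm z < 1"
  shows "norm (f z) \<le> norm (f 0) + K / \<beta> * (1 - norm z) powr (- \<beta>)"
proof -
  \<comment> \<open>An antiderivative in t of the bound for the speed of t \<mapsto> f(tz). Because
    \<beta> > 0 it is a pure power.\<close>
  define \<phi> where "\<phi> = (\<lambda>t. K / \<beta> * (1 - t * norm z) powr (- \<beta>))"
  have tz: "t * norm z < 1" if "0 \<le> t" "t \<le> 1" for t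
    using that z mult_left_le_one_le[of "norm z" t] by (auto simp: mult.commute)
  have df: "((\<lambda>t. f (of_real t * z)) has_vector_derivative (z * deriv f (of_real t * z))) (at t)" if "0 \<le> t" "t \<le> 1" for t
  proof -
    have "(f has_field_derivative deriv f (of_real t * z)) (at (of_real t * z))"
      using tz[OF that] that f by (intro holomorphic_derivI[OF f]) (auto simp: norm_mult)
    moreover have "((\<lambda>t. of_real t * z) has_vector_derivative z) (at t)"
      by (auto intro!: derivative_eq_intros simp: has_vector_derivative_def scaleR_conv_of_real)
    ultimately show ?thesis
      using field_vector_diff_chain_at[of "\<lambda>t. of_real t * z" z t f] by (simp add: o_def)
  qed
  have dp: "(\<phi> has_vector_derivative (K * norm z * (1 - t * norm z) powr (- \<beta> - 1))) (at t)" if "0 \<le> t" "t \<le> 1" for t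
    unfolding \<phi>_def has_real_derivative_iff_has_vector_derivative[symmetric]
    using tz[OF that] \<open>0 < \<beta>\<close> by (auto intro!: derivative_eq_intros)
  have "norm (f (of_real 1 * z) - f (of_real 0 * z)) \<le> \<phi> 1 - \<phi> 0"
  proof (rule differentiable_bound_general[OF zero_less_one])
    show "continuous_on {0..1} (\<lambda>t. f (of_real t * z))"
      using df by (auto intro!: continuous_at_imp_continuous_on has_vector_derivative_continuous)
    show "continuous_on {0..1} \<phi>"
      using dp by (auto intro!: continuous_at_imp_continuous_on has_vector_derivative_continuous)
    fix t :: real assume t: "0 < t" "t < 1"
    then show "((\<lambda>t. f (of_real t * z)) has_vector_derivative (z * deriv f (of_real t * z))) (at t)"
      "(\<phi> has_vector_derivative (K * norm z * (1 - t * norm z) powr (- \<beta> - 1))) (at t)"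
      using df dp by auto
    show "norm (z * deriv f (of_real t * z)) \<le> K * norm z * (1 - t * norm z) powr (- \<beta> - 1)"
    proof -
      have "norm (deriv f (of_real t * z)) \<le> K * (1 - t * norm z) powr (- \<beta> - 1)"
        using d[of "of_real t * z"] tz[of t] t by (simp add: norm_mult)
      from mult_left_mono[OF this norm_ge_zero[of z]] show ?thesis by (simp add: norm_mult ac_simps)
    qed
  qed
  moreover have "\<phi> 0 \<ge> 0" using assms by (simp add: \<phi>_def)
  ultimately have "norm (f z - f 0) \<le> K / \<beta> * (1 - norm z) powr (- \<beta>)" by (simp add: \<phi>_def)
  then show ?thesis using norm_triangle_ineq2[of "f z" "f 0"] by linarith
qed

text \<open>The bound is linear in the Carleson norm with a constant common to all f, as an estimate
  of the operator norm requires.\<close>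

lemma morrey_norm_growth:
  assumes lam: "0 < lam" "lam < 1"
  shows "\<exists>C>0. \<forall>f m. f holomorphic_on ball 0 1 \<longrightarrow> 0 \<le> m \<longrightarrow> morrey_norm lam f \<le> ennreal m \<longrightarrow>
    (\<forall>z. norm z < 1 \<longrightarrow> norm (f z) \<le> C * m * (1 - norm z) powr ((lam - 1) / 2))"
proof -
  define \<beta> where "\<beta> = (1 - lam) / 2"
  have \<beta>: "0 < \<beta>" "(lam - 1) / 2 = - \<beta>" "(lam - (1 + 2)) / 2 = - \<beta> - 1" using lam by (auto simp: \<beta>_def field_simps)
  define C where "C = 1 + 2 powr ((lam + (1 + 2)) / 2) / \<beta>"
  have C: "C > 0" using \<beta> by (simp add: C_def add_pos_pos)
  have "norm (f z) \<le> C * m * (1 - norm z) powr (- \<beta>)"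
    if f: "f holomorphic_on ball 0 1" and m: "0 \<le> m" and n: "morrey_norm lam f \<le> ennreal m" and z: "norm z < 1" for f m z
  proof -
    have "ennreal (norm (f 0)) \<le> morrey_norm lam f" by (simp add: morrey_norm_def)
    with n have f0: "norm (f 0) \<le> m" using m by (meson ennreal_le_iff order_trans)
    have box: "ennsqrt ((\<integral>\<^sup>+w\<in>carleson_box I. ennreal ((norm (deriv f w))\<^sup>2 * (1 - (norm w)\<^sup>2) powr 1) \<partial>area_measure)
       / ennreal (arc_len I powr lam)) \<le> ennreal m" if I: "I \<in> arcs" for I
    proof -
      have eq: "(\<integral>\<^sup>+w\<in>carleson_box I. ennreal ((norm (deriv f w))\<^sup>2 * (1 - (norm w)\<^sup>2) powr 1) \<partial>area_measure) =
        (\<integral>\<^sup>+w\<in>carleson_box I. ennreal ((norm (deriv f w))\<^sup>2 * (1 - (norm w)\<^sup>2)) \<partial>area_measure)"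
        using one_minus_norm_sq(3)[OF norm_less_1_of_box]
        by (intro nn_integral_cong) (auto simp: indicator_def less_imp_le)
      have "ennsqrt ((\<integral>\<^sup>+w\<in>carleson_box I. ennreal ((norm (deriv f w))\<^sup>2 * (1 - (norm w)\<^sup>2)) \<partial>area_measure)
       / ennreal (arc_len I powr lam)) \<le> morrey_norm lam f"
        unfolding morrey_norm_def by (rule add_increasing) (auto intro: SUP_upper I)
      then show ?thesis unfolding eq using n by simp
    qed
    have "deriv f holomorphic_on ball 0 1" using f by (intro holomorphic_deriv) auto
    from norm_le_of_box_integrals[OF this _ _ _ m box] lam
    have "norm (deriv f w) \<le> 2 powr ((lam + (1 + 2)) / 2) * m * (1 - norm w) powr (- \<beta> - 1)" if "norm w < 1" for w
      using that unfolding \<beta>(3) by auto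
    then have "norm (f z) \<le> norm (f 0) + 2 powr ((lam + (1 + 2)) / 2) * m / \<beta> * (1 - norm z) powr (- \<beta>)"
      using z m \<beta> by (intro growth_from_deriv[OF f]) auto
    also have "norm (f 0) \<le> m * (1 - norm z) powr (- \<beta>)"
    proof -
      have "1 powr (- \<beta>) \<le> (1 - norm z) powr (- \<beta>)" using \<beta> z by (intro powr_mono2') auto
      then show ?thesis using f0 m mult_left_mono[of 1 "(1 - norm z) powr (- \<beta>)" m] by simp
    qed
    finally show ?thesis by (simp add: C_def algebra_simps)
  qed
  with C \<beta>(2) show ?thesis by metis
qed

lemma bm_seminorm_imp_deriv_bound:
  assumes lam: "0 < lam" "lam < 1" and p: "1 < p"
  shows "\<exists>C>0. \<forall>g m. g holomorphic_on ball 0 1 \<longrightarrow> 0 \<le> m \<longrightarrow> bm_seminorm p lam g \<le> ennreal m \<longrightarrow>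
    (\<forall>z. norm z < 1 \<longrightarrow> norm (deriv g z) \<le> C * m * (1 - norm z) powr (- (lam + 1) / 2))"
proof (intro exI conjI allI impI)
  show "2 powr ((p - lam + 1 + (p + 2)) / 2) > (0::real)" by simp
  fix g :: "complex \<Rightarrow> complex" and m :: real and z :: complex
  assume g: "g holomorphic_on ball 0 1" and m: "0 \<le> m" "bm_seminorm p lam g \<le> ennreal m" and z: "norm z < 1"
  have "norm (deriv g z) \<le> 2 powr ((p - lam + 1 + (p + 2)) / 2) * m * (1 - norm z) powr ((p - lam + 1 - (p + 2)) / 2)"
  proof (rule norm_le_of_box_integrals[OF _ z])
    show "deriv g holomorphic_on ball 0 1" using g by (intro holomorphic_deriv) auto
    show "ennsqrt ((\<integral>\<^sup>+w\<in>carleson_box I. ennreal ((norm (deriv g w))\<^sup>2 * (1 - (norm w)\<^sup>2) powr p) \<partial>area_measure)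
       / ennreal (arc_len I powr (p - lam + 1))) \<le> ennreal m" if "I \<in> arcs" for I
      using SUP_upper[OF that] m(2) unfolding bm_seminorm_def by (rule order_trans)
  qed (use lam p m in auto)
  then show "norm (deriv g z) \<le> 2 powr ((p - lam + 1 + (p + 2)) / 2) * m * (1 - norm z) powr (- (lam + 1) / 2)"
    by (simp add: algebra_simps)
qed

text \<open>Inserting the bound leaves the weight of exponent p-\<lambda>-1, which exceeds -1
  because p > 1 > \<lambda>; integrating it over a box returns |I|^(p-\<lambda>+1), the
  normalisation in the seminorm.\<close>

lemma deriv_bound_imp_bm_seminorm:
  assumes lam: "0 < lam" "lam < 1" and p: "1 < p"
  shows "\<exists>C>0. \<forall>g m. 0 \<le> m \<longrightarrow>
    (\<forall>z. norm z < 1 \<longrightarrow> norm (deriv g z) \<le> m * (1 - norm z) powr (- (lam + 1) / 2)) \<longrightarrow>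
    bm_seminorm p lam g \<le> ennreal (C * m)"
proof -
  obtain B where B: "B > 0" "\<And>I. I \<in> arcs \<Longrightarrow>
    (\<integral>\<^sup>+z\<in>carleson_box I. ennreal ((1 - (norm z)\<^sup>2) powr (p - lam - 1)) \<partial>area_measure)
     \<le> ennreal (B * arc_len I powr (p - lam - 1 + 2))"
    using box_weight_integral[of "p - lam - 1"] lam p by auto
  define C where "C = sqrt (2 powr (lam + 1) * B)"
  have C: "C > 0" "C\<^sup>2 = 2 powr (lam + 1) * B" using B by (auto simp: C_def)
  have "bm_seminorm p lam g \<le> ennreal (C * m)"
    if m: "0 \<le> m" and d: "\<And>z. norm z < 1 \<Longrightarrow> norm (deriv g z) \<le> m * (1 - norm z) powr (- (lam + 1) / 2)" for g m
    unfolding bm_seminorm_def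
  proof (rule SUP_least)
    fix I assume I: "I \<in> arcs"
    have ptw: "(norm (deriv g z))\<^sup>2 * (1 - (norm z)\<^sup>2) powr p \<le> m\<^sup>2 * 2 powr (lam + 1) * (1 - (norm z)\<^sup>2) powr (p - lam - 1)"
      if z: "norm z < 1" for z
    proof -
      define y where "y = 1 - (norm z)\<^sup>2"
      have y: "0 < y" "y \<le> 2 * (1 - norm z)" using one_minus_norm_sq[OF z] by (auto simp: y_def)
      have "(norm (deriv g z))\<^sup>2 \<le> (m * (1 - norm z) powr (- (lam + 1) / 2))\<^sup>2"
        using d[OF z] by (intro power_mono) auto
      also have "\<dots> = m\<^sup>2 * (1 - norm z) powr (- (lam + 1))"
        by (simp add: power_mult_distrib power2_eq_square powr_add[symmetric])
      also have "\<dots> \<le> m\<^sup>2 * (y / 2) powr (- (lam + 1))"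
        using y z lam by (intro mult_left_mono powr_mono2') auto
      also have "(y / 2) powr (- (lam + 1)) = 2 powr (lam + 1) * y powr (- (lam + 1))"
        using powr_divide[of y 2 "- (lam + 1)"] powr_minus_divide[of 2 "lam + 1"] y by simp
      finally have "(norm (deriv g z))\<^sup>2 * y powr p \<le> m\<^sup>2 * (2 powr (lam + 1) * y powr (- (lam + 1))) * y powr p"
        by (rule mult_right_mono) auto
      also have "\<dots> = m\<^sup>2 * 2 powr (lam + 1) * (y powr (- (lam + 1)) * y powr p)" by simp
      also have "y powr (- (lam + 1)) * y powr p = y powr (p - lam - 1)"
        unfolding powr_add[symmetric] by (simp add: algebra_simps)
      finally show ?thesis by (simp add: y_def)
    qed
    have "(\<integral>\<^sup>+z\<in>carleson_box I. ennreal ((norm (deriv g z))\<^sup>2 * (1 - (norm z)\<^sup>2) powr p) \<partial>area_measure) \<le>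
      (\<integral>\<^sup>+z. ennreal (m\<^sup>2 * 2 powr (lam + 1)) * (ennreal ((1 - (norm z)\<^sup>2) powr (p - lam - 1)) * indicator (carleson_box I) z) \<partial>area_measure)"
    proof (rule nn_integral_mono)
      fix z
      show "ennreal ((norm (deriv g z))\<^sup>2 * (1 - (norm z)\<^sup>2) powr p) * indicator (carleson_box I) z \<le>
        ennreal (m\<^sup>2 * 2 powr (lam + 1)) * (ennreal ((1 - (norm z)\<^sup>2) powr (p - lam - 1)) * indicator (carleson_box I) z)"
        using ptw[OF norm_less_1_of_box, of z I] m
        by (cases "z \<in> carleson_box I") (auto simp: ennreal_mult[symmetric] intro!: ennreal_leI)
    qed
    also have "\<dots> \<le> ennreal (m\<^sup>2 * 2 powr (lam + 1)) * ennreal (B * arc_len I powr (p - lam - 1 + 2))"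
      using B(2)[OF I] carleson_box_borel[OF I] by (subst nn_integral_cmult) (auto intro!: mult_left_mono)
    also have "\<dots> = ennreal ((C * m)\<^sup>2 * arc_len I powr (p - lam + 1))"
      using B(1) C by (simp add: ennreal_mult[symmetric] power_mult_distrib algebra_simps)
    finally show "ennsqrt ((\<integral>\<^sup>+z\<in>carleson_box I. ennreal ((norm (deriv g z))\<^sup>2 * (1 - (norm z)\<^sup>2) powr p) \<partial>area_measure)
          / ennreal (arc_len I powr (p - lam + 1))) \<le> ennreal (C * m)"
      using C m by (subst ennsqrt_quotient_le_iff[OF I]) auto
  qed
  with C(1) show ?thesis by blast
qed

section \<open>Growth of Morrey functions from the boundary condition\<close>

lemma norm_one_minus_mult_cnj:
  assumes "norm \<zeta> = 1"
  shows "norm (1 - z * cnj \<zeta>) = norm (\<zeta> - z)"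
proof -
  have "cnj \<zeta> * \<zeta> = 1" using assms complex_norm_square[of \<zeta>] by (simp add: mult.commute)
  then have "1 - z * cnj \<zeta> = cnj \<zeta> * (\<zeta> - z)" by (simp add: algebra_simps)
  then show ?thesis using assms by (simp add: norm_mult)
qed

text \<open>The dilates \<open>f\<^sub>r\<close> are bounded in \<open>L\<^sup>2\<close>, so truncating them at height \<open>M\<close> costs only \<open>O(1/M)\<close> in
  \<open>L\<^sup>1\<close>, while the truncations converge by dominated convergence.\<close>

lemma hardy2_cauchy_bound:
  assumes f: "f \<in> hardy2" and F: "boundary_function f F" and z: "norm z < 1"
  shows "ennreal (norm (f z)) \<le> (\<integral>\<^sup>+\<zeta>. ennreal (norm (F \<zeta>) / norm (1 - z * cnj \<zeta>)) \<partial>circle_measure)"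
proof -
  have hol: "f holomorphic_on ball 0 1" using f by (simp add: hardy2_def)
  have Fm[measurable]: "F \<in> borel_measurable borel" using F by (simp add: boundary_function_def)
  define v where "v = (\<lambda>w. indicator (ball 0 1) w *\<^sub>R f w)"
  have vm[measurable]: "v \<in> borel_measurable borel"
    unfolding v_def by (intro borel_measurable_continuous_on_indicator holomorphic_on_imp_continuous_on hol) auto
  have vf: "v w = f w" if "norm w < 1" for w using that by (simp add: v_def)
  obtain B where B: "0 \<le> B" "(SUP r\<in>{0..<1::real}.
        \<integral>\<^sup>+\<zeta>. ennreal ((norm (f (of_real r * \<zeta>)))\<^sup>2) \<partial>circle_measure) = ennreal B"
    using f by (auto simp: hardy2_def elim!: ennreal_cases[of "SUP r\<in>_. _ r"] simp: less_top_ennreal)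
  \<comment> \<open>A bound for the Cauchy kernel on the circle, where |\<zeta> - z| \<ge> 1 -
    |z|.\<close>
  define K where "K = 1 / (1 - norm z)"
  have K: "K > 0" using z by (simp add: K_def)
  define k where "k = (\<lambda>\<zeta>. 1 / norm (1 - z * cnj \<zeta>))"
  have kK: "k \<zeta> \<le> K" if "norm \<zeta> = 1" for \<zeta>
    using norm_triangle_ineq2[of \<zeta> z] that z unfolding k_def K_def norm_one_minus_mult_cnj[OF that]
    by (intro divide_left_mono mult_pos_pos) auto
  have k0: "0 \<le> k \<zeta>" for \<zeta> by (simp add: k_def)
  have [measurable]: "k \<in> borel_measurable borel" unfolding k_def by measurable
  \<comment> \<open>The shift by two keeps every radius strictly positive.\<close>
  define r where "r = (\<lambda>n. 1 - inverse (real (Suc (Suc n))))"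
  have r: "0 < r n" "r n < 1" for n by (auto simp: r_def field_simps)
  have "r \<longlonglongrightarrow> 1 - 0"
    unfolding r_def by (intro tendsto_intros LIMSEQ_Suc[OF LIMSEQ_inverse_real_of_nat])
  then have rl: "r \<longlonglongrightarrow> 1" by simp
  have rl': "filterlim r (at_left 1) sequentially"
    using rl r(2) by (auto simp: filterlim_at less_imp_neq)
  have mr[measurable]: "(\<lambda>\<zeta>. v (of_real (r n) * \<zeta>)) \<in> borel_measurable borel" for n
    by (rule measurable_compose[OF mult_measurable_complex vm])
  have main: "ennreal (norm (f z)) \<le> (\<integral>\<^sup>+\<zeta>. ennreal (norm (F \<zeta>) * k \<zeta>) \<partial>circle_measure) + ennreal (K * B / M)"
    if M: "0 < M" for M
  proof -
    define a where "a = (\<lambda>n \<zeta>. norm (v (of_real (r n) * \<zeta>)))"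
    have am[measurable]: "a n \<in> borel_measurable borel" for n unfolding a_def by measurable
    have step: "ennreal (norm (f (of_real (r n) * z))) \<le>
      (\<integral>\<^sup>+\<zeta>. ennreal (min (a n \<zeta>) M * k \<zeta>) \<partial>circle_measure) + ennreal (K * B / M)" for n
    proof -
      define S where "S = {w::complex. norm (of_real (r n) * w) < 1}"
      have S: "open S" unfolding S_def by (intro open_Collect_less continuous_intros)
      have "cball 0 1 \<subseteq> S"
        using r[of n] by (auto simp: S_def norm_mult intro: le_less_trans[OF mult_left_le])
      moreover have "(\<lambda>w. f (of_real (r n) * w)) holomorphic_on S"
        by (rule holomorphic_on_compose_gen[OF _ hol, unfolded o_def]) (auto simp: S_def intro!: holomorphic_intros)
      then have "(\<lambda>w. v (of_real (r n) * w)) holomorphic_on S"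
        by (rule holomorphic_transform) (auto simp: S_def vf)
      ultimately have "(LINT \<zeta>|circle_measure. v (of_real (r n) * \<zeta>) / (1 - z * cnj \<zeta>)) = v (of_real (r n) * z)"
        using S z by (intro cauchy_circle[of _ S]) auto
      moreover have rz: "norm (of_real (r n) * z) < 1"
        using r[of n] z mult_left_le_one_le[of "norm z" "r n"] by (auto simp: norm_mult)
      ultimately have "ennreal (norm (f (of_real (r n) * z))) =
          ennreal (norm (LINT \<zeta>|circle_measure. v (of_real (r n) * \<zeta>) / (1 - z * cnj \<zeta>)))"
        by (simp add: vf)
      also have "\<dots> \<le> (\<integral>\<^sup>+\<zeta>. ennreal (norm (v (of_real (r n) * \<zeta>) / (1 - z * cnj \<zeta>))) \<partial>circle_measure)"
        by (rule norm_lebesgue_integral_le_nn_integral)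
      also have "\<dots> \<le> (\<integral>\<^sup>+\<zeta>. ennreal (min (a n \<zeta>) M * k \<zeta>) + ennreal (K / M) * ennreal ((norm (f (of_real (r n) * \<zeta>)))\<^sup>2) \<partial>circle_measure)"
      proof (rule nn_integral_mono_AE, use AE_circle_norm in eventually_elim)
        fix \<zeta> :: complex assume \<zeta>: "norm \<zeta> = 1"
        have fa: "norm (f (of_real (r n) * \<zeta>)) = a n \<zeta>"
          unfolding a_def using r[of n] \<zeta> by (subst vf) (auto simp: norm_mult)
        \<comment> \<open>Truncation: where a exceeds M, a itself is at most a^2/M, which the Hardy
          bound controls uniformly in n.\<close>
        have "a n \<zeta> \<le> min (a n \<zeta>) M + (a n \<zeta>)\<^sup>2 / M"
        proof (cases "a n \<zeta> \<le> M")
          case False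
          then have "a n \<zeta> * M \<le> (a n \<zeta>)\<^sup>2" using M by (simp add: power2_eq_square)
          then have "a n \<zeta> \<le> (a n \<zeta>)\<^sup>2 / M" using M by (simp add: pos_le_divide_eq)
          then show ?thesis using False M by simp
        qed (use M in simp)
        then have "a n \<zeta> * k \<zeta> \<le> (min (a n \<zeta>) M + (a n \<zeta>)\<^sup>2 / M) * k \<zeta>"
          by (rule mult_right_mono) (rule k0)
        also have "\<dots> \<le> min (a n \<zeta>) M * k \<zeta> + K / M * (a n \<zeta>)\<^sup>2"
          using mult_left_mono[OF kK[OF \<zeta>], of "(a n \<zeta>)\<^sup>2 / M"] M by (simp add: algebra_simps)
        finally have "norm (v (of_real (r n) * \<zeta>) / (1 - z * cnj \<zeta>)) \<le> min (a n \<zeta>) M * k \<zeta> + K / M * (a n \<zeta>)\<^sup>2"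
          by (simp add: a_def k_def norm_divide)
        then have "ennreal (norm (v (of_real (r n) * \<zeta>) / (1 - z * cnj \<zeta>))) \<le>
          ennreal (min (a n \<zeta>) M * k \<zeta> + K / M * (a n \<zeta>)\<^sup>2)" by (rule ennreal_leI)
        also have "\<dots> = ennreal (min (a n \<zeta>) M * k \<zeta>) + ennreal (K / M * (a n \<zeta>)\<^sup>2)"
          using M K k0[of \<zeta>] by (intro ennreal_plus mult_nonneg_nonneg) (auto simp: a_def)
        also have "ennreal (K / M * (a n \<zeta>)\<^sup>2) = ennreal (K / M) * ennreal ((a n \<zeta>)\<^sup>2)"
          using M K by (intro ennreal_mult) auto
        finally show "ennreal (norm (v (of_real (r n) * \<zeta>) / (1 - z * cnj \<zeta>))) \<le>
          ennreal (min (a n \<zeta>) M * k \<zeta>) + ennreal (K / M) * ennreal ((norm (f (of_real (r n) * \<zeta>)))\<^sup>2)"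
          unfolding fa .
      qed
      also have "\<dots> = (\<integral>\<^sup>+\<zeta>. ennreal (min (a n \<zeta>) M * k \<zeta>) + ennreal (K / M) * ennreal ((a n \<zeta>)\<^sup>2) \<partial>circle_measure)"
        by (rule nn_integral_cong_AE, use AE_circle_norm in eventually_elim)
           (use r[of n] in \<open>auto simp: a_def vf norm_mult\<close>)
      also have "\<dots> = (\<integral>\<^sup>+\<zeta>. ennreal (min (a n \<zeta>) M * k \<zeta>) \<partial>circle_measure) + ennreal (K / M) * (\<integral>\<^sup>+\<zeta>. ennreal ((a n \<zeta>)\<^sup>2) \<partial>circle_measure)"
        by (subst nn_integral_add; (subst nn_integral_cmult)?) auto
      also have "(\<integral>\<^sup>+\<zeta>. ennreal ((a n \<zeta>)\<^sup>2) \<partial>circle_measure) = (\<integral>\<^sup>+\<zeta>. ennreal ((norm (f (of_real (r n) * \<zeta>)))\<^sup>2) \<partial>circle_measure)"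
        by (rule nn_integral_cong_AE, use AE_circle_norm in eventually_elim)
           (use r[of n] in \<open>auto simp: a_def vf norm_mult\<close>)
      also have "\<dots> \<le> ennreal B"
        unfolding B(2)[symmetric] by (rule SUP_upper) (use r[of n] in auto)
      finally show ?thesis using K M B(1)
        by (simp add: ennreal_mult[symmetric] add_left_mono mult_left_mono)
    qed
    have "(\<lambda>n. (\<integral>\<^sup>+\<zeta>. ennreal (min (a n \<zeta>) M * k \<zeta>) \<partial>circle_measure)) \<longlonglongrightarrow>
      (\<integral>\<^sup>+\<zeta>. ennreal (min (norm (F \<zeta>)) M * k \<zeta>) \<partial>circle_measure)"
    proof (rule nn_integral_dominated_convergence[where w = "\<lambda>_. ennreal (M * K)"])
      show "AE \<zeta> in circle_measure. ennreal (min (a n \<zeta>) M * k \<zeta>) \<le> ennreal (M * K)" for n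
        using AE_circle_norm
        by eventually_elim (use M K k0 kK in \<open>auto intro!: ennreal_leI mult_mono simp: a_def\<close>)
      have "AE \<zeta> in circle_measure. ((\<lambda>r::real. f (of_real r * \<zeta>)) \<longlongrightarrow> F \<zeta>) (at_left 1)"
        using F by (simp add: boundary_function_def)
      then show "AE \<zeta> in circle_measure. (\<lambda>n. ennreal (min (a n \<zeta>) M * k \<zeta>)) \<longlonglongrightarrow> ennreal (min (norm (F \<zeta>)) M * k \<zeta>)"
        using AE_circle_norm
      proof eventually_elim
        fix \<zeta> :: complex assume l: "((\<lambda>r::real. f (of_real r * \<zeta>)) \<longlongrightarrow> F \<zeta>) (at_left 1)" and \<zeta>: "norm \<zeta> = 1"
        have "(\<lambda>n. f (of_real (r n) * \<zeta>)) \<longlonglongrightarrow> F \<zeta>"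
          using filterlim_compose[OF l rl'] .
        moreover have "f (of_real (r n) * \<zeta>) = v (of_real (r n) * \<zeta>)" for n
          using r[of n] \<zeta> by (subst vf) (auto simp: norm_mult)
        ultimately have "(\<lambda>n. v (of_real (r n) * \<zeta>)) \<longlonglongrightarrow> F \<zeta>" by simp
        then show "(\<lambda>n. ennreal (min (a n \<zeta>) M * k \<zeta>)) \<longlonglongrightarrow> ennreal (min (norm (F \<zeta>)) M * k \<zeta>)"
          unfolding a_def by (intro tendsto_intros)
      qed
    qed (auto simp: ennreal_mult_less_top)
    then have lim: "(\<lambda>n. (\<integral>\<^sup>+\<zeta>. ennreal (min (a n \<zeta>) M * k \<zeta>) \<partial>circle_measure) + ennreal (K * B / M)) \<longlonglongrightarrow>
      (\<integral>\<^sup>+\<zeta>. ennreal (min (norm (F \<zeta>)) M * k \<zeta>) \<partial>circle_measure) + ennreal (K * B / M)"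
      by (intro tendsto_intros)
    have "isCont f z"
      using hol z by (intro continuous_on_interior[OF holomorphic_on_imp_continuous_on[OF hol]]) auto
    moreover have "(\<lambda>n. of_real (r n) * z) \<longlonglongrightarrow> of_real 1 * z" by (intro tendsto_intros rl)
    ultimately have "(\<lambda>n. f (of_real (r n) * z)) \<longlonglongrightarrow> f z"
      using isCont_tendsto_compose[of z f] by auto
    then have "(\<lambda>n. ennreal (norm (f (of_real (r n) * z)))) \<longlonglongrightarrow> ennreal (norm (f z))"
      by (intro tendsto_intros)
    from LIMSEQ_le[OF this lim] step
    have "ennreal (norm (f z)) \<le> (\<integral>\<^sup>+\<zeta>. ennreal (min (norm (F \<zeta>)) M * k \<zeta>) \<partial>circle_measure) + ennreal (K * B / M)"
      by blast
    also have "\<dots> \<le> (\<integral>\<^sup>+\<zeta>. ennreal (norm (F \<zeta>) * k \<zeta>) \<partial>circle_measure) + ennreal (K * B / M)"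
      using k0 by (intro add_right_mono nn_integral_mono ennreal_leI mult_right_mono) auto
    finally show ?thesis .
  qed
  have "ennreal (norm (f z)) \<le> (\<integral>\<^sup>+\<zeta>. ennreal (norm (F \<zeta>) * k \<zeta>) \<partial>circle_measure)"
  proof (rule ennreal_le_epsilon)
    fix e :: real assume e: "0 < e"
    \<comment> \<open>The summand 1 keeps the height positive when B = 0.\<close>
    define M where "M = K * B / e + 1"
    have "K * B / e \<ge> 0" using K B e by simp
    then have M: "0 < M" by (simp add: M_def)
    have "K * B \<le> e * M" using e by (simp add: M_def field_simps)
    then have "K * B / M \<le> e" using M by (simp add: pos_divide_le_eq)
    then show "ennreal (norm (f z)) \<le> (\<integral>\<^sup>+\<zeta>. ennreal (norm (F \<zeta>) * k \<zeta>) \<partial>circle_measure) + ennreal e"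
      using main[OF M] by (meson add_left_mono ennreal_leI order_trans)
  qed
  then show ?thesis by (simp add: k_def)
qed

section \<open>Centred arcs of normalised length 2^-k, the whole circle at k = 0, and the size of
  boundary functions on them\<close>

definition dyadic_arc :: "real \<Rightarrow> nat \<Rightarrow> complex set" where
  "dyadic_arc \<theta> k = cis ` {\<theta> - pi / 2 ^ k..\<theta> + pi / 2 ^ k}"

lemma dyadic_arc: "dyadic_arc \<theta> k \<in> arcs" "arc_len (dyadic_arc \<theta> k) = 1 / 2 ^ k"
  "dyadic_arc \<theta> (Suc k) \<subseteq> dyadic_arc \<theta> k"
proof -
  have le: "pi / 2 ^ k \<le> pi" by (simp add: pos_divide_le_eq)
  have pos: "0 < pi / 2 ^ k" by simp
  have ab: "\<theta> - pi / 2 ^ k < \<theta> + pi / 2 ^ k" "\<theta> + pi / 2 ^ k \<le> \<theta> - pi / 2 ^ k + 2 * pi"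
    using le pos by linarith+
  then show "dyadic_arc \<theta> k \<in> arcs" unfolding arcs_def dyadic_arc_def by blast
  show "arc_len (dyadic_arc \<theta> k) = 1 / 2 ^ k"
    unfolding dyadic_arc_def using ab by (subst arc_len_arc) auto
  have "pi / 2 ^ Suc k \<le> pi / 2 ^ k" by (intro divide_left_mono) auto
  then show "dyadic_arc \<theta> (Suc k) \<subseteq> dyadic_arc \<theta> k"
    unfolding dyadic_arc_def by (intro image_mono) auto
qed

text \<open>In place of the Cauchy-Schwarz inequality, x \<le> t^\<beta> x^2 + t^-\<beta> is
  integrated over the arc of length t. The weight is chosen so that both terms become multiples of
  t^(1-\<beta>); the constant is K + 1 rather than sqrt K.\<close>

lemma morrey_oscillation_L1:
  fixes F :: "complex \<Rightarrow> complex" and K \<beta> :: real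
  assumes [measurable]: "F \<in> borel_measurable borel" and I: "I \<in> arcs" and K: "0 \<le> K"
    and bd: "(\<integral>\<^sup>+\<zeta>\<in>I. ennreal ((norm (F \<zeta> - c))\<^sup>2) \<partial>circle_measure) \<le> ennreal (K * arc_len I powr (1 - 2 * \<beta>))"
  shows "(\<integral>\<^sup>+\<zeta>\<in>I. ennreal (norm (F \<zeta> - c)) \<partial>circle_measure) \<le> ennreal ((K + 1) * arc_len I powr (1 - \<beta>))"
proof -
  define t where "t = arc_len I"
  have t: "0 < t" using arc_len_pos[OF I] by (simp add: t_def)
  have [measurable]: "I \<in> sets borel" using I by measurable
  have pt: "x \<le> t powr \<beta> * x\<^sup>2 + t powr (- \<beta>)" if "0 \<le> x" for x :: real
  proof (cases "x \<le> t powr (- \<beta>)")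
    case False
    have "1 = t powr \<beta> * t powr (- \<beta>)" using t by (simp add: powr_add[symmetric])
    also have "\<dots> \<le> t powr \<beta> * x" using False by (intro mult_left_mono) auto
    finally have "1 * x \<le> t powr \<beta> * x * x" using that by (intro mult_right_mono) auto
    then have "x \<le> t powr \<beta> * x\<^sup>2" by (simp add: power2_eq_square mult.assoc)
    then show ?thesis by (rule add_increasing2[rotated]) simp
  qed (simp add: add_increasing)
  have "(\<integral>\<^sup>+\<zeta>\<in>I. ennreal (norm (F \<zeta> - c)) \<partial>circle_measure) \<le>
    (\<integral>\<^sup>+\<zeta>. ennreal (t powr \<beta>) * (ennreal ((norm (F \<zeta> - c))\<^sup>2) * indicator I \<zeta>) + ennreal (t powr (- \<beta>)) * indicator I \<zeta> \<partial>circle_measure)"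
  proof (rule nn_integral_mono)
    fix \<zeta>
    show "ennreal (norm (F \<zeta> - c)) * indicator I \<zeta> \<le>
      ennreal (t powr \<beta>) * (ennreal ((norm (F \<zeta> - c))\<^sup>2) * indicator I \<zeta>) + ennreal (t powr (- \<beta>)) * indicator I \<zeta>"
      using pt[of "norm (F \<zeta> - c)"]
      by (cases "\<zeta> \<in> I") (auto simp: ennreal_mult[symmetric] ennreal_plus[symmetric] simp del: ennreal_plus intro!: ennreal_leI)
  qed
  also have "\<dots> = ennreal (t powr \<beta>) * (\<integral>\<^sup>+\<zeta>\<in>I. ennreal ((norm (F \<zeta> - c))\<^sup>2) \<partial>circle_measure) + ennreal (t powr (- \<beta>)) * ennreal t"
    by (subst nn_integral_add) (auto simp: nn_integral_cmult nn_integral_cmult_indicator emeasure_arc_len t_def)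
  also have "\<dots> \<le> ennreal (t powr \<beta>) * ennreal (K * t powr (1 - 2 * \<beta>)) + ennreal (t powr (- \<beta>)) * ennreal t"
    using bd by (intro add_right_mono mult_left_mono) (auto simp: t_def)
  also have "\<dots> = ennreal (K * (t powr \<beta> * t powr (1 - 2 * \<beta>)) + t powr (- \<beta>) * t powr 1)"
    using t K by (simp add: ennreal_mult[symmetric] ennreal_plus[symmetric] ac_simps del: ennreal_plus)
  also have "t powr \<beta> * t powr (1 - 2 * \<beta>) = t powr (1 - \<beta>)"
    unfolding powr_add[symmetric] by (simp add: algebra_simps)
  also have "t powr (- \<beta>) * t powr 1 = t powr (1 - \<beta>)"
    unfolding powr_add[symmetric] by (simp add: algebra_simps)
  finally show ?thesis by (simp add: t_def algebra_simps)
qed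

text \<open>On the half-length arc J of I the integral is at most the oscillation over I plus |J|
  times the mean over I, that is, half the previous bound. The recurrence x(k+1) \<le> x(k)/2 +
  (K+1) q^k keeps the rate q^k because q = 2^(\<beta>-1) > 1/2, which is where \<beta> > 0
  enters.\<close>

lemma dyadic_arc_integral_bound:
  fixes K \<beta> :: real
  assumes Fm[measurable]: "F \<in> borel_measurable borel" and \<beta>: "0 < \<beta>" "\<beta> < 1" and K: "0 \<le> K"
    and bd: "\<And>I. I \<in> arcs \<Longrightarrow> (\<integral>\<^sup>+\<zeta>\<in>I. ennreal ((norm (F \<zeta> - arc_mean F I))\<^sup>2) \<partial>circle_measure) \<le> ennreal (K * arc_len I powr (1 - 2 * \<beta>))"
  shows "\<exists>D\<ge>0. \<forall>\<theta> k. (\<integral>\<^sup>+\<zeta>\<in>dyadic_arc \<theta> k. ennreal (norm (F \<zeta>)) \<partial>circle_measure) \<le> ennreal (D * (2 powr (\<beta> - 1)) ^ k)"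
proof -
  define q :: real where "q = 2 powr (\<beta> - 1)"
  have "2 powr (- 1) < 2 powr (\<beta> - 1)" by (subst powr_less_cancel_iff) (use \<beta> in auto)
  then have q: "1 / 2 < q" by (simp add: q_def powr_minus)
  have split: "(\<integral>\<^sup>+\<zeta>\<in>J. ennreal (norm (F \<zeta>)) \<partial>circle_measure) \<le>
      ennreal ((K + 1) * arc_len I powr (1 - \<beta>)) + ennreal (norm (arc_mean F I)) * ennreal (arc_len J)"
    if I: "I \<in> arcs" and J: "J \<in> arcs" "J \<subseteq> I" for I J
  proof -
    have [measurable]: "I \<in> sets borel" "J \<in> sets borel" using I J by measurable
    have "(\<integral>\<^sup>+\<zeta>\<in>J. ennreal (norm (F \<zeta>)) \<partial>circle_measure) \<le>
      (\<integral>\<^sup>+\<zeta>. ennreal (norm (F \<zeta> - arc_mean F I)) * indicator I \<zeta> + ennreal (norm (arc_mean F I)) * indicator J \<zeta> \<partial>circle_measure)"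
    proof (rule nn_integral_mono)
      fix \<zeta>
      have "norm (F \<zeta>) \<le> norm (F \<zeta> - arc_mean F I) + norm (arc_mean F I)"
        using norm_triangle_ineq[of "F \<zeta> - arc_mean F I" "arc_mean F I"] by simp
      then show "ennreal (norm (F \<zeta>)) * indicator J \<zeta> \<le>
        ennreal (norm (F \<zeta> - arc_mean F I)) * indicator I \<zeta> + ennreal (norm (arc_mean F I)) * indicator J \<zeta>"
        using J by (cases "\<zeta> \<in> J") (auto simp: ennreal_plus[symmetric] subset_iff simp del: ennreal_plus intro!: ennreal_leI)
    qed
    also have "\<dots> = (\<integral>\<^sup>+\<zeta>\<in>I. ennreal (norm (F \<zeta> - arc_mean F I)) \<partial>circle_measure) + ennreal (norm (arc_mean F I)) * ennreal (arc_len J)"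
      by (subst nn_integral_add) (auto simp: nn_integral_cmult_indicator emeasure_arc_len)
    also have "\<dots> \<le> ennreal ((K + 1) * arc_len I powr (1 - \<beta>)) + ennreal (norm (arc_mean F I)) * ennreal (arc_len J)"
      by (intro add_right_mono morrey_oscillation_L1[OF Fm I K bd[OF I]])
    finally show ?thesis .
  qed
  define D0 where "D0 = (K + 1) + norm (arc_mean F (dyadic_arc 0 0))"
  \<comment> \<open>\<open>arc_mean\<close> is a complex number in every case, so finite oscillation
    over the whole circle already gives a finite L1 norm. Starting from the whole circle makes the
    bound uniform in \<theta>.\<close>
  have all: "(\<integral>\<^sup>+\<zeta>. ennreal (norm (F \<zeta>)) \<partial>circle_measure) \<le> ennreal D0"
  proof -
    have "(\<integral>\<^sup>+\<zeta>. ennreal (norm (F \<zeta>)) \<partial>circle_measure) = (\<integral>\<^sup>+\<zeta>\<in>dyadic_arc 0 0. ennreal (norm (F \<zeta>)) \<partial>circle_measure)"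
    proof (rule nn_integral_cong_AE, use AE_circle_norm in eventually_elim)
      fix \<zeta> :: complex assume "norm \<zeta> = 1"
      then obtain s where "\<bar>s\<bar> \<le> pi" "\<zeta> = cis (0 + s)" using unit_circle_arc[of \<zeta> 0] by blast
      then have "\<zeta> \<in> dyadic_arc 0 0" unfolding dyadic_arc_def by (intro image_eqI[of _ _ s]) auto
      then show "ennreal (norm (F \<zeta>)) = ennreal (norm (F \<zeta>)) * indicator (dyadic_arc 0 0) \<zeta>" by simp
    qed
    also have "\<dots> \<le> ennreal D0"
      using split[OF dyadic_arc(1) dyadic_arc(1) order_refl, of 0 0] K
      by (simp add: dyadic_arc(2) D0_def)
    finally show ?thesis .
  qed
  \<comment> \<open>The first entry starts the induction, the second absorbs the oscillation term in
    its step.\<close>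
  define D where "D = max D0 ((K + 1) / (q - 1 / 2))"
  have D: "D0 \<le> D" "K + 1 \<le> D * (q - 1 / 2)" "0 \<le> D"
  proof -
    show "D0 \<le> D" by (simp add: D_def)
    moreover have "0 \<le> D0" using K by (simp add: D0_def)
    ultimately show "0 \<le> D" by linarith
    have "(K + 1) / (q - 1 / 2) \<le> D" by (simp add: D_def)
    then show "K + 1 \<le> D * (q - 1 / 2)" using q by (subst (asm) pos_divide_le_eq) auto
  qed
  have "(\<integral>\<^sup>+\<zeta>\<in>dyadic_arc \<theta> k. ennreal (norm (F \<zeta>)) \<partial>circle_measure) \<le> ennreal (D * q ^ k)" for \<theta> k
  proof (induction k)
    case 0
    have "(\<integral>\<^sup>+\<zeta>\<in>dyadic_arc \<theta> 0. ennreal (norm (F \<zeta>)) \<partial>circle_measure) \<le> (\<integral>\<^sup>+\<zeta>. ennreal (norm (F \<zeta>)) \<partial>circle_measure)"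
      by (intro nn_integral_mono) (auto simp: indicator_def)
    also have "\<dots> \<le> ennreal D" using all D(1) by (meson ennreal_leI order_trans)
    finally show ?case by simp
  next
    case (Suc k)
    define I J where "I = dyadic_arc \<theta> k" and "J = dyadic_arc \<theta> (Suc k)"
    have IJ: "I \<in> arcs" "J \<in> arcs" "J \<subseteq> I" "arc_len I = 1 / 2 ^ k" "arc_len J = arc_len I / 2"
      using dyadic_arc[of \<theta> k] dyadic_arc[of \<theta> "Suc k"] by (auto simp: I_def J_def)
    have "ennreal (norm (arc_mean F I) * arc_len I) \<le> ennreal (D * q ^ k)"
      using norm_arc_mean_le[OF Fm IJ(1)] Suc by (simp add: I_def)
    then have "norm (arc_mean F I) * arc_len I \<le> D * q ^ k"
      using D(3) q by (subst (asm) ennreal_le_iff) auto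
    then have mean: "norm (arc_mean F I) * arc_len J \<le> D * q ^ k / 2" by (simp add: IJ(5))
    have pw: "arc_len I powr (1 - \<beta>) = q ^ k"
      using powr_half_pow[of k "1 - \<beta>"] by (simp add: IJ(4) q_def)
    have "(\<integral>\<^sup>+\<zeta>\<in>J. ennreal (norm (F \<zeta>)) \<partial>circle_measure) \<le>
      ennreal ((K + 1) * q ^ k) + ennreal (norm (arc_mean F I)) * ennreal (arc_len J)"
      using split[OF IJ(1-3)] by (simp add: pw)
    also have "\<dots> = ennreal ((K + 1) * q ^ k + norm (arc_mean F I) * arc_len J)"
      using K q arc_len_pos[OF IJ(2)] by (simp add: ennreal_mult[symmetric] ennreal_plus[symmetric] del: ennreal_plus)
    also have "\<dots> \<le> ennreal (D * q ^ Suc k)"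
    proof (rule ennreal_leI)
      have "(K + 1) * q ^ k \<le> D * (q - 1 / 2) * q ^ k" using D(2) q by (intro mult_right_mono) auto
      then show "(K + 1) * q ^ k + norm (arc_mean F I) * arc_len J \<le> D * q ^ Suc k"
        using mean by (simp add: algebra_simps)
    qed
    finally show ?case by (simp add: J_def)
  qed
  then show ?thesis using D(3) unfolding q_def by blast
qed

text \<open>Take the last k \<le> n whose arc contains \<zeta>. If k < n, missing the next arc puts
  \<zeta> at distance at least 2^-k from \<open>cis \<theta>\<close>, hence at least half of that
  from z, since z is no farther from \<open>cis \<theta>\<close> than from \<zeta>. If k = n, the
  distance from z to the circle suffices.\<close>

lemma cauchy_kernel_dyadic:
  assumes z: "z = of_real (norm z) * cis \<theta>" "norm z < 1" and n: "1 / 2 ^ Suc n < 1 - norm z"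
    and \<zeta>: "norm \<zeta> = 1"
  shows "\<exists>k\<le>n. \<zeta> \<in> dyadic_arc \<theta> k \<and> 1 / norm (\<zeta> - z) \<le> 2 ^ Suc k"
proof -
  define d where "d = norm (\<zeta> - z)"
  have dd: "1 - norm z \<le> d" using norm_triangle_ineq2[of \<zeta> z] \<zeta> by (simp add: d_def)
  have "\<zeta> \<in> dyadic_arc \<theta> 0"
  proof -
    obtain s where s: "\<bar>s\<bar> \<le> pi" "\<zeta> = cis (\<theta> + s)" using unit_circle_arc[OF \<zeta>] by blast
    then show ?thesis unfolding dyadic_arc_def by (intro image_eqI[of _ _ "\<theta> + s"]) auto
  qed
  then have ne: "0 \<in> {k. k \<le> n \<and> \<zeta> \<in> dyadic_arc \<theta> k}" by simp
  define k where "k = Max {k. k \<le> n \<and> \<zeta> \<in> dyadic_arc \<theta> k}"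
  have fin: "finite {k. k \<le> n \<and> \<zeta> \<in> dyadic_arc \<theta> k}" by simp
  have k: "k \<le> n" "\<zeta> \<in> dyadic_arc \<theta> k" using Max_in[OF fin] ne unfolding k_def by blast+
  have "1 / d \<le> 2 ^ Suc k"
  proof (cases "k = n")
    case True
    have "1 / 2 ^ Suc n \<le> d" using n dd by linarith
    then show ?thesis using True z(2) dd by (simp add: field_simps)
  next
    case False
    then have "Suc k \<le> n" using k by simp
    then have "\<zeta> \<notin> dyadic_arc \<theta> (Suc k)" using Max_ge[OF fin, of "Suc k"] unfolding k_def[symmetric] by auto
    then have "2 * (1 / 2 ^ Suc k) \<le> norm (\<zeta> - cis \<theta>)"
      using chord_ge[OF \<zeta>, of "1 / 2 ^ Suc k" \<theta>] by (simp add: dyadic_arc_def)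
    also have "\<dots> \<le> d + norm (z - cis \<theta>)"
      using norm_triangle_ineq[of "\<zeta> - z" "z - cis \<theta>"] by (simp add: d_def)
    also have "norm (z - cis \<theta>) \<le> 1 - norm z" using norm_polar_diff[OF z, of \<theta>] by simp
    finally have "1 / 2 ^ Suc k \<le> d" using dd by simp
    then show ?thesis using z(2) dd by (simp add: field_simps)
  qed
  with k show ?thesis by (auto simp: d_def)
qed

text \<open>At scale 2^-k the kernel is at most 2^(k+1) and the integral of |F| at most D
  2^((\<beta>-1)k). Their products grow geometrically with ratio 2^\<beta> > 1, so the last term, at
  the scale of 1 - |z|, governs the sum. The constant depends on f.\<close>

lemma morrey_growth:
  assumes lam: "0 < lam" "lam < 1" and f: "f \<in> morrey lam"
  shows "\<exists>C>0. \<forall>z. norm z < 1 \<longrightarrow> norm (f z) \<le> C * (1 - norm z) powr ((lam - 1) / 2)"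
proof -
  define \<beta> where "\<beta> = (1 - lam) / 2"
  have \<beta>: "0 < \<beta>" "\<beta> < 1" "(lam - 1) / 2 = - \<beta>" "lam = 1 - 2 * \<beta>" using lam by (auto simp: \<beta>_def field_simps)
  obtain F where h: "f \<in> hardy2" and F: "boundary_function f F" and sup: "(SUP I\<in>arcs. (\<integral>\<^sup>+\<zeta>\<in>I. ennreal ((norm (F \<zeta> - arc_mean F I))\<^sup>2) \<partial>circle_measure)
        / ennreal (arc_len I powr lam)) < \<infinity>" (is "?S < _")
    using f by (auto simp: morrey_def)
  have Fm[measurable]: "F \<in> borel_measurable borel" using F by (simp add: boundary_function_def)
  obtain K where K: "0 \<le> K" "?S = ennreal K"
    using sup by (cases ?S rule: ennreal_cases) auto
  have "(\<integral>\<^sup>+\<zeta>\<in>I. ennreal ((norm (F \<zeta> - arc_mean F I))\<^sup>2) \<partial>circle_measure) \<le> ennreal (K * arc_len I powr (1 - 2 * \<beta>))"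
    if I: "I \<in> arcs" for I
  proof -
    have "(\<integral>\<^sup>+\<zeta>\<in>I. ennreal ((norm (F \<zeta> - arc_mean F I))\<^sup>2) \<partial>circle_measure) / ennreal (arc_len I powr lam) \<le> ?S"
      using I by (rule SUP_upper)
    then show ?thesis unfolding K(2) using K(1) arc_len_pos[OF I] by (subst (asm) ennreal_divide_le_iff) (auto simp: \<beta>(4))
  qed
  from dyadic_arc_integral_bound[OF Fm \<beta>(1,2) K(1) this] obtain D where
    D: "0 \<le> D" "\<And>\<theta> k. (\<integral>\<^sup>+\<zeta>\<in>dyadic_arc \<theta> k. ennreal (norm (F \<zeta>)) \<partial>circle_measure) \<le> ennreal (D * (2 powr (\<beta> - 1)) ^ k)"
    by blast
  define b :: real where "b = 2 powr \<beta>"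
  have "2 powr 0 < (2::real) powr \<beta>" by (subst powr_less_cancel_iff) (use \<beta> in auto)
  then have b: "1 < b" by (simp add: b_def)
  \<comment> \<open>The summand 1 makes the constant positive even for D = 0.\<close>
  define C where "C = 2 * D * b / (b - 1) + 1"
  have C: "C > 0" using b D by (auto simp: C_def intro!: add_nonneg_pos)
  have "norm (f z) \<le> C * (1 - norm z) powr (- \<beta>)" if z: "norm z < 1" for z
  proof -
    obtain \<theta> where \<theta>: "z = of_real (norm z) * cis \<theta>"
      by (metis rcis_cmod_Arg rcis_def)
    obtain n :: nat where n: "1 / 2 ^ Suc n < 1 - norm z" "1 - norm z \<le> 1 / 2 ^ n"
      using dyadic_exists[of "1 - norm z" 1] z by auto
    have [measurable]: "dyadic_arc \<theta> k \<in> sets borel" for k using dyadic_arc(1) by measurable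
    have "ennreal (norm (f z)) \<le> (\<integral>\<^sup>+\<zeta>. ennreal (norm (F \<zeta>) / norm (1 - z * cnj \<zeta>)) \<partial>circle_measure)"
      by (rule hardy2_cauchy_bound[OF h F z])
    also have "\<dots> \<le> (\<integral>\<^sup>+\<zeta>. (\<Sum>k\<le>n. ennreal (2 ^ Suc k) * (ennreal (norm (F \<zeta>)) * indicator (dyadic_arc \<theta> k) \<zeta>)) \<partial>circle_measure)"
    proof (rule nn_integral_mono_AE, use AE_circle_norm in eventually_elim)
      fix \<zeta> :: complex assume \<zeta>: "norm \<zeta> = 1"
      obtain k where k: "k \<le> n" "\<zeta> \<in> dyadic_arc \<theta> k" "1 / norm (\<zeta> - z) \<le> 2 ^ Suc k"
        using cauchy_kernel_dyadic[OF \<theta> z n(1) \<zeta>] by blast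
      have "norm (F \<zeta>) / norm (1 - z * cnj \<zeta>) = 1 / norm (\<zeta> - z) * norm (F \<zeta>)"
        by (simp add: norm_one_minus_mult_cnj[OF \<zeta>])
      also have "\<dots> \<le> 2 ^ Suc k * norm (F \<zeta>)" by (rule mult_right_mono[OF k(3)]) simp
      finally have "ennreal (norm (F \<zeta>) / norm (1 - z * cnj \<zeta>)) \<le> ennreal (2 ^ Suc k) * (ennreal (norm (F \<zeta>)) * indicator (dyadic_arc \<theta> k) \<zeta>)"
        using k(2) by (simp add: ennreal_mult[symmetric] ennreal_leI)
      also have "\<dots> \<le> (\<Sum>k\<le>n. ennreal (2 ^ Suc k) * (ennreal (norm (F \<zeta>)) * indicator (dyadic_arc \<theta> k) \<zeta>))"
        using k(1) by (intro member_le_sum) auto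
      finally show "ennreal (norm (F \<zeta>) / norm (1 - z * cnj \<zeta>)) \<le> \<dots>" .
    qed
    also have "\<dots> = (\<Sum>k\<le>n. ennreal (2 ^ Suc k) * (\<integral>\<^sup>+\<zeta>\<in>dyadic_arc \<theta> k. ennreal (norm (F \<zeta>)) \<partial>circle_measure))"
      by (subst nn_integral_sum) (auto simp: nn_integral_cmult)
    also have "\<dots> \<le> (\<Sum>k\<le>n. ennreal (2 ^ Suc k) * ennreal (D * (2 powr (\<beta> - 1)) ^ k))"
      by (intro sum_mono mult_left_mono D(2)) auto
    also have "\<dots> = ennreal (\<Sum>k\<le>n. 2 ^ Suc k * (D * (2 powr (\<beta> - 1)) ^ k))"
      using D(1) by (simp add: ennreal_mult[symmetric] sum_ennreal)
    finally have "norm (f z) \<le> (\<Sum>k\<le>n. 2 ^ Suc k * (D * (2 powr (\<beta> - 1)) ^ k))"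
      using D(1) by (subst (asm) ennreal_le_iff) (auto intro!: sum_nonneg)
    also have "\<dots> = (\<Sum>k\<le>n. 2 * D * b ^ k)"
    proof (rule sum.cong[OF refl])
      fix k
      have "2 * 2 powr (\<beta> - 1) = b" by (simp add: b_def powr_diff)
      then have "b ^ k = 2 ^ k * (2 powr (\<beta> - 1)) ^ k" by (metis power_mult_distrib)
      then show "2 ^ Suc k * (D * (2 powr (\<beta> - 1)) ^ k) = 2 * D * b ^ k" by simp
    qed
    also have "\<dots> = 2 * D * (\<Sum>k<Suc n. b ^ k)" by (simp add: sum_distrib_left lessThan_Suc_atMost)
    also have "(\<Sum>k<Suc n. b ^ k) = (b ^ Suc n - 1) / (b - 1)" using b by (subst geometric_sum) auto
    also have "2 * D * \<dots> \<le> 2 * D * (b ^ Suc n / (b - 1))"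
      using b D(1) by (intro mult_left_mono divide_right_mono) auto
    also have "\<dots> = 2 * D * b / (b - 1) * b ^ n" by simp
    finally have le: "norm (f z) \<le> 2 * D * b / (b - 1) * b ^ n" .
    have "b ^ n = (1 / 2 ^ n) powr (- \<beta>)" using powr_half_pow[of n "- \<beta>"] by (simp add: b_def)
    also have "\<dots> \<le> (1 - norm z) powr (- \<beta>)"
      using n z \<beta> by (intro powr_mono2') auto
    finally have "2 * D * b / (b - 1) * b ^ n \<le> C * (1 - norm z) powr (- \<beta>)"
      using b D(1) by (intro mult_mono) (auto simp: C_def)
    with le show ?thesis by linarith
  qed
  with C \<beta>(3) show ?thesis by metis
qed

section \<open>The operator\<close>

text \<open>On the convex disc the integrand has a primitive, from which the integral along the
  segment differs by a constant.\<close>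

lemma has_field_derivative_T_op:
  assumes f: "f holomorphic_on ball 0 1" and g: "g holomorphic_on ball 0 1" and z: "norm z < 1"
  shows "(T_op g f has_field_derivative f z * deriv g z) (at z)"
proof -
  have hol: "(\<lambda>w. f w * deriv g w) holomorphic_on ball 0 1"
    using f g by (intro holomorphic_intros holomorphic_deriv) auto
  obtain P where P: "\<And>w. w \<in> ball 0 1 \<Longrightarrow> (P has_field_derivative f w * deriv g w) (at w within ball 0 1)"
    using holomorphic_convex_primitive'[OF convex_ball open_ball hol] by auto
  have T: "T_op g f w = P w - P 0" if w: "w \<in> ball 0 1" for w
  proof -
    have "path_image (linepath 0 w) \<subseteq> ball 0 1"
      unfolding path_image_linepath using w by (intro closed_segment_subset) auto
    then have "((\<lambda>w. f w * deriv g w) has_contour_integral (P (pathfinish (linepath 0 w)) - P (pathstart (linepath 0 w)))) (linepath 0 w)"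
      by (intro contour_integral_primitive[OF P]) auto
    then show ?thesis by (simp add: T_op_def contour_integral_unique)
  qed
  have "(P has_field_derivative f z * deriv g z) (at z)"
    using P[of z] z by (simp add: at_within_open[OF _ open_ball])
  then have "((\<lambda>w. P w - P 0) has_field_derivative f z * deriv g z) (at z)"
    by (auto intro!: derivative_eq_intros)
  then show ?thesis
    by (rule has_field_derivative_transform_within_open[of _ _ _ "ball 0 1"]) (use z T in auto)
qed

lemma T_op_holomorphic:
  assumes "f holomorphic_on ball 0 1" "g holomorphic_on ball 0 1"
  shows "T_op g f holomorphic_on ball 0 1"
  unfolding holomorphic_on_open[OF open_ball]
  using has_field_derivative_T_op[OF assms] by fastforce

lemma T_op_0 [simp]: "T_op g f 0 = 0"
  by (simp add: T_op_def)

lemma bloch_norm_T_op: "bloch_norm (T_op g f) = bloch_seminorm (T_op g f)"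
  by (simp add: bloch_norm_def)

lemma bloch_seminorm_T_op:
  assumes "f holomorphic_on ball 0 1" "g holomorphic_on ball 0 1"
  shows "bloch_seminorm (T_op g f) = (SUP z\<in>ball 0 1. ennreal ((1 - (norm z)\<^sup>2) * (norm (f z) * norm (deriv g z))))"
  unfolding bloch_seminorm_def
  by (intro SUP_cong refl) (use DERIV_imp_deriv[OF has_field_derivative_T_op[OF assms]] in \<open>simp add: norm_mult\<close>)

text \<open>The exponents 1, (\<lambda>-1)/2 and -(\<lambda>+1)/2 sum to 0, so the product of the
  two growth bounds exactly balances the Bloch weight; the 2 is from 1 - |z|^2 \<le> 2 (1 -
  |z|).\<close>

lemma bloch_seminorm_T_op_le:
  assumes f: "f holomorphic_on ball 0 1" and g: "g holomorphic_on ball 0 1"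
    and fb: "\<And>z. norm z < 1 \<Longrightarrow> norm (f z) \<le> A * (1 - norm z) powr ((lam - 1) / 2)"
    and gb: "\<And>z. norm z < 1 \<Longrightarrow> norm (deriv g z) \<le> m * (1 - norm z) powr (- (lam + 1) / 2)"
  shows "bloch_seminorm (T_op g f) \<le> ennreal (2 * A * m)"
  unfolding bloch_seminorm_T_op[OF f g]
proof (rule SUP_least, rule ennreal_leI)
  fix z :: complex assume "z \<in> ball 0 1"
  then have z: "norm z < 1" by simp
  define d where "d = 1 - norm z"
  have d: "0 < d" using z by (simp add: d_def)
  have A: "0 \<le> A * d powr ((lam - 1) / 2)" using order_trans[OF norm_ge_zero fb[OF z]] by (simp add: d_def)
  have fg: "norm (f z) * norm (deriv g z) \<le> (A * d powr ((lam - 1) / 2)) * (m * d powr (- (lam + 1) / 2))"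
    using fb[OF z] gb[OF z] A by (intro mult_mono) (auto simp: d_def)
  have "(1 - (norm z)\<^sup>2) * (norm (f z) * norm (deriv g z)) \<le> 2 * d * ((A * d powr ((lam - 1) / 2)) * (m * d powr (- (lam + 1) / 2)))"
    using one_minus_norm_sq[OF z] by (intro mult_mono[OF _ fg]) (auto simp: d_def)
  also have "\<dots> = 2 * A * m * (d powr 1 * d powr ((lam - 1) / 2) * d powr (- (lam + 1) / 2))"
    using d by simp
  also have "d powr 1 * d powr ((lam - 1) / 2) * d powr (- (lam + 1) / 2) = d powr 0"
    unfolding powr_add[symmetric] by (rule arg_cong[of _ _ "\<lambda>x. d powr x"]) (simp add: field_simps)
  finally show "(1 - (norm z)\<^sup>2) * (norm (f z) * norm (deriv g z)) \<le> 2 * A * m" using d by simp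
qed

lemma T_op_linear:
  assumes g: "g holomorphic_on ball 0 1" and z: "z \<in> ball 0 1" and f: "f holomorphic_on ball 0 1"
  shows "h holomorphic_on ball 0 1 \<Longrightarrow> T_op g (\<lambda>w. f w + h w) z = T_op g f z + T_op g h z"
    and "T_op g (\<lambda>w. c * f w) z = c * T_op g f z"
proof -
  have sub: "closed_segment 0 z \<subseteq> ball 0 1" using z by (intro closed_segment_subset) auto
  have int: "(\<lambda>w. u w * deriv g w) contour_integrable_on linepath 0 z" if "u holomorphic_on ball 0 1" for u
  proof (rule contour_integrable_continuous_linepath)
    show "continuous_on (closed_segment 0 z) (\<lambda>w. u w * deriv g w)"
      using that g sub by (intro holomorphic_on_imp_continuous_on holomorphic_on_subset[OF _ sub] holomorphic_intros holomorphic_deriv) auto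
  qed
  show "T_op g (\<lambda>w. f w + h w) z = T_op g f z + T_op g h z" if "h holomorphic_on ball 0 1"
    using int[OF f] int[OF that] by (simp add: T_op_def distrib_right contour_integral_add)
  show "T_op g (\<lambda>w. c * f w) z = c * T_op g f z"
    using int[OF f] by (simp add: T_op_def mult.assoc contour_integral_lmul)
qed

section \<open>The operator norm against the pointwise bound for g'\<close>

lemma morrey_holomorphic: "f \<in> morrey lam \<Longrightarrow> f holomorphic_on ball 0 1"
  by (simp add: morrey_def hardy2_def)

text \<open>For each z the operator is tested on the function adapted to that same z, and the Bloch
  supremum is evaluated only there; dividing by |f(z)| isolates g'(z).\<close>

lemma T_norm_imp_deriv_bound:
  assumes lam: "0 < lam" "lam < 1"
  shows "\<exists>C>0. \<forall>g m. g holomorphic_on ball 0 1 \<longrightarrow> 0 \<le> m \<longrightarrow> T_norm lam g \<le> ennreal m \<longrightarrow>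
    (\<forall>z. norm z < 1 \<longrightarrow> norm (deriv g z) \<le> C * m * (1 - norm z) powr (- (lam + 1) / 2))"
proof -
  obtain k where k: "k > 0" "\<And>b. norm b < 1 \<Longrightarrow> \<exists>f\<in>morrey lam. morrey_norm lam f \<le> 1 \<and>
     norm (f b) = k * (1 - (norm b)\<^sup>2) powr ((lam - 1) / 2)"
    using morrey_test_functions[OF lam] by blast
  have "norm (deriv g z) \<le> 1 / k * m * (1 - norm z) powr (- (lam + 1) / 2)"
    if g: "g holomorphic_on ball 0 1" and m: "0 \<le> m" "T_norm lam g \<le> ennreal m" and z: "norm z < 1" for g m z
  proof -
    obtain f where f: "f \<in> morrey lam" "morrey_norm lam f \<le> 1" "norm (f z) = k * (1 - (norm z)\<^sup>2) powr ((lam - 1) / 2)"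
      using k(2)[OF z] by blast
    define y where "y = 1 - (norm z)\<^sup>2"
    have y: "0 < y" "1 - norm z \<le> y" using one_minus_norm_sq[OF z] by (auto simp: y_def)
    have "ennreal (y * (norm (f z) * norm (deriv g z))) \<le> bloch_seminorm (T_op g f)"
      unfolding bloch_seminorm_T_op[OF morrey_holomorphic[OF f(1)] g] y_def using z by (intro SUP_upper) auto
    also have "\<dots> \<le> T_norm lam g"
      unfolding operator_norm_def bloch_norm_T_op using f by (intro SUP_upper) auto
    finally have "y * (norm (f z) * norm (deriv g z)) \<le> m"
      using m by (meson ennreal_le_iff order_trans)
    then have "k * (y powr 1 * y powr ((lam - 1) / 2)) * norm (deriv g z) \<le> m"
      using f(3) y by (simp add: y_def ac_simps)
    also have "y powr 1 * y powr ((lam - 1) / 2) = y powr ((lam + 1) / 2)"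
      unfolding powr_add[symmetric] by (rule arg_cong[of _ _ "\<lambda>x. y powr x"]) (simp add: field_simps)
    finally have "norm (deriv g z) * (k * y powr ((lam + 1) / 2)) \<le> m" by (simp add: ac_simps)
    then have "norm (deriv g z) \<le> m / (k * y powr ((lam + 1) / 2))"
      using k(1) y(1) by (subst pos_le_divide_eq) auto
    also have "\<dots> = 1 / k * m * y powr (- (lam + 1) / 2)"
      using powr_minus_divide[of y "(lam + 1) / 2"] by (simp add: minus_divide_left)
    also have "\<dots> \<le> 1 / k * m * (1 - norm z) powr (- (lam + 1) / 2)"
      using k(1) m(1) y z lam by (intro mult_left_mono powr_mono2') auto
    finally show ?thesis .
  qed
  then show ?thesis using k(1) by (intro exI[of _ "1 / k"]) auto
qed

text \<open>For \<open>f\<close> in the Morrey space of infinite Carleson norm, membership of \<open>T_op g f\<close> in the Bloch space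
  cannot come from the norm inequality, hence the appeal to the growth estimate
  derived from the boundary condition.\<close>

lemma deriv_bound_imp_T_bounded:
  assumes lam: "0 < lam" "lam < 1"
  shows "\<exists>C>0. \<forall>g m. g holomorphic_on ball 0 1 \<longrightarrow> 0 \<le> m \<longrightarrow>
    (\<forall>z. norm z < 1 \<longrightarrow> norm (deriv g z) \<le> m * (1 - norm z) powr (- (lam + 1) / 2)) \<longrightarrow>
    T_bounded lam g \<and> T_norm lam g \<le> ennreal (C * m)"
proof -
  obtain A where A: "A > 0" "\<And>f m z. f holomorphic_on ball 0 1 \<Longrightarrow> 0 \<le> m \<Longrightarrow> morrey_norm lam f \<le> ennreal m \<Longrightarrow>
    norm z < 1 \<Longrightarrow> norm (f z) \<le> A * m * (1 - norm z) powr ((lam - 1) / 2)"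
    using morrey_norm_growth[OF lam] by blast
  have "T_bounded lam g \<and> T_norm lam g \<le> ennreal (2 * A * m)"
    if g: "g holomorphic_on ball 0 1" and m: "0 \<le> m"
      and gb: "\<And>z. norm z < 1 \<Longrightarrow> norm (deriv g z) \<le> m * (1 - norm z) powr (- (lam + 1) / 2)" for g m
  proof -
    have bd: "bloch_norm (T_op g f) \<le> ennreal (2 * A * m * t)"
      if f: "f \<in> morrey lam" and t: "0 \<le> t" "morrey_norm lam f \<le> ennreal t" for f t
      using bloch_seminorm_T_op_le[OF morrey_holomorphic[OF f] g A(2)[OF morrey_holomorphic[OF f] t] gb]
      by (simp add: bloch_norm_T_op ac_simps)
    have "T_op g f \<in> bloch" if f: "f \<in> morrey lam" for f
    proof -
      \<comment> \<open>A constant depending on f is enough, since only finiteness of the seminorm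
        is at stake.\<close>
      obtain C where "\<And>z. norm z < 1 \<Longrightarrow> norm (f z) \<le> C * (1 - norm z) powr ((lam - 1) / 2)"
        using morrey_growth[OF lam f] by blast
      then have "bloch_seminorm (T_op g f) \<le> ennreal (2 * C * m)"
        using bloch_seminorm_T_op_le[OF morrey_holomorphic[OF f] g _ gb] by blast
      then have "bloch_seminorm (T_op g f) < \<infinity>" by (rule le_less_trans) simp
      then show ?thesis using T_op_holomorphic[OF morrey_holomorphic[OF f] g] by (simp add: bloch_def)
    qed
    \<comment> \<open>The summand 1 keeps the factor positive: if the Morrey norm is infinite, the
      right side is then infinite too, whereas 0 times infinity is 0 in
      \<open>ennreal\<close>.\<close>
    moreover have "bloch_norm (T_op g f) \<le> ennreal (2 * A * m + 1) * morrey_norm lam f" if f: "f \<in> morrey lam" for f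
    proof (cases "morrey_norm lam f" rule: ennreal_cases)
      case (real t)
      have "bloch_norm (T_op g f) \<le> ennreal (2 * A * m * t)" using bd[OF f real(1)] real(2) by simp
      also have "\<dots> \<le> ennreal ((2 * A * m + 1) * t)" using real(1) by (intro ennreal_leI mult_right_mono) auto
      also have "\<dots> = ennreal (2 * A * m + 1) * morrey_norm lam f"
        using A(1) m real by (simp add: ennreal_mult)
      finally show ?thesis .
    next
      case top
      have "0 < 2 * A * m + 1" using A(1) m by (simp add: add_nonneg_pos)
      then show ?thesis using top by (simp add: ennreal_mult_top)
    qed
    moreover have "0 \<le> 2 * A * m + 1" using A(1) m by simp
    ultimately have "T_bounded lam g"
      unfolding bounded_operator_def using T_op_linear[OF g] morrey_holomorphic by blast
    moreover have "T_norm lam g \<le> ennreal (2 * A * m)"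
      unfolding operator_norm_def using bd[of _ 1] by (intro SUP_least) auto
    ultimately show ?thesis by simp
  qed
  then show ?thesis using A(1) by (intro exI[of _ "2 * A"]) auto
qed

lemma T_bounded_imp_T_norm_finite:
  assumes "T_bounded lam g"
  shows "T_norm lam g < \<infinity>"
proof -
  obtain K where K: "K \<ge> 0" "\<And>f. f \<in> morrey lam \<Longrightarrow> bloch_norm (T_op g f) \<le> ennreal K * morrey_norm lam f"
    using assms by (auto simp: bounded_operator_def)
  have "T_norm lam g \<le> ennreal K"
    unfolding operator_norm_def
  proof (rule SUP_least)
    fix f assume "f \<in> {f \<in> morrey lam. morrey_norm lam f \<le> 1}"
    then show "bloch_norm (T_op g f) \<le> ennreal K"
      using K(2)[of f] mult_left_mono[of "morrey_norm lam f" 1 "ennreal K"] by auto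
  qed
  then show ?thesis by (rule le_less_trans) simp
qed

theorem theorem3p2:
  fixes lam :: real
  assumes "0 < lam" and "lam < 1"
  shows "(\<forall>g. g holomorphic_on ball 0 1 \<longrightarrow>
            (T_bounded lam g \<longleftrightarrow> (\<forall>p>1. g \<in> bloch_morrey p lam)) \<and>
            (T_bounded lam g \<longleftrightarrow> (\<exists>p>1. g \<in> bloch_morrey p lam))) \<and>
         (\<forall>p>1. \<exists>C>0. \<forall>g. g holomorphic_on ball 0 1 \<longrightarrow> T_bounded lam g \<longrightarrow>
            ennreal (1 / C) * bm_seminorm p lam g \<le> T_norm lam g \<and>
            T_norm lam g \<le> ennreal C * bm_seminorm p lam g)"
proof -
  obtain A where A: "A > 0" "\<And>g m z. g holomorphic_on ball 0 1 \<Longrightarrow> 0 \<le> m \<Longrightarrow> T_norm lam g \<le> ennreal m \<Longrightarrow>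
    norm z < 1 \<Longrightarrow> norm (deriv g z) \<le> A * m * (1 - norm z) powr (- (lam + 1) / 2)"
    using T_norm_imp_deriv_bound[OF assms] by blast
  obtain B where B: "B > 0" "\<And>g m. g holomorphic_on ball 0 1 \<Longrightarrow> 0 \<le> m \<Longrightarrow>
    (\<And>z. norm z < 1 \<Longrightarrow> norm (deriv g z) \<le> m * (1 - norm z) powr (- (lam + 1) / 2)) \<Longrightarrow>
    T_bounded lam g \<and> T_norm lam g \<le> ennreal (B * m)"
    using deriv_bound_imp_T_bounded[OF assms] by blast
  have up: "\<exists>C>0. \<forall>g m. g holomorphic_on ball 0 1 \<longrightarrow> 0 \<le> m \<longrightarrow> bm_seminorm p lam g \<le> ennreal m \<longrightarrow>
      T_bounded lam g \<and> T_norm lam g \<le> ennreal (C * m)" if p: "1 < p" for p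
  proof -
    obtain C where C: "C > 0" "\<And>g m z. g holomorphic_on ball 0 1 \<Longrightarrow> 0 \<le> m \<Longrightarrow> bm_seminorm p lam g \<le> ennreal m \<Longrightarrow>
      norm z < 1 \<Longrightarrow> norm (deriv g z) \<le> C * m * (1 - norm z) powr (- (lam + 1) / 2)"
      using bm_seminorm_imp_deriv_bound[OF assms p] by blast
    have "T_bounded lam g \<and> T_norm lam g \<le> ennreal (B * C * m)"
      if "g holomorphic_on ball 0 1" "0 \<le> m" "bm_seminorm p lam g \<le> ennreal m" for g m
      using B(2)[OF that(1) _ C(2)[OF that]] C(1) that(2) by (simp add: mult.assoc)
    then show ?thesis using B(1) C(1) by (intro exI[of _ "B * C"]) auto
  qed
  have lo: "\<exists>C>0. \<forall>g m. g holomorphic_on ball 0 1 \<longrightarrow> 0 \<le> m \<longrightarrow> T_norm lam g \<le> ennreal m \<longrightarrow>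
      bm_seminorm p lam g \<le> ennreal (C * m)" if p: "1 < p" for p
  proof -
    obtain C where C: "C > 0" "\<And>g m. 0 \<le> m \<Longrightarrow>
      (\<And>z. norm z < 1 \<Longrightarrow> norm (deriv g z) \<le> m * (1 - norm z) powr (- (lam + 1) / 2)) \<Longrightarrow>
      bm_seminorm p lam g \<le> ennreal (C * m)"
      using deriv_bound_imp_bm_seminorm[OF assms p] by blast
    have "bm_seminorm p lam g \<le> ennreal (C * A * m)"
      if "g holomorphic_on ball 0 1" "0 \<le> m" "T_norm lam g \<le> ennreal m" for g m
      using C(2)[OF _ A(2)[OF that]] A(1) that(2) by (simp add: mult.assoc)
    then show ?thesis using A(1) C(1) by (intro exI[of _ "C * A"]) auto
  qed
  have bm_fin: "bm_seminorm p lam g < \<infinity>"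
    if p: "1 < p" and g: "g holomorphic_on ball 0 1" and T: "T_bounded lam g" for p g
  proof -
    obtain m where m: "0 \<le> m" "T_norm lam g = ennreal m"
      using T_bounded_imp_T_norm_finite[OF T] by (cases "T_norm lam g" rule: ennreal_cases) auto
    then obtain C where "bm_seminorm p lam g \<le> ennreal (C * m)"
      using lo[OF p] g by fastforce
    then show ?thesis by (rule le_less_trans) (simp only: infinity_ennreal_def ennreal_less_top)
  qed
  have bdd: "T_bounded lam g"
    if p: "1 < p" and g: "g holomorphic_on ball 0 1" and fin: "bm_seminorm p lam g < \<infinity>" for p g
  proof -
    obtain m where "0 \<le> m" "bm_seminorm p lam g = ennreal m"
      using fin by (cases "bm_seminorm p lam g" rule: ennreal_cases) auto
    then show ?thesis using up[OF p] g by fastforce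
  qed
  have equiv: "(T_bounded lam g \<longleftrightarrow> (\<forall>p>1. g \<in> bloch_morrey p lam)) \<and>
            (T_bounded lam g \<longleftrightarrow> (\<exists>p>1. g \<in> bloch_morrey p lam))" if g: "g holomorphic_on ball 0 1" for g
  proof -
    have 1: "\<forall>p>1. g \<in> bloch_morrey p lam" if "T_bounded lam g"
      using bm_fin g that by (auto simp: bloch_morrey_def)
    have 2: "T_bounded lam g" if "\<exists>p>1. g \<in> bloch_morrey p lam"
      using bdd g that by (auto simp: bloch_morrey_def)
    \<comment> \<open>Any exponent above 1 is a witness; 2 is taken.\<close>
    have 3: "\<exists>p>1. g \<in> bloch_morrey p lam" if "\<forall>p>1. g \<in> bloch_morrey p lam"
      using that by (intro exI[of _ 2]) auto
    show ?thesis using 1 2 3 by blast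
  qed
  have norms: "\<exists>C>0. \<forall>g. g holomorphic_on ball 0 1 \<longrightarrow> T_bounded lam g \<longrightarrow>
            ennreal (1 / C) * bm_seminorm p lam g \<le> T_norm lam g \<and>
            T_norm lam g \<le> ennreal C * bm_seminorm p lam g" if p: "1 < p" for p
  proof -
    obtain C1 where C1: "C1 > 0" "\<And>g m. g holomorphic_on ball 0 1 \<Longrightarrow> 0 \<le> m \<Longrightarrow> bm_seminorm p lam g \<le> ennreal m \<Longrightarrow>
      T_norm lam g \<le> ennreal (C1 * m)" using up[OF p] by blast
    obtain C2 where C2: "C2 > 0" "\<And>g m. g holomorphic_on ball 0 1 \<Longrightarrow> 0 \<le> m \<Longrightarrow> T_norm lam g \<le> ennreal m \<Longrightarrow>
      bm_seminorm p lam g \<le> ennreal (C2 * m)" using lo[OF p] by blast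
    define C where "C = max C1 C2"
    have C: "C > 0" "C1 \<le> C" "C2 \<le> C" using C1(1) by (auto simp: C_def)
    have "ennreal (1 / C) * bm_seminorm p lam g \<le> T_norm lam g \<and> T_norm lam g \<le> ennreal C * bm_seminorm p lam g"
      if g: "g holomorphic_on ball 0 1" and T: "T_bounded lam g" for g
    proof -
      \<comment> \<open>Boundedness of the operator makes both quantities finite, so they can be
        compared as reals, each serving as the bound in the estimate of the other.\<close>
      obtain m where m: "0 \<le> m" "bm_seminorm p lam g = ennreal m"
        using bm_fin[OF p g T] by (cases "bm_seminorm p lam g" rule: ennreal_cases) auto
      obtain t where t: "0 \<le> t" "T_norm lam g = ennreal t"
        using T_bounded_imp_T_norm_finite[OF T] by (cases "T_norm lam g" rule: ennreal_cases) auto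
      have "ennreal t \<le> ennreal (C1 * m)" "ennreal m \<le> ennreal (C2 * t)"
        using C1(2)[OF g m(1)] C2(2)[OF g t(1)] m t by auto
      then have "t \<le> C1 * m" "m \<le> C2 * t" using C1(1) C2(1) m t by (auto simp: ennreal_le_iff)
      moreover have "C1 * m \<le> C * m" "C2 * t \<le> C * t" using C m t by (auto intro: mult_right_mono)
      ultimately have "t \<le> C * m" "1 / C * m \<le> t" using C(1) by (auto simp: field_simps)
      then show ?thesis using C(1) m t by (simp add: ennreal_mult[symmetric] ennreal_leI)
    qed
    with C(1) show ?thesis by blast
  qed
  from equiv norms show ?thesis by blast
qed

end
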